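(* For every integer $n\ge 1$, the family $$\left\{R_{2k_1+1}\wedge R_{2k_2+1}\wedge\dots\wedge R_{2k_p+1}\ :\ p\ge 1,\ 0\le k_1<k_2<\dots<k_p \text{ integers},\ \sum_{i=1}^p(2k_i+1)=n\right\}$$ is a basis of the $n$-th Chevalley cohomology space $H^n$ of vectorial aerial graphs (more precisely, the classes of these elements form a basis of $H^n$). In other words, the Chevalley cohomology of vectorial graphs is given by the wheels of odd length.
   Context: **Graphs.** A vectorial aerial graph $\Delta$ with $n$ vertices is a directed graph with vertices labelled $1,\dots,n$ (or by another totally ordered $n$-element set), such that at most one arrow starts from each vertex. Loops $\overrightarrow{ii}$ are allowed, and there are no multiple arrows (but $\overrightarrow{ij}$ and $\overrightarrow{ji}$ may both occur). $Deb(i)$ is the set of arrows starting at $i$ (so $|Deb(i)|\in\{0,1\}$), and $Fin(i)$ is the set of arrows ending at $i$; a loop at $i$ belongs to both. **Symmetric combinations.** For $\sigma\in S_n$, $\sigma(\Delta)$ is the graph with arrows $\overrightarrow{\sigma(a)\sigma(b)}$ for $\overrightarrow{ab}$ an arrow of $\Delta$. Let $\varepsilon_{|Deb(\Delta)|}(\sigma)$ be the signature of the permutation induced by $\sigma$ on the vertices with $|Deb|=1$, i.e. $(-1)^N$ with $N$ the number of pairs $a<b$ such that $|Deb(a)|=|Deb(b)|=1$ and $\sigma(a)>\sigma(b)$. A finite real linear combination $\delta=\sum_\Delta a_\Delta\Delta$ of vectorial aerial graphs with $n$ vertices is symmetric if $a_{\sigma(\Delta)}=\varepsilon_{|Deb(\Delta)|}(\sigma)a_\Delta$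 for all $\Delta$ and $\sigma$. The symmetrization of $\Delta$ is $S(\Delta)=\sum_{\sigma\in S_n}\varepsilon_{|Deb(\Delta)|}(\sigma)\,\sigma(\Delta)$. **Coboundary.** For $\delta=\sum_\Delta a_\Delta\Delta$ symmetric with $n$ vertices, $\partial\delta=\sum_\Delta a_\Delta\,\partial\Delta$ is a symmetric combination of graphs with vertices labelled $0,\dots,n$ (afterwards relabelled $1,\dots,n+1$ increasingly), where $$\partial\Delta=-\sum_{i\ne j,\ 0\le i,j\le n}\varepsilon_{|Deb|}(j,0,\dots,\hat\jmath,\dots,n)\sum_{\Delta'_{ji}}\Delta'_{ji}.$$ Here, for given $i\neq j$, the vertices of $\Delta$ are relabelled increasingly by $\{0,\dots,n\}\setminus\{j\}$, and the inner sum runs over all proper splittings $\Delta'_{ji}$ of the vertex $i$: one adds a new vertex $j$ and an arrow $\overrightarrow{ji}$; if $i$ has an outgoing arrow, it still starts from $i$; each arrow of $\Delta$ ending at $i$ is made to end either at $i$ or at $j$. If $i$ is isolated in $\Delta$, there is exactly one $\Delta'_{ji}$ (add $j$ and $\overrightarrow{ji}$). If $i$ is not isolated, one keeps exactly those redistributions for which both $i$ and $j$ satisfy $|Deb|+|Fin|>1$ in the new graph. The sign is $\varepsilon_{|Deb|}(j,0,\dots,\hat\jmath,\dots,n)=(-1)^{\#\{a<j\,:\,|Deb(a)|=1\text{ in }\Delta'_{ji}\}}$ (note $|Deb(j)|=1$). **Cohomology.** $Z^n$ is the space of symmetric combinations $\delta$ of vectorial aerial graphs with $n$ vertices such that $\partial\delta=0$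 (cocycles); $B^n$ is the space of the $\partial\beta$ with $\beta$ a symmetric combination of vectorial aerial graphs with $n-1$ vertices (coboundaries; $B^1=0$); $H^n=Z^n/B^n$. **Wheels.** The simple wheel $\Delta_k$ of length $k$ is the graph with vertices $1,\dots,k$ and arrows $\overrightarrow{12},\overrightarrow{23},\dots,\overrightarrow{(k-1)k},\overrightarrow{k1}$ (for $k=1$, a loop), and $R_k=S(\Delta_k)$. For $m_1<\dots<m_p$ odd, $R_{m_1}\wedge\dots\wedge R_{m_p}$ denotes $S(\Delta_{m_1}\wedge\dots\wedge\Delta_{m_p})$, where $\Delta_{m_1}\wedge\dots\wedge\Delta_{m_p}$ is the disjoint union of the simple wheels, labelled consecutively: first wheel on $1,\dots,m_1$, second on $m_1+1,\dots,m_1+m_2$, etc., each with its arrows in cyclic increasing order. *)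

theory Defs
  imports
    "HOL-Analysis.Finite_Function_Topology"
    "HOL-Combinatorics.Permutations"
    "HOL-Algebra.Module"
begin

section \<open>Bases of quotient vector spaces\<close>

text \<open>
  The quotient of a real subspace \<open>Z\<close> by a subspace \<open>B\<close>: the elements are the cosets
  \<open>z + B\<close>. The ring multiplication that the record type carries is irrelevant for a module.
\<close>

definition coset_class :: "'a::real_vector set \<Rightarrow> 'a \<Rightarrow> 'a set" where
  "coset_class B z = {z + b | b. b \<in> B}"

definition quotient_space :: "'a::real_vector set \<Rightarrow> 'a set \<Rightarrow> (real, 'a set) module" where
  "quotient_space Z B =
     \<lparr>carrier = coset_class B ` Z,
      mult = undefined,
      one = undefined,
      zero = coset_class B 0,
      add = (\<lambda>X Y. {x + y | x y. x \<in> X \<and> y \<in> Y}),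
      smult = (\<lambda>c X. {c *\<^sub>R x + b | x b. x \<in> X \<and> b \<in> B})\<rparr>"

definition is_basis_family :: "(real, 'b) module \<Rightarrow> 'i set \<Rightarrow> ('i \<Rightarrow> 'b) \<Rightarrow> bool" where
  "is_basis_family M I v \<longleftrightarrow>
     v \<in> I \<rightarrow> carrier M \<and>
     (\<forall>J c. finite J \<and> J \<subseteq> I \<and> (\<Oplus>\<^bsub>M\<^esub>i\<in>J. c i \<odot>\<^bsub>M\<^esub> v i) = \<zero>\<^bsub>M\<^esub> \<longrightarrow> (\<forall>i\<in>J. c i = 0)) \<and>
     (\<forall>x\<in>carrier M. \<exists>J c. finite J \<and> J \<subseteq> I \<and> x = (\<Oplus>\<^bsub>M\<^esub>i\<in>J. c i \<odot>\<^bsub>M\<^esub> v i))"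


section \<open>Vectorial aerial graphs\<close>

text \<open>A graph is its set of arrows; the vertex set is always given separately.\<close>

type_synonym vgraph = "(nat \<times> nat) set"

definition vectorial_graphs :: "nat \<Rightarrow> vgraph set" where
  "vectorial_graphs n = {\<Delta>. \<Delta> \<subseteq> {1..n} \<times> {1..n} \<and> single_valued \<Delta>}"

definition Deb :: "vgraph \<Rightarrow> nat \<Rightarrow> (nat \<times> nat) set" where
  "Deb \<Delta> i = {e \<in> \<Delta>. fst e = i}"

definition Fin :: "vgraph \<Rightarrow> nat \<Rightarrow> (nat \<times> nat) set" where
  "Fin \<Delta> i = {e \<in> \<Delta>. snd e = i}"

definition relabel :: "(nat \<Rightarrow> nat) \<Rightarrow> vgraph \<Rightarrow> vgraph" where
  "relabel \<sigma> \<Delta> = map_prod \<sigma> \<sigma> ` \<Delta>"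

definition eps_deb :: "vgraph \<Rightarrow> (nat \<Rightarrow> nat) \<Rightarrow> real" where
  "eps_deb \<Delta> \<sigma> =
     (-1) ^ card {(a, b). a < b \<and> card (Deb \<Delta> a) = 1 \<and> card (Deb \<Delta> b) = 1 \<and> \<sigma> a > \<sigma> b}"


section \<open>Symmetric combinations\<close>

type_synonym comb = "vgraph \<Rightarrow>\<^sub>0 real"

definition symmetric_combs :: "nat \<Rightarrow> comb set" where
  "symmetric_combs n =
     {\<delta>. Poly_Mapping.keys \<delta> \<subseteq> vectorial_graphs n \<and>
        (\<forall>\<Delta>\<in>vectorial_graphs n. \<forall>\<sigma>. \<sigma> permutes {1..n} \<longrightarrow>
           Poly_Mapping.lookup \<delta> (relabel \<sigma> \<Delta>) = eps_deb \<Delta> \<sigma> * Poly_Mapping.lookup \<delta> \<Delta>)}"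

definition symmetrization :: "nat \<Rightarrow> vgraph \<Rightarrow> comb" where
  "symmetrization n \<Delta> =
     (\<Sum>\<sigma> | \<sigma> permutes {1..n}. Poly_Mapping.single (relabel \<sigma> \<Delta>) (eps_deb \<Delta> \<sigma>))"


section \<open>The coboundary\<close>

text \<open>The increasing bijection from \<open>{1..n}\<close> onto \<open>{0..n} - {j}\<close>.\<close>

definition skip :: "nat \<Rightarrow> nat \<Rightarrow> nat" where
  "skip j v = (if v \<le> j then v - 1 else v)"

text \<open>
  Here \<open>j\<close> is not a vertex of \<open>\<Delta>\<close>, and \<open>A\<close> is the set of those arrows ending at \<open>i\<close> which are
  redirected to \<open>j\<close>. Distinct sets \<open>A\<close> yield distinct graphs, so nothing is lost by collecting the
  splittings in a set. A loop at \<open>i\<close> that is redirected becomes the arrow from \<open>i\<close> to \<open>j\<close>.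
\<close>

definition splitting :: "vgraph \<Rightarrow> nat \<Rightarrow> nat \<Rightarrow> (nat \<times> nat) set \<Rightarrow> vgraph" where
  "splitting \<Delta> j i A = (\<Delta> - A) \<union> {(a, j) | a. (a, i) \<in> A} \<union> {(j, i)}"

definition proper_splittings :: "vgraph \<Rightarrow> nat \<Rightarrow> nat \<Rightarrow> vgraph set" where
  "proper_splittings \<Delta> j i =
     {\<Delta>'. \<exists>A \<subseteq> Fin \<Delta> i. \<Delta>' = splitting \<Delta> j i A \<and>
        (Deb \<Delta> i = {} \<and> Fin \<Delta> i = {} \<or>
         card (Deb \<Delta>' i) + card (Fin \<Delta>' i) > 1 \<and> card (Deb \<Delta>' j) + card (Fin \<Delta>' j) > 1)}"

definition eps_front :: "vgraph \<Rightarrow> nat \<Rightarrow> real" where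
  "eps_front \<Delta>' j = (-1) ^ card {a. a < j \<and> card (Deb \<Delta>' a) = 1}"

text \<open>The splittings have vertices \<open>0, \<dots>, n\<close>; \<open>relabel Suc\<close> shifts them to \<open>1, \<dots>, n + 1\<close>.\<close>

definition coboundary_graph :: "nat \<Rightarrow> vgraph \<Rightarrow> comb" where
  "coboundary_graph n \<Delta> =
     - (\<Sum>(i, j) | i \<le> n \<and> j \<le> n \<and> i \<noteq> j.
          \<Sum>\<Delta>'\<in>proper_splittings (relabel (skip j) \<Delta>) j i.
            Poly_Mapping.single (relabel Suc \<Delta>') (eps_front \<Delta>' j))"

definition coboundary :: "nat \<Rightarrow> comb \<Rightarrow> comb" where
  "coboundary n \<delta> =
     (\<Sum>\<Delta>\<in>Poly_Mapping.keys \<delta>. Poly_Mapping.lookup \<delta> \<Delta> *\<^sub>R coboundary_graph n \<Delta>)"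


section \<open>Chevalley cohomology\<close>

definition cocycles :: "nat \<Rightarrow> comb set" where
  "cocycles n = {\<delta> \<in> symmetric_combs n. coboundary n \<delta> = 0}"

definition coboundaries :: "nat \<Rightarrow> comb set" where
  "coboundaries n = (if n \<le> 1 then {0} else coboundary (n - 1) ` symmetric_combs (n - 1))"

definition cohomology :: "nat \<Rightarrow> (real, comb set) module" where
  "cohomology n = quotient_space (cocycles n) (coboundaries n)"


section \<open>Wheels\<close>

definition wheel_from :: "nat \<Rightarrow> nat \<Rightarrow> vgraph" where
  "wheel_from s m = {(s + a, s + a + 1) | a. 1 \<le> a \<and> a < m} \<union> {(s + m, s + 1)}"

fun wheels_from :: "nat \<Rightarrow> nat list \<Rightarrow> vgraph" where
  "wheels_from s [] = {}"
| "wheels_from s (m # ms) = wheel_from s m \<union> wheels_from (s + m) ms"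

definition wheel_wedge :: "nat list \<Rightarrow> comb" where
  "wheel_wedge ms = symmetrization (sum_list ms) (wheels_from 0 ms)"

text \<open>The lists \<open>[k\<^sub>1, \<dots>, k\<^sub>p]\<close> index the wedges of the wheels of lengths \<open>2 k\<^sub>i + 1\<close>.\<close>

definition odd_wheel_indices :: "nat \<Rightarrow> nat list set" where
  "odd_wheel_indices n = {ks. ks \<noteq> [] \<and> sorted_wrt (<) ks \<and> (\<Sum>k\<leftarrow>ks. 2 * k + 1) = n}"

definition odd_wheel_wedge :: "nat list \<Rightarrow> comb" where
  "odd_wheel_wedge ks = wheel_wedge (map (\<lambda>k. 2 * k + 1) ks)"

end

theory Submission
  imports Defs "HOL-Combinatorics.Cycles"
begin

text \<open>
  The coefficient of a graph in a coboundary is a signed sum over its contractible arrows, and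
  contracting an arrow preserves the number of leaves (vertices without incoming arrow). Attaching
  a new arrow to a leaf therefore defines an operator \<open>h\<close> on symmetric combinations, and once the
  sum is normalised by the number of leaves, \<open>\<partial>h + h\<partial>\<close> is the projection onto graphs with at
  least one leaf. Hence only leafless graphs contribute to the cohomology. By counting arrows these
  are the permutations, all of whose vertices are odd; so a symmetric combination vanishes on a
  permutation whose centralizer contains an odd permutation, that is, unless its cycles have
  distinct odd lengths. Since contracting an arrow of an odd cycle yields an even one, \<open>\<partial>\<close> vanishes
  identically on leafless graphs.
\<close>

section \<open>Signs of inversions\<close>

text \<open>The obstacle is the labelling. Contracting an arrow deletes a label and the homotopy
  adds one, so the vertex sets that arise are not of the form \<open>{1..n}\<close>, and shifting
  labels at every step would bury the signs. Coefficients are therefore carried along increasing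
  bijections to arbitrary finite vertex sets, where symmetry becomes equivariance under every
  injective renaming. All signs then reduce to two rules for inversions: multiplicativity under
  composition, and the cost of moving one point to the front.

  The attached vertex is always called \<open>0\<close>. Being smallest it lies in no inversion, and
  its arrow negates the front sign of every other vertex. Hence the terms of \<partial>h and
  h\<partial> cancel in which the contracted arrow does not start at the chosen leaf or at
  \<open>0\<close>. The remaining terms concern one leaf at a time, and each leaf returns exactly
  one copy of the original coefficient: either the attached arrow itself is contracted, or the
  leaf's own arrow is, which amounts to renaming the leaf to \<open>0\<close>.\<close>

lemma prod_sign_eq_power_card:
  assumes "finite A"
  shows "(\<Prod>x\<in>A. if P x then - 1 else (1::real)) = (- 1) ^ card {x \<in> A. P x}"
  using assms by (simp add: prod.If_cases Int_def)

text \<open>A product over pairs instead of a power of a count, because products can be reindexed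
  and split, which composition and the removal of a point require.\<close>

definition inversion_sign :: "nat set \<Rightarrow> (nat \<Rightarrow> nat) \<Rightarrow> real" where
  "inversion_sign D \<sigma> = (\<Prod>(a, b)\<in>{(a, b). a \<in> D \<and> b \<in> D \<and> a < b}. if \<sigma> b < \<sigma> a then - 1 else 1)"

lemma finite_ordered_pairs: "finite D \<Longrightarrow> finite {(a, b). a \<in> D \<and> b \<in> D \<and> a < (b::nat)}"
  by (rule finite_subset[of _ "D \<times> D"]) auto

lemma inversion_sign_eq_power_card:
  assumes "finite D"
  shows "inversion_sign D \<sigma> = (- 1) ^ card {(a, b). a < b \<and> a \<in> D \<and> b \<in> D \<and> \<sigma> b < \<sigma> a}"
proof -
  have "inversion_sign D \<sigma> =
    (\<Prod>x\<in>{(a, b). a \<in> D \<and> b \<in> D \<and> a < b}. if \<sigma> (snd x) < \<sigma> (fst x) then - 1 else 1)"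
    unfolding inversion_sign_def by (rule prod.cong) auto
  also have "\<dots> = (- 1) ^ card {x \<in> {(a, b). a \<in> D \<and> b \<in> D \<and> a < b}. \<sigma> (snd x) < \<sigma> (fst x)}"
    by (rule prod_sign_eq_power_card) (rule finite_ordered_pairs[OF assms])
  also have "{x \<in> {(a, b). a \<in> D \<and> b \<in> D \<and> a < b}. \<sigma> (snd x) < \<sigma> (fst x)} =
      {(a, b). a < b \<and> a \<in> D \<and> b \<in> D \<and> \<sigma> b < \<sigma> a}"
    by auto
  finally show ?thesis .
qed

lemma inversion_sign_cong:
  assumes "\<And>a. a \<in> D \<Longrightarrow> \<sigma> a = \<tau> a"
  shows "inversion_sign D \<sigma> = inversion_sign D \<tau>"
  unfolding inversion_sign_def using assms by (intro prod.cong) auto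

lemma inversion_sign_strict_mono:
  assumes "strict_mono_on D \<sigma>"
  shows "inversion_sign D \<sigma> = 1"
  unfolding inversion_sign_def
  by (rule prod.neutral) (use assms in \<open>force dest: strict_mono_onD\<close>)

lemma inversion_sign_compose:
  assumes "finite D" "inj_on \<sigma> D" "inj_on \<tau> (\<sigma> ` D)"
  shows "inversion_sign D (\<tau> \<circ> \<sigma>) = inversion_sign (\<sigma> ` D) \<tau> * inversion_sign D \<sigma>"
proof -
  \<comment> \<open>\<open>w\<close> is symmetric in the two points, unlike the factor in
    \<open>inversion_sign\<close>; this permits the reindexing along \<open>?f\<close>, which puts
    the images back into increasing order.\<close>
  define w where "w \<rho> = (\<lambda>(a::nat, b::nat). if (a < b) = (\<rho> a < (\<rho> b::nat)) then (1::real) else - 1)" for \<rho>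
  let ?P = "\<lambda>D. {(a, b). a \<in> D \<and> b \<in> D \<and> a < (b::nat)}"
  have eq: "inversion_sign E \<rho> = prod (w \<rho>) (?P E)" if "inj_on \<rho> E" for E \<rho>
    unfolding inversion_sign_def w_def
  proof (rule prod.cong, rule refl, clarify)
    fix a b assume "a \<in> E" "b \<in> E" "a < b"
    then have "\<rho> a \<noteq> \<rho> b" using that by (auto simp: inj_on_def)
    then show "(if \<rho> b < \<rho> a then - 1 else 1) = (if (a < b) = (\<rho> a < \<rho> b) then 1 else (- 1::real))"
      using \<open>a < b\<close> by auto
  qed
  let ?f = "\<lambda>(a, b). if \<sigma> a < \<sigma> b then (\<sigma> a, \<sigma> b) else (\<sigma> b, \<sigma> a)"
  have bij: "bij_betw ?f (?P D) (?P (\<sigma> ` D))"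
  proof (rule bij_betw_imageI)
    show "inj_on ?f (?P D)"
    proof (rule inj_onI)
      fix x y assume xy: "x \<in> ?P D" "y \<in> ?P D" "?f x = ?f y"
      then obtain a b c d where ab: "a \<in> D" "b \<in> D" "a < b" and cd: "c \<in> D" "d \<in> D" "c < d"
        and x: "x = (a, b)" and y: "y = (c, d)"
        by auto
      from xy(3) have "\<sigma> a = \<sigma> c \<and> \<sigma> b = \<sigma> d \<or> \<sigma> a = \<sigma> d \<and> \<sigma> b = \<sigma> c"
        unfolding x y by (simp split: if_splits)
      then have "a = c \<and> b = d \<or> a = d \<and> b = c"
        using ab(1,2) cd(1,2) assms(2) by (metis inj_on_eq_iff)
      then show "x = y" using ab(3) cd(3) by (auto simp: x y)
    qed
    show "?f ` ?P D = ?P (\<sigma> ` D)"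
    proof
      show "?f ` ?P D \<subseteq> ?P (\<sigma> ` D)"
      proof
        fix x assume "x \<in> ?f ` ?P D"
        then obtain a b where "a \<in> D" "b \<in> D" "a < b" and "x = ?f (a, b)" by auto
        moreover from this have "\<sigma> a \<noteq> \<sigma> b" using assms(2) by (auto simp: inj_on_def)
        ultimately show "x \<in> ?P (\<sigma> ` D)" by auto
      qed
    next
      show "?P (\<sigma> ` D) \<subseteq> ?f ` ?P D"
      proof clarify
        fix a b assume ab: "a \<in> D" "b \<in> D" "\<sigma> a < \<sigma> b"
        show "(\<sigma> a, \<sigma> b) \<in> ?f ` ?P D"
        proof (cases "a < b")
          case True
          then show ?thesis using ab by (intro image_eqI[of _ _ "(a, b)"]) auto
        next
          case False
          then have "b < a" using ab by (metis less_irrefl linorder_neqE_nat)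
          then show ?thesis using ab by (intro image_eqI[of _ _ "(b, a)"]) auto
        qed
      qed
    qed
  qed
  have "inversion_sign (\<sigma> ` D) \<tau> = prod (w \<tau>) (?P (\<sigma> ` D))"
    by (rule eq) (rule assms(3))
  also have "\<dots> = prod (\<lambda>x. w \<tau> (?f x)) (?P D)"
    by (rule prod.reindex_bij_betw[OF bij, symmetric])
  finally have "inversion_sign (\<sigma> ` D) \<tau> * inversion_sign D \<sigma> = 
     prod (\<lambda>x. w \<tau> (?f x) * w \<sigma> x) (?P D)"
    by (simp add: eq[OF assms(2)] prod.distrib)
  also have "\<dots> = prod (w (\<tau> \<circ> \<sigma>)) (?P D)"
  proof (rule prod.cong, rule refl)
    fix x assume "x \<in> ?P D"
    then obtain a b where "a \<in> D" "b \<in> D" "a < b" "x = (a, b)" by auto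
    moreover from this have "\<sigma> a \<noteq> \<sigma> b" "\<tau> (\<sigma> a) \<noteq> \<tau> (\<sigma> b)"
      using assms(2,3) by (auto simp: inj_on_def)
    ultimately show "w \<tau> (?f x) * w \<sigma> x = w (\<tau> \<circ> \<sigma>) x"
      by (auto simp: w_def)
  qed
  also have "\<dots> = inversion_sign D (\<tau> \<circ> \<sigma>)"
    by (rule eq[symmetric]) (use assms in \<open>auto intro: comp_inj_on\<close>)
  finally show ?thesis by simp
qed

text \<open>Besides the transposed pair itself, every point of \<open>D\<close> strictly between
  them gives two inversions, so their number is odd.\<close>

lemma inversion_sign_transpose:
  assumes "finite D" "a \<in> D" "b \<in> D" "a \<noteq> b"
  shows "inversion_sign D (transpose a b) = - 1"
proof -
  have main: "inversion_sign D (transpose a b) = - 1" if "a < b" "a \<in> D" "b \<in> D" for a b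
  proof -
    let ?M = "{c \<in> D. a < c \<and> c < b}"
    have "{(x, y). x < y \<and> x \<in> D \<and> y \<in> D \<and> transpose a b y < transpose a b x} =
      insert (a, b) ((\<lambda>c. (a, c)) ` ?M \<union> (\<lambda>c. (c, b)) ` ?M)"
      using that by (auto simp: transpose_def split: if_splits)
    moreover have "card (insert (a, b) ((\<lambda>c. (a, c)) ` ?M \<union> (\<lambda>c. (c, b)) ` ?M)) = Suc (card ?M + card ?M)"
      using assms(1) by (subst card_insert_disjoint, simp, force, subst card_Un_disjoint)
        (auto simp: card_image inj_on_def)
    ultimately show ?thesis
      by (simp add: inversion_sign_eq_power_card[OF assms(1)])
  qed
  show ?thesis
    using main[of a b] main[of b a] assms by (metis linorder_neqE_nat transpose_commute)
qed

text \<open>Moving \<open>j\<close> to the front before \<sigma>, or its image to the front after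
  \<sigma>, accounts for all pairs that contain \<open>j\<close>. This is the rule by which the
  front signs of the coboundary follow a relabelling.\<close>

lemma inversion_sign_remove:
  assumes "finite D" "j \<in> D" "inj_on \<sigma> D"
  shows "(- 1) ^ card {a \<in> D. a < j} * inversion_sign D \<sigma> =
    (- 1) ^ card {c \<in> \<sigma> ` D. c < \<sigma> j} * inversion_sign (D - {j}) \<sigma>"
proof -
  let ?P = "\<lambda>D. {(a, b). a \<in> D \<and> b \<in> D \<and> a < (b::nat)}"
  let ?g = "\<lambda>(a, b). if \<sigma> b < \<sigma> a then - 1 else (1::real)"
  let ?L = "{a \<in> D. a < j}" and ?U = "{a \<in> D. j < a}"
  have "?P D = ?P (D - {j}) \<union> ((\<lambda>a. (a, j)) ` ?L \<union> (\<lambda>a. (j, a)) ` ?U)"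
    using assms(2) by auto
  then have "inversion_sign D \<sigma> = prod ?g (?P (D - {j}) \<union> ((\<lambda>a. (a, j)) ` ?L \<union> (\<lambda>a. (j, a)) ` ?U))"
    by (simp add: inversion_sign_def)
  also have "\<dots> = inversion_sign (D - {j}) \<sigma> * prod ?g ((\<lambda>a. (a, j)) ` ?L \<union> (\<lambda>a. (j, a)) ` ?U)"
    unfolding inversion_sign_def 
    by (rule prod.union_disjoint) (use assms(1) finite_ordered_pairs[of "D - {j}"] in auto)
  also have "prod ?g ((\<lambda>a. (a, j)) ` ?L \<union> (\<lambda>a. (j, a)) ` ?U) = 
      prod ?g ((\<lambda>a. (a, j)) ` ?L) * prod ?g ((\<lambda>a. (j, a)) ` ?U)"
    by (rule prod.union_disjoint) (use assms(1) in auto)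
  also have "prod ?g ((\<lambda>a. (a, j)) ` ?L) = (\<Prod>a\<in>?L. if \<sigma> j < \<sigma> a then - 1 else 1)"
    by (subst prod.reindex) (auto simp: inj_on_def)
  also have "prod ?g ((\<lambda>a. (j, a)) ` ?U) = (\<Prod>a\<in>?U. if \<sigma> a < \<sigma> j then - 1 else 1)"
    by (subst prod.reindex) (auto simp: inj_on_def)
  finally have 1: "inversion_sign D \<sigma> = inversion_sign (D - {j}) \<sigma> *
     ((\<Prod>a\<in>?L. if \<sigma> j < \<sigma> a then - 1 else 1) * (\<Prod>a\<in>?U. if \<sigma> a < \<sigma> j then - 1 else 1))" .
  have "{c \<in> \<sigma> ` D. c < \<sigma> j} = \<sigma> ` {a \<in> D. \<sigma> a < \<sigma> j}" by auto
  then have "card {c \<in> \<sigma> ` D. c < \<sigma> j} = card {a \<in> D. \<sigma> a < \<sigma> j}"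
    using card_image[OF inj_on_subset[OF assms(3), of "{a \<in> D. \<sigma> a < \<sigma> j}"]] by auto
  also have "{a \<in> D. \<sigma> a < \<sigma> j} = {a \<in> ?L \<union> ?U. \<sigma> a < \<sigma> j}"
    by (auto simp: not_less le_less)
  finally have "(- 1) ^ card {c \<in> \<sigma> ` D. c < \<sigma> j} = (\<Prod>a\<in>?L \<union> ?U. if \<sigma> a < \<sigma> j then - 1 else (1::real))"
    using assms(1) by (subst prod_sign_eq_power_card) auto
  also have "\<dots> = (\<Prod>a\<in>?L. if \<sigma> a < \<sigma> j then - 1 else 1) * (\<Prod>a\<in>?U. if \<sigma> a < \<sigma> j then - 1 else 1)"
    by (rule prod.union_disjoint) (use assms(1) in auto)
  finally have 2: "(- 1) ^ card {c \<in> \<sigma> ` D. c < \<sigma> j} =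
     (\<Prod>a\<in>?L. if \<sigma> a < \<sigma> j then - 1 else (1::real)) * (\<Prod>a\<in>?U. if \<sigma> a < \<sigma> j then - 1 else 1)" .
  have 3: "(- 1) ^ card ?L = (\<Prod>a\<in>?L. (- 1::real))" by simp
  \<comment> \<open>For \<open>a < j\<close> the factor records
    \<open>\<sigma> j < \<sigma> a\<close>; by injectivity the extra -1 turns it into the indicator
    of the opposite inequality, which is the one counted after \<sigma>.\<close>
  have 4: "(\<Prod>a\<in>?L. - 1) * (\<Prod>a\<in>?L. if \<sigma> j < \<sigma> a then - 1 else 1) = 
     (\<Prod>a\<in>?L. if \<sigma> a < \<sigma> j then - 1 else (1::real))"
    unfolding prod.distrib[symmetric]
    by (rule prod.cong) (use assms(2,3) in \<open>auto simp: inj_on_def not_less le_less\<close>)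
  show ?thesis
    unfolding 1 2 3 4[symmetric] by (simp only: mult_ac)
qed

section \<open>Graphs on arbitrary finite vertex sets\<close>

definition graph_on :: "nat set \<Rightarrow> vgraph \<Rightarrow> bool" where
  "graph_on V \<Gamma> \<longleftrightarrow> \<Gamma> \<subseteq> V \<times> V \<and> single_valued \<Gamma>"

lemma mem_vectorial_graphs: "\<Gamma> \<in> vectorial_graphs n \<longleftrightarrow> graph_on {1..n} \<Gamma>"
  by (simp add: vectorial_graphs_def graph_on_def)

lemma graph_onD:
  assumes "graph_on V \<Gamma>" "(a, b) \<in> \<Gamma>"
  shows "a \<in> V" "b \<in> V"
  using assms by (auto simp: graph_on_def)

lemma graph_on_unique:
  assumes "graph_on V \<Gamma>" "(a, b) \<in> \<Gamma>" "(a, c) \<in> \<Gamma>"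
  shows "b = c"
  using assms by (auto simp: graph_on_def single_valued_def)

lemma graph_on_finite: "graph_on V \<Gamma> \<Longrightarrow> finite V \<Longrightarrow> finite \<Gamma>"
  unfolding graph_on_def by (meson finite_SigmaI finite_subset)

lemma graph_on_Domain: "graph_on V \<Gamma> \<Longrightarrow> Domain \<Gamma> \<subseteq> V"
  by (auto simp: graph_on_def)

lemma finite_vectorial_graphs: "finite (vectorial_graphs n)"
  by (rule finite_subset[of _ "Pow ({1..n} \<times> {1..n})"]) (auto simp: vectorial_graphs_def)

lemma card_Deb_eq_1_iff:
  assumes "single_valued \<Gamma>"
  shows "card (Deb \<Gamma> a) = 1 \<longleftrightarrow> a \<in> Domain \<Gamma>"
proof (cases "a \<in> Domain \<Gamma>")
  case True
  then obtain c where "(a, c) \<in> \<Gamma>" by auto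
  then have "Deb \<Gamma> a = {(a, c)}"
    using assms by (auto simp: Deb_def single_valued_def)
  then show ?thesis using True by simp
next
  case False
  then have "Deb \<Gamma> a = {}" by (auto simp: Deb_def)
  then show ?thesis using False by simp
qed

lemma eps_deb_eq_inversion_sign:
  assumes "graph_on V \<Gamma>" "finite V"
  shows "eps_deb \<Gamma> \<sigma> = inversion_sign (Domain \<Gamma>) \<sigma>"
proof -
  have "finite (Domain \<Gamma>)"
    using assms graph_on_Domain finite_subset by blast
  then show ?thesis
    using assms(1) by (simp only: eps_deb_def inversion_sign_eq_power_card card_Deb_eq_1_iff graph_on_def)
qed

lemma eps_front_eq:
  assumes "graph_on V \<Gamma>"
  shows "eps_front \<Gamma> j = (- 1) ^ card {a \<in> Domain \<Gamma>. a < j}"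
proof -
  have "{a. a < j \<and> card (Deb \<Gamma> a) = 1} = {a \<in> Domain \<Gamma>. a < j}"
    using assms by (auto simp only: card_Deb_eq_1_iff graph_on_def)
  then show ?thesis by (simp only: eps_front_def)
qed

lemma relabel_comp: "relabel (\<tau> \<circ> \<sigma>) \<Gamma> = relabel \<tau> (relabel \<sigma> \<Gamma>)"
  by (force simp: relabel_def)

lemma relabel_id: "relabel id \<Gamma> = \<Gamma>"
  by (simp add: relabel_def map_prod.id)

lemma relabel_cong:
  assumes "\<Gamma> \<subseteq> V \<times> V" "\<And>v. v \<in> V \<Longrightarrow> \<sigma> v = \<tau> v"
  shows "relabel \<sigma> \<Gamma> = relabel \<tau> \<Gamma>"
  unfolding relabel_def by (rule image_cong) (use assms in auto)

lemma Domain_relabel: "Domain (relabel \<sigma> \<Gamma>) = \<sigma> ` Domain \<Gamma>"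
  by (force simp: relabel_def)

lemma relabel_insert: "relabel \<sigma> (insert (a, b) \<Gamma>) = insert (\<sigma> a, \<sigma> b) (relabel \<sigma> \<Gamma>)"
  by (simp add: relabel_def)

lemma mem_relabel_iff:
  assumes "graph_on V \<Gamma>" "inj_on \<sigma> V" "a \<in> V" "b \<in> V"
  shows "(\<sigma> a, \<sigma> b) \<in> relabel \<sigma> \<Gamma> \<longleftrightarrow> (a, b) \<in> \<Gamma>"
proof
  assume "(\<sigma> a, \<sigma> b) \<in> relabel \<sigma> \<Gamma>"
  then obtain c d where cd: "(c, d) \<in> \<Gamma>" "\<sigma> a = \<sigma> c" "\<sigma> b = \<sigma> d"
    by (auto simp: relabel_def)
  then have "a = c" "b = d"
    using graph_onD[OF assms(1) cd(1)] assms(2-4) by (auto dest: inj_onD)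
  then show "(a, b) \<in> \<Gamma>" using cd(1) by simp
qed (force simp: relabel_def)

lemma relabelE:
  assumes "e \<in> relabel \<sigma> \<Gamma>"
  obtains a b where "e = (\<sigma> a, \<sigma> b)" "(a, b) \<in> \<Gamma>"
  using assms by (auto simp: relabel_def)

lemma graph_on_relabel:
  assumes "graph_on V \<Gamma>" "inj_on \<sigma> V"
  shows "graph_on (\<sigma> ` V) (relabel \<sigma> \<Gamma>)"
  using assms
  by (auto simp: graph_on_def single_valued_def relabel_def inj_on_def) blast

lemma relabel_permutes:
  assumes "\<sigma> permutes V" "graph_on V \<Gamma>"
  shows "graph_on V (relabel \<sigma> \<Gamma>)"
  using graph_on_relabel[OF assms(2) permutes_inj_on[OF assms(1)]] permutes_image[OF assms(1)] by simp

lemma relabel_inj: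
  assumes "graph_on V \<Gamma>" "graph_on V \<Gamma>'" "inj_on \<sigma> V" "relabel \<sigma> \<Gamma> = relabel \<sigma> \<Gamma>'"
  shows "\<Gamma> = \<Gamma>'"
proof -
  have "(a, b) \<in> \<Gamma> \<longleftrightarrow> (a, b) \<in> \<Gamma>'" for a b
    using mem_relabel_iff[OF assms(1,3)] mem_relabel_iff[OF assms(2,3)] assms(4)
      graph_onD[OF assms(1)] graph_onD[OF assms(2)] by metis
  then show ?thesis by auto
qed

text \<open>The cocycle identity of the signs, on which the symmetry of
  \<open>symmetrization\<close> rests.\<close>

lemma eps_deb_compose:
  assumes "graph_on V \<Gamma>" "finite V" "inj_on \<sigma> V" "inj_on \<tau> (\<sigma> ` V)"
  shows "eps_deb \<Gamma> (\<tau> \<circ> \<sigma>) = eps_deb (relabel \<sigma> \<Gamma>) \<tau> * eps_deb \<Gamma> \<sigma>"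
proof -
  have D: "Domain \<Gamma> \<subseteq> V" "finite (Domain \<Gamma>)"
    using assms graph_on_Domain finite_subset by blast+
  show ?thesis
    unfolding eps_deb_eq_inversion_sign[OF assms(1,2)]
      eps_deb_eq_inversion_sign[OF graph_on_relabel[OF assms(1,3)] finite_imageI[OF assms(2)]] Domain_relabel
    by (rule inversion_sign_compose) (use D assms in \<open>auto intro: inj_on_subset\<close>)
qed

lemma symmetric_combs_lookup:
  assumes "\<delta> \<in> symmetric_combs n" "graph_on {1..n} \<Gamma>" "\<sigma> permutes {1..n}"
  shows "Poly_Mapping.lookup \<delta> (relabel \<sigma> \<Gamma>) = eps_deb \<Gamma> \<sigma> * Poly_Mapping.lookup \<delta> \<Gamma>"
  using assms by (auto simp: symmetric_combs_def mem_vectorial_graphs)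

lemma symmetric_combs_lookup_eq_0:
  assumes "\<delta> \<in> symmetric_combs n" "\<not> graph_on {1..n} \<Gamma>"
  shows "Poly_Mapping.lookup \<delta> \<Gamma> = 0"
  using assms by (auto simp only: symmetric_combs_def mem_vectorial_graphs[symmetric]
      not_in_keys_iff_lookup_eq_zero[symmetric])

section \<open>Coefficients on arbitrary finite vertex sets\<close>

definition rank :: "nat set \<Rightarrow> nat \<Rightarrow> nat" where
  "rank V v = card {u \<in> V. u \<le> v}"

lemma strict_mono_on_rank: "finite V \<Longrightarrow> strict_mono_on V (rank V)"
  unfolding rank_def strict_mono_on_def
proof (intro allI impI psubset_card_mono)
  fix r s assume "finite V" and rs: "r \<in> V \<and> s \<in> V \<and> r < s"
  then show "finite {u \<in> V. u \<le> s}" by simp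
  have "s \<in> {u \<in> V. u \<le> s} - {u \<in> V. u \<le> r}" using rs by simp
  then show "{u \<in> V. u \<le> r} \<subset> {u \<in> V. u \<le> s}" using rs by fastforce
qed

lemma rank_image:
  assumes "finite V"
  shows "rank V ` V = {1..card V}"
proof (rule card_subset_eq)
  show "rank V ` V \<subseteq> {1..card V}"
  proof clarify
    fix v assume "v \<in> V"
    then have "{u \<in> V. u \<le> v} \<noteq> {}" by auto
    then show "rank V v \<in> {1..card V}"
      using assms unfolding rank_def by (auto simp: card_gt_0_iff Suc_le_eq intro: card_mono)
  qed
  show "card (rank V ` V) = card {1..card V}"
    using card_image[OF strict_mono_on_imp_inj_on[OF strict_mono_on_rank[OF assms]]] by simp
qed simp

lemma inj_on_rank: "finite V \<Longrightarrow> inj_on (rank V) V"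
  by (rule strict_mono_on_imp_inj_on) (rule strict_mono_on_rank)

lemma rank_atLeast1: "v \<in> {1..n} \<Longrightarrow> rank {1..n} v = v"
proof -
  assume "v \<in> {1..n}"
  then have "{u \<in> {1..n}. u \<le> v} = {1..v}" by auto
  then show ?thesis by (simp add: rank_def)
qed

text \<open>The coefficient in \<open>\<delta>\<close> of a graph with an arbitrary finite set of vertices \<open>V\<close>, relabelled
  increasingly by \<open>1, \<dots>, card V\<close>.\<close>

definition coeff_on :: "comb \<Rightarrow> nat set \<Rightarrow> vgraph \<Rightarrow> real" where
  "coeff_on \<delta> V \<Gamma> = Poly_Mapping.lookup \<delta> (relabel (rank V) \<Gamma>)"

lemma coeff_on_atLeast1:
  assumes "graph_on {1..n} \<Gamma>"
  shows "coeff_on \<delta> {1..n} \<Gamma> = Poly_Mapping.lookup \<delta> \<Gamma>"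
proof -
  have "relabel (rank {1..n}) \<Gamma> = relabel id \<Gamma>"
    by (rule relabel_cong[of _ "{1..n}"]) (use assms rank_atLeast1 in \<open>auto simp: graph_on_def\<close>)
  then show ?thesis by (simp add: coeff_on_def relabel_id)
qed

text \<open>The two rank functions are increasing and create no inversions. What is left of \<sigma>
  between them is a permutation of \<open>{1..card V}\<close>, to which the symmetry of \<delta>
  applies.\<close>

lemma coeff_on_relabel:
  assumes \<delta>: "\<delta> \<in> symmetric_combs (card V)" and V: "finite V" and \<Gamma>: "graph_on V \<Gamma>"
    and \<sigma>: "inj_on \<sigma> V"
  shows "coeff_on \<delta> (\<sigma> ` V) (relabel \<sigma> \<Gamma>) = eps_deb \<Gamma> \<sigma> * coeff_on \<delta> V \<Gamma>"
proof -
  let ?r = "rank V" and ?s = "rank (\<sigma> ` V)"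
  \<comment> \<open>\<tau> is \<sigma> conjugated by the rank functions, extended by the identity so
    that it is a permutation in the sense of \<open>permutes\<close>.\<close>
  define \<tau> where "\<tau> = (\<lambda>x. if x \<in> {1..card V} then ?s (\<sigma> (the_inv_into V ?r x)) else x)"
  have card: "card (\<sigma> ` V) = card V" using \<sigma> by (rule card_image)
  have \<tau>: "\<tau> (?r v) = ?s (\<sigma> v)" if "v \<in> V" for v
  proof -
    have "?r v \<in> {1..card V}" using rank_image[OF V] that by blast
    then show ?thesis
      using the_inv_into_f_f[OF inj_on_rank[OF V] that] by (simp add: \<tau>_def)
  qed
  have im: "\<tau> ` {1..card V} = {1..card V}"
  proof -
    have "\<tau> ` {1..card V} = \<tau> ` ?r ` V" by (simp add: rank_image[OF V])
    also have "\<dots> = ?s ` \<sigma> ` V" unfolding image_image by (rule image_cong) (auto simp: \<tau>)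
    also have "\<dots> = {1..card V}" using V by (subst rank_image) (auto simp: card)
    finally show ?thesis .
  qed
  have perm: "\<tau> permutes {1..card V}"
  proof (rule bij_imp_permutes)
    have "inj_on \<tau> {1..card V}" by (rule eq_card_imp_inj_on) (simp_all only: im finite_atLeastAtMost)
    then show "bij_betw \<tau> {1..card V} {1..card V}" by (simp only: bij_betw_def im simp_thms)
  qed (simp only: \<tau>_def if_False)
  have g: "graph_on {1..card V} (relabel ?r \<Gamma>)"
    using graph_on_relabel[OF \<Gamma> inj_on_rank[OF V]] rank_image[OF V] by simp
  have D: "Domain \<Gamma> \<subseteq> V" "finite (Domain \<Gamma>)"
    using \<Gamma> V graph_on_Domain finite_subset by blast+
  have "relabel ?s (relabel \<sigma> \<Gamma>) = relabel \<tau> (relabel ?r \<Gamma>)"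
    unfolding relabel_comp[symmetric]
    by (rule relabel_cong[of _ V]) (use \<Gamma> \<tau> in \<open>auto simp: graph_on_def\<close>)
  then have 1: "coeff_on \<delta> (\<sigma> ` V) (relabel \<sigma> \<Gamma>) = eps_deb (relabel ?r \<Gamma>) \<tau> * coeff_on \<delta> V \<Gamma>"
    unfolding coeff_on_def using symmetric_combs_lookup[OF \<delta> g perm] by simp
  have mono: "strict_mono_on (Domain \<Gamma>) ?r" "strict_mono_on (\<sigma> ` Domain \<Gamma>) ?s"
    using monotone_on_subset[OF strict_mono_on_rank[OF V] D(1)]
      monotone_on_subset[OF strict_mono_on_rank[OF finite_imageI[OF V]] image_mono[OF D(1)]]
    by blast+
  have injD: "inj_on \<sigma> (Domain \<Gamma>)" "inj_on ?r (Domain \<Gamma>)" "inj_on ?s (\<sigma> ` Domain \<Gamma>)"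
    using D \<sigma> inj_on_rank[OF V] inj_on_rank[OF finite_imageI[OF V]] 
    by (auto intro: inj_on_subset)
  have inj\<tau>: "inj_on \<tau> (?r ` Domain \<Gamma>)"
    using permutes_inj_on[OF perm] .
  have "inversion_sign (?r ` Domain \<Gamma>) \<tau> = inversion_sign (?r ` Domain \<Gamma>) \<tau> * inversion_sign (Domain \<Gamma>) ?r"
    using inversion_sign_strict_mono[OF mono(1)] by simp
  also have "\<dots> = inversion_sign (Domain \<Gamma>) (\<tau> \<circ> ?r)"
    by (rule inversion_sign_compose[symmetric]) (use D injD inj\<tau> in auto)
  also have "\<dots> = inversion_sign (Domain \<Gamma>) (?s \<circ> \<sigma>)"
    by (rule inversion_sign_cong) (use D \<tau> in auto)
  also have "\<dots> = inversion_sign (\<sigma> ` Domain \<Gamma>) ?s * inversion_sign (Domain \<Gamma>) \<sigma>"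
    by (rule inversion_sign_compose) (use D injD in auto)
  also have "\<dots> = inversion_sign (Domain \<Gamma>) \<sigma>"
    using inversion_sign_strict_mono[OF mono(2)] by simp
  finally have "eps_deb (relabel ?r \<Gamma>) \<tau> = eps_deb \<Gamma> \<sigma>"
    using g \<Gamma> V by (simp add: eps_deb_eq_inversion_sign Domain_relabel)
  with 1 show ?thesis by simp
qed

section \<open>Contraction of arrows\<close>

definition contract :: "vgraph \<Rightarrow> nat \<Rightarrow> nat \<Rightarrow> vgraph" where
  "contract \<Gamma> j i = {(a, if c = j then i else c) | a c. (a, c) \<in> \<Gamma> \<and> a \<noteq> j}"

text \<open>The arrows \<open>(j, i)\<close> that occur in a proper splitting: the equivalence covers the case of two
  vertices of valence greater than 1 as well as that of an arrow forming a component of its own,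
  which stems from the splitting of an isolated vertex.\<close>

definition contractible :: "vgraph \<Rightarrow> nat \<Rightarrow> nat \<Rightarrow> bool" where
  "contractible \<Gamma> j i \<longleftrightarrow> (j, i) \<in> \<Gamma> \<and> j \<noteq> i \<and>
     ((\<exists>a. (a, j) \<in> \<Gamma>) \<longleftrightarrow> (\<exists>c. (i, c) \<in> \<Gamma>) \<or> (\<exists>a. a \<noteq> j \<and> (a, i) \<in> \<Gamma>))"

text \<open>The coefficient of \<Gamma> in the coboundary, read backwards: every splitting that
  yields \<Gamma> is recovered from its new arrow by contracting it. The vertex set is arbitrary
  because the homotopy evaluates coboundaries on vertex sets that contain \<open>0\<close>.\<close>

definition coboundary_coeff :: "comb \<Rightarrow> nat set \<Rightarrow> vgraph \<Rightarrow> real" where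
  "coboundary_coeff \<delta> V \<Gamma> =
     - (\<Sum>(j, i) | contractible \<Gamma> j i. eps_front \<Gamma> j * coeff_on \<delta> (V - {j}) (contract \<Gamma> j i))"

lemma graph_on_contract:
  assumes "graph_on V \<Gamma>" "(j, i) \<in> \<Gamma>" "j \<noteq> i"
  shows "graph_on (V - {j}) (contract \<Gamma> j i)"
  using assms by (auto simp: graph_on_def contract_def single_valued_def)

lemma Domain_contract: "Domain (contract \<Gamma> j i) = Domain \<Gamma> - {j}"
proof (intro equalityI subsetI)
  fix a assume "a \<in> Domain \<Gamma> - {j}"
  then obtain c where "(a, c) \<in> \<Gamma>" "a \<noteq> j" by auto
  then have "(a, if c = j then i else c) \<in> contract \<Gamma> j i"
    unfolding contract_def by blast
  then show "a \<in> Domain (contract \<Gamma> j i)" by blast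
qed (auto simp: contract_def)

lemma relabel_contract:
  assumes "graph_on V \<Gamma>" "inj_on \<sigma> V" "j \<in> V" "i \<in> V"
  shows "relabel \<sigma> (contract \<Gamma> j i) = contract (relabel \<sigma> \<Gamma>) (\<sigma> j) (\<sigma> i)"
proof -
  have inj: "\<sigma> c = \<sigma> j \<longleftrightarrow> c = j" if "c \<in> V" for c
    using assms that by (auto simp: inj_on_def)
  show ?thesis
  proof (intro equalityI subsetI)
    fix e assume "e \<in> relabel \<sigma> (contract \<Gamma> j i)"
    then obtain a c where e: "e = (\<sigma> a, \<sigma> (if c = j then i else c))" and ac: "(a, c) \<in> \<Gamma>" "a \<noteq> j"
      by (auto simp: relabel_def contract_def)
    have "(\<sigma> a, \<sigma> c) \<in> relabel \<sigma> \<Gamma>" using ac by (force simp: relabel_def)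
    moreover have "\<sigma> a \<noteq> \<sigma> j" "\<sigma> c = \<sigma> j \<longleftrightarrow> c = j"
      using inj ac graph_onD[OF assms(1) ac(1)] by auto
    ultimately show "e \<in> contract (relabel \<sigma> \<Gamma>) (\<sigma> j) (\<sigma> i)"
      unfolding contract_def e by (intro CollectI exI[of _ "\<sigma> a"] exI[of _ "\<sigma> c"]) auto
  next
    fix e assume "e \<in> contract (relabel \<sigma> \<Gamma>) (\<sigma> j) (\<sigma> i)"
    then obtain a c where e: "e = (\<sigma> a, if \<sigma> c = \<sigma> j then \<sigma> i else \<sigma> c)" and ac: "(a, c) \<in> \<Gamma>" "\<sigma> a \<noteq> \<sigma> j"
      by (auto simp: relabel_def contract_def)
    have "(a, if c = j then i else c) \<in> contract \<Gamma> j i"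
      using ac by (auto simp: contract_def)
    moreover have "e = map_prod \<sigma> \<sigma> (a, if c = j then i else c)"
      using inj graph_onD[OF assms(1) ac(1)] e by auto
    ultimately show "e \<in> relabel \<sigma> (contract \<Gamma> j i)"
      unfolding relabel_def by blast
  qed
qed

lemma contractible_relabel:
  assumes "graph_on V \<Gamma>" "inj_on \<sigma> V" "j \<in> V" "i \<in> V"
  shows "contractible (relabel \<sigma> \<Gamma>) (\<sigma> j) (\<sigma> i) \<longleftrightarrow> contractible \<Gamma> j i"
proof -
  have inj: "\<sigma> a = \<sigma> b \<longleftrightarrow> a = b" if "a \<in> V" "b \<in> V" for a b
    using assms that by (auto simp: inj_on_def)
  have mem: "(\<sigma> a, \<sigma> b) \<in> relabel \<sigma> \<Gamma> \<longleftrightarrow> (a, b) \<in> \<Gamma>" if "a \<in> V" "b \<in> V" for a b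
    using mem_relabel_iff[OF assms(1,2) that] .
  have V: "(\<exists>a. (a, x) \<in> relabel \<sigma> \<Gamma> \<and> P a) \<longleftrightarrow> (\<exists>a\<in>V. (\<sigma> a, x) \<in> relabel \<sigma> \<Gamma> \<and> P (\<sigma> a))" 
    "(\<exists>a. (x, a) \<in> relabel \<sigma> \<Gamma> \<and> P a) \<longleftrightarrow> (\<exists>a\<in>V. (x, \<sigma> a) \<in> relabel \<sigma> \<Gamma> \<and> P (\<sigma> a))" for x P
    using graph_onD[OF assms(1)] by (blast elim: relabelE)+
  have V': "(\<exists>a. (a, x) \<in> \<Gamma> \<and> P a) \<longleftrightarrow> (\<exists>a\<in>V. (a, x) \<in> \<Gamma> \<and> P a)" 
    "(\<exists>a. (x, a) \<in> \<Gamma> \<and> P a) \<longleftrightarrow> (\<exists>a\<in>V. (x, a) \<in> \<Gamma> \<and> P a)" for x P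
    using graph_onD[OF assms(1)] by blast+
  have "(\<exists>a. (a, \<sigma> j) \<in> relabel \<sigma> \<Gamma>) \<longleftrightarrow> (\<exists>a. (a, j) \<in> \<Gamma>)"
    using V(1)[of "\<sigma> j" "\<lambda>_. True"] V'(1)[of j "\<lambda>_. True"] mem assms(3) by simp
  moreover have "(\<exists>c. (\<sigma> i, c) \<in> relabel \<sigma> \<Gamma>) \<longleftrightarrow> (\<exists>c. (i, c) \<in> \<Gamma>)"
    using V(2)[of "\<sigma> i" "\<lambda>_. True"] V'(2)[of i "\<lambda>_. True"] mem assms(4) by simp
  moreover have "(\<exists>a. a \<noteq> \<sigma> j \<and> (a, \<sigma> i) \<in> relabel \<sigma> \<Gamma>) \<longleftrightarrow> (\<exists>a. a \<noteq> j \<and> (a, i) \<in> \<Gamma>)"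
    using V(1)[of "\<sigma> i" "\<lambda>a. a \<noteq> \<sigma> j"] V'(1)[of i "\<lambda>a. a \<noteq> j"] mem inj assms(3,4)
    by (simp add: conj_commute cong: conj_cong)
  ultimately show ?thesis
    unfolding contractible_def using mem inj assms(3,4) by simp
qed

lemma contractible_relabel_bij:
  assumes "graph_on V \<Gamma>" "inj_on \<sigma> V"
  shows "bij_betw (map_prod \<sigma> \<sigma>) {(j, i). contractible \<Gamma> j i} {(j, i). contractible (relabel \<sigma> \<Gamma>) j i}"
proof (rule bij_betw_imageI)
  have sub: "{(j, i). contractible \<Gamma> j i} \<subseteq> V \<times> V"
    using graph_onD[OF assms(1)] by (auto simp: contractible_def)
  show "inj_on (map_prod \<sigma> \<sigma>) {(j, i). contractible \<Gamma> j i}"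
    using map_prod_inj_on[OF assms(2,2)] sub by (rule inj_on_subset)
  show "map_prod \<sigma> \<sigma> ` {(j, i). contractible \<Gamma> j i} = {(j, i). contractible (relabel \<sigma> \<Gamma>) j i}"
  proof (intro equalityI subsetI)
    fix e assume "e \<in> map_prod \<sigma> \<sigma> ` {(j, i). contractible \<Gamma> j i}"
    then obtain j i where "e = (\<sigma> j, \<sigma> i)" "contractible \<Gamma> j i" by auto
    moreover from this sub have "j \<in> V" "i \<in> V" by auto
    ultimately show "e \<in> {(j, i). contractible (relabel \<sigma> \<Gamma>) j i}"
      using contractible_relabel[OF assms] by auto
  next
    fix e assume e: "e \<in> {(j, i). contractible (relabel \<sigma> \<Gamma>) j i}"
    then have "e \<in> relabel \<sigma> \<Gamma>" by (auto simp: contractible_def)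
    then obtain j i where ji: "e = (\<sigma> j, \<sigma> i)" "(j, i) \<in> \<Gamma>" by (rule relabelE)
    then have "contractible \<Gamma> j i"
      using contractible_relabel[OF assms] graph_onD[OF assms(1) ji(2)] e by auto
    then show "e \<in> map_prod \<sigma> \<sigma> ` {(j, i). contractible \<Gamma> j i}"
      using ji(1) by force
  qed
qed

text \<open>Relabelling permutes the contractible arrows. For a single arrow,
  \<open>inversion_sign_remove\<close> combines the change of its front sign with the sign of
  \<sigma> on the contracted graph into \<open>eps_deb \<Gamma> \<sigma>\<close>, which is the same
  for all arrows.\<close>

lemma coboundary_coeff_relabel:
  assumes \<delta>: "\<delta> \<in> symmetric_combs n" and V: "finite V" "card V = Suc n" and \<Gamma>: "graph_on V \<Gamma>"
    and \<sigma>: "inj_on \<sigma> V"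
  shows "coboundary_coeff \<delta> (\<sigma> ` V) (relabel \<sigma> \<Gamma>) = eps_deb \<Gamma> \<sigma> * coboundary_coeff \<delta> V \<Gamma>"
proof -
  have "(\<Sum>(j, i) | contractible (relabel \<sigma> \<Gamma>) j i. 
      eps_front (relabel \<sigma> \<Gamma>) j * coeff_on \<delta> (\<sigma> ` V - {j}) (contract (relabel \<sigma> \<Gamma>) j i))
    = (\<Sum>(j, i) | contractible \<Gamma> j i. eps_front (relabel \<sigma> \<Gamma>) (\<sigma> j) * 
        coeff_on \<delta> (\<sigma> ` V - {\<sigma> j}) (contract (relabel \<sigma> \<Gamma>) (\<sigma> j) (\<sigma> i)))"
    unfolding sum.reindex_bij_betw[OF contractible_relabel_bij[OF \<Gamma> \<sigma>], symmetric]
    by (rule sum.cong) auto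
  also have "\<dots> = (\<Sum>(j, i) | contractible \<Gamma> j i. 
      eps_deb \<Gamma> \<sigma> * (eps_front \<Gamma> j * coeff_on \<delta> (V - {j}) (contract \<Gamma> j i)))"
  proof (rule sum.cong, rule refl, clarify)
    fix j i assume "contractible \<Gamma> j i"
    then have ji: "(j, i) \<in> \<Gamma>" "j \<noteq> i" by (auto simp: contractible_def)
    then have jV: "j \<in> V" "i \<in> V" using graph_onD[OF \<Gamma>] by auto
    have D: "Domain \<Gamma> \<subseteq> V" "finite (Domain \<Gamma>)" "j \<in> Domain \<Gamma>"
      using \<Gamma> V graph_on_Domain finite_subset ji by blast+
    have im: "\<sigma> ` (V - {j}) = \<sigma> ` V - {\<sigma> j}"
      using \<sigma> jV by (auto simp: inj_on_def)
    note gc = graph_on_contract[OF \<Gamma> ji]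
    have "coeff_on \<delta> (\<sigma> ` (V - {j})) (relabel \<sigma> (contract \<Gamma> j i)) 
       = eps_deb (contract \<Gamma> j i) \<sigma> * coeff_on \<delta> (V - {j}) (contract \<Gamma> j i)"
      using \<delta> V jV \<sigma> gc by (intro coeff_on_relabel) (auto intro: inj_on_subset)
    moreover have "eps_front (relabel \<sigma> \<Gamma>) (\<sigma> j) * eps_deb (contract \<Gamma> j i) \<sigma> =
        eps_deb \<Gamma> \<sigma> * eps_front \<Gamma> j"
      using inversion_sign_remove[OF D(2,3) inj_on_subset[OF \<sigma> D(1)]] \<Gamma> V(1) gc graph_on_relabel[OF \<Gamma> \<sigma>]
      by (simp add: eps_deb_eq_inversion_sign[where V = V] eps_deb_eq_inversion_sign[where V = "V - {j}"]
         eps_front_eq[where V = V] eps_front_eq[where V = "\<sigma> ` V"] Domain_contract Domain_relabel mult.commute)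
    ultimately show "eps_front (relabel \<sigma> \<Gamma>) (\<sigma> j) * 
        coeff_on \<delta> (\<sigma> ` V - {\<sigma> j}) (contract (relabel \<sigma> \<Gamma>) (\<sigma> j) (\<sigma> i)) =
        eps_deb \<Gamma> \<sigma> * (eps_front \<Gamma> j * coeff_on \<delta> (V - {j}) (contract \<Gamma> j i))"
      by (simp add: im relabel_contract[OF \<Gamma> \<sigma> jV] flip: mult.assoc)
  qed
  finally show ?thesis
    by (simp add: coboundary_coeff_def sum_distrib_left case_prod_unfold)
qed

section \<open>Coefficients of coboundaries\<close>

lemma valence_target_gt_1_iff:
  assumes "graph_on V \<Gamma>" "finite V" "(j, i) \<in> \<Gamma>" "j \<noteq> i"
  shows "card (Deb \<Gamma> i) + card (Fin \<Gamma> i) > 1 \<longleftrightarrow> (\<exists>c. (i, c) \<in> \<Gamma>) \<or> (\<exists>a. a \<noteq> j \<and> (a, i) \<in> \<Gamma>)"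
proof -
  have fin: "finite (Deb \<Gamma> i)" "finite (Fin \<Gamma> i)"
    using graph_on_finite[OF assms(1,2)] by (auto simp: Deb_def Fin_def)
  have "Fin \<Gamma> i = insert (j, i) {e \<in> Fin \<Gamma> i. e \<noteq> (j, i)}"
    using assms(3) by (auto simp: Fin_def)
  then have "card (Fin \<Gamma> i) = Suc (card {e \<in> Fin \<Gamma> i. e \<noteq> (j, i)})"
    using fin by (metis (mono_tags, lifting) card_insert_disjoint finite_subset mem_Collect_eq subset_insertI)
  then have "card (Deb \<Gamma> i) + card (Fin \<Gamma> i) > 1 \<longleftrightarrow> Deb \<Gamma> i \<noteq> {} \<or> {e \<in> Fin \<Gamma> i. e \<noteq> (j, i)} \<noteq> {}"
    using fin by (simp add: card_gt_0_iff)
  then show ?thesis by (auto simp: Deb_def Fin_def)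
qed

lemma valence_source_gt_1_iff:
  assumes "graph_on V \<Gamma>" "finite V" "(j, i) \<in> \<Gamma>"
  shows "card (Deb \<Gamma> j) + card (Fin \<Gamma> j) > 1 \<longleftrightarrow> (\<exists>a. (a, j) \<in> \<Gamma>)"
proof -
  have "finite (Fin \<Gamma> j)"
    using graph_on_finite[OF assms(1,2)] by (auto simp: Fin_def)
  moreover have "card (Deb \<Gamma> j) = 1"
    using assms by (subst card_Deb_eq_1_iff) (auto simp: graph_on_def)
  ultimately show ?thesis by (auto simp: Fin_def card_gt_0_iff)
qed

lemma mem_splitting_iff:
  "(a, c) \<in> splitting \<Delta> j i A \<longleftrightarrow>
     (a, c) \<in> \<Delta> \<and> (a, c) \<notin> A \<or> c = j \<and> (a, i) \<in> A \<or> a = j \<and> c = i"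
  by (auto simp: splitting_def)

lemma graph_on_splitting:
  assumes "graph_on (V - {j}) \<Delta>" "i \<in> V" "j \<in> V" "A \<subseteq> Fin \<Delta> i"
  shows "graph_on V (splitting \<Delta> j i A)"
  unfolding graph_on_def
proof (intro conjI subsetI single_valuedI)
  note \<Delta> = graph_onD[OF assms(1)] and u = graph_on_unique[OF assms(1)]
  have A: "(a, c) \<in> A \<Longrightarrow> (a, c) \<in> \<Delta> \<and> c = i" for a c
    using assms(4) by (auto simp: Fin_def)
  show "e \<in> V \<times> V" if "e \<in> splitting \<Delta> j i A" for e
  proof -
    obtain a c where e: "e = (a, c)" by force
    then have "a \<in> V \<and> c \<in> V"
      using that \<Delta>[of a c] \<Delta>[of a i] A[of a c] A[of a i] assms(2,3) by (auto simp: mem_splitting_iff)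
    then show ?thesis by (simp add: e)
  qed
  show "c = d" if "(a, c) \<in> splitting \<Delta> j i A" "(a, d) \<in> splitting \<Delta> j i A" for a c d
    using that \<Delta>[of a] A[of a] u[of a] unfolding mem_splitting_iff by blast
qed

lemma mem_contract_iff:
  "i \<noteq> j \<Longrightarrow> (a, c) \<in> contract \<Gamma> j i \<longleftrightarrow> a \<noteq> j \<and> ((a, c) \<in> \<Gamma> \<and> c \<noteq> j \<or> c = i \<and> (a, j) \<in> \<Gamma>)"
  by (auto simp: contract_def)

text \<open>All arrows into \<open>j\<close> come from \<open>A\<close>, and contraction sends them
  back to \<open>i\<close>; in particular a loop at \<open>i\<close> that became an arrow from
  \<open>i\<close> to \<open>j\<close> becomes a loop again.\<close>

lemma contract_splitting:
  assumes "graph_on (V - {j}) \<Delta>" "A \<subseteq> Fin \<Delta> i" "i \<noteq> j"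
  shows "contract (splitting \<Delta> j i A) j i = \<Delta>"
proof -
  note \<Delta> = graph_onD[OF assms(1)]
  have A: "(a, c) \<in> A \<Longrightarrow> (a, c) \<in> \<Delta> \<and> c = i" for a c
    using assms(2) by (auto simp: Fin_def)
  have "(a, c) \<in> contract (splitting \<Delta> j i A) j i \<longleftrightarrow> (a, c) \<in> \<Delta>" for a c
    using \<Delta>[of a c] \<Delta>[of a i] \<Delta>[of a j] A[of a c] A[of a i] A[of a j] assms(3)
    unfolding mem_contract_iff[OF assms(3)] mem_splitting_iff by blast
  then show ?thesis by auto
qed

text \<open>The redirected set can be read off from \<Gamma>: it consists of the arrows into
  \<open>j\<close>, made to end at \<open>i\<close>.\<close>

lemma splitting_contract:
  assumes "graph_on V \<Gamma>" "(j, i) \<in> \<Gamma>" "i \<noteq> j"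
  shows "splitting (contract \<Gamma> j i) j i {(a, i) | a. (a, j) \<in> \<Gamma>} = \<Gamma>"
proof -
  note u = graph_on_unique[OF assms(1)]
  have "(a, c) \<in> splitting (contract \<Gamma> j i) j i {(a, i) | a. (a, j) \<in> \<Gamma>} \<longleftrightarrow> (a, c) \<in> \<Gamma>" for a c
    using assms(2,3) u[of a c] u[of a j] u[of j c i] u[of j j i] 
    by (auto simp: mem_splitting_iff mem_contract_iff)
  then show ?thesis by auto
qed

lemma mem_proper_splittings_iff:
  assumes \<Delta>: "graph_on (V - {j}) \<Delta>" and V: "finite V" "i \<in> V" "j \<in> V" "i \<noteq> j" and \<Gamma>: "graph_on V \<Gamma>"
  shows "\<Gamma> \<in> proper_splittings \<Delta> j i \<longleftrightarrow> contractible \<Gamma> j i \<and> \<Delta> = contract \<Gamma> j i"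
proof -
  let ?P = "\<exists>a. (a, j) \<in> \<Gamma>" and ?Q = "(\<exists>c. (i, c) \<in> \<Gamma>) \<or> (\<exists>a. a \<noteq> j \<and> (a, i) \<in> \<Gamma>)"
  \<comment> \<open>The vertex \<open>i\<close> is isolated in \<Delta> exactly when
    \<open>?P\<close> and \<open>?Q\<close> both fail, and both valences in \<Gamma> exceed 1
    exactly when \<open>?P\<close> and \<open>?Q\<close> both hold.\<close>
  have proper: "(Deb \<Delta> i = {} \<and> Fin \<Delta> i = {} \<or>
         card (Deb \<Gamma> i) + card (Fin \<Gamma> i) > 1 \<and> card (Deb \<Gamma> j) + card (Fin \<Gamma> j) > 1) \<longleftrightarrow> (?P \<longleftrightarrow> ?Q)"
    if ji: "(j, i) \<in> \<Gamma>" and c: "\<Delta> = contract \<Gamma> j i"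
  proof -
    have "Deb \<Delta> i = {} \<and> Fin \<Delta> i = {} \<longleftrightarrow> (\<forall>b. (i, b) \<notin> \<Delta>) \<and> (\<forall>a. (a, i) \<notin> \<Delta>)"
      by (auto simp: Deb_def Fin_def)
    also have "(\<forall>b. (i, b) \<notin> \<Delta>) \<longleftrightarrow> \<not> (\<exists>c. (i, c) \<in> \<Gamma>)"
      using V(4) by (auto simp: c mem_contract_iff)
    also have "(\<forall>a. (a, i) \<notin> \<Delta>) \<longleftrightarrow> \<not> ?P \<and> \<not> (\<exists>a. a \<noteq> j \<and> (a, i) \<in> \<Gamma>)"
    proof -
      have "(j, j) \<notin> \<Gamma>" using V(4) graph_on_unique[OF \<Gamma> ji, of j] by blast
      then have "a \<noteq> j" if "(a, j) \<in> \<Gamma>" for a using that by blast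
      moreover have "(a, i) \<in> \<Delta> \<longleftrightarrow> a \<noteq> j \<and> ((a, i) \<in> \<Gamma> \<or> (a, j) \<in> \<Gamma>)" for a
        using V(4) by (simp add: c mem_contract_iff)
      ultimately show ?thesis by metis
    qed
    finally have "Deb \<Delta> i = {} \<and> Fin \<Delta> i = {} \<longleftrightarrow> \<not> ?P \<and> \<not> ?Q"
      by (simp add: conj_commute conj_left_commute)
    then show ?thesis
      using valence_source_gt_1_iff[OF \<Gamma> V(1) ji] valence_target_gt_1_iff[OF \<Gamma> V(1) ji] V(4) by blast
  qed
  show ?thesis
  proof
    assume "\<Gamma> \<in> proper_splittings \<Delta> j i"
    then obtain A where A: "A \<subseteq> Fin \<Delta> i" "\<Gamma> = splitting \<Delta> j i A" and
      p: "Deb \<Delta> i = {} \<and> Fin \<Delta> i = {} \<or>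
         card (Deb \<Gamma> i) + card (Fin \<Gamma> i) > 1 \<and> card (Deb \<Gamma> j) + card (Fin \<Gamma> j) > 1"
      unfolding proper_splittings_def by blast
    have ji: "(j, i) \<in> \<Gamma>" by (simp add: A(2) mem_splitting_iff)
    have c: "\<Delta> = contract \<Gamma> j i"
      using contract_splitting[OF \<Delta> A(1) V(4)] A(2) by simp
    show "contractible \<Gamma> j i \<and> \<Delta> = contract \<Gamma> j i"
      unfolding contractible_def using ji c V(4) proper[OF ji c] p by blast
  next
    assume a: "contractible \<Gamma> j i \<and> \<Delta> = contract \<Gamma> j i"
    then have ji: "(j, i) \<in> \<Gamma>" and c: "\<Delta> = contract \<Gamma> j i" by (auto simp: contractible_def)
    let ?A = "{(a, i) | a. (a, j) \<in> \<Gamma>}"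
    have "?A \<subseteq> Fin \<Delta> i"
      using V(4) graph_on_unique[OF \<Gamma> ji, of j] by (auto simp: c Fin_def mem_contract_iff)
    moreover have "\<Gamma> = splitting \<Delta> j i ?A"
      using splitting_contract[OF \<Gamma> ji V(4)] c by simp
    moreover have "?P \<longleftrightarrow> ?Q" using a by (simp add: contractible_def)
    ultimately show "\<Gamma> \<in> proper_splittings \<Delta> j i"
      unfolding proper_splittings_def using proper[OF ji c] by blast
  qed
qed

lemma graph_on_proper_splittings:
  assumes "graph_on (V - {j}) \<Delta>" "i \<in> V" "j \<in> V" "\<Gamma> \<in> proper_splittings \<Delta> j i"
  shows "graph_on V \<Gamma>"
  using assms graph_on_splitting unfolding proper_splittings_def by blast

lemma finite_proper_splittings:
  assumes "graph_on V \<Delta>" "finite V"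
  shows "finite (proper_splittings \<Delta> j i)"
proof (rule finite_subset)
  show "proper_splittings \<Delta> j i \<subseteq> splitting \<Delta> j i ` Pow (Fin \<Delta> i)"
    by (auto simp: proper_splittings_def)
  show "finite (splitting \<Delta> j i ` Pow (Fin \<Delta> i))"
    using graph_on_finite[OF assms] by (auto simp: Fin_def)
qed

lemma skip_image:
  assumes "j \<le> n"
  shows "skip j ` {1..n} = {0..n} - {j}" 
proof (intro equalityI subsetI)
  fix u assume u: "u \<in> {0..n} - {j}"
  show "u \<in> skip j ` {1..n}"
    by (rule image_eqI[of _ _ "if u < j then Suc u else u"]) (use u assms in \<open>auto simp: skip_def\<close>)
qed (use assms in \<open>auto simp: skip_def split: if_splits\<close>)

lemma inj_on_skip: "inj_on (skip j) {1..n}"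
  by (auto simp: inj_on_def skip_def split: if_splits)

lemma rank_skip:
  assumes "j \<le> n" "v \<in> {1..n}"
  shows "rank ({0..n} - {j}) (skip j v) = v"
proof (cases "v \<le> j")
  case True
  then have "{u \<in> {0..n} - {j}. u \<le> skip j v} = {..<v}"
    using assms by (auto simp: skip_def)
  then show ?thesis by (simp add: rank_def)
next
  case False
  then have "{u \<in> {0..n} - {j}. u \<le> skip j v} = {..v} - {j}"
    using assms by (auto simp: skip_def)
  then show ?thesis using False by (simp add: rank_def)
qed

lemma relabel_skip_eq_iff:
  assumes "j \<le> n" "graph_on {1..n} \<Delta>" "graph_on ({0..n} - {j}) \<Gamma>"
  shows "relabel (skip j) \<Delta> = \<Gamma> \<longleftrightarrow> \<Delta> = relabel (rank ({0..n} - {j})) \<Gamma>"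
proof -
  let ?V = "{0..n} - {j}"
  have 1: "relabel (rank ?V) (relabel (skip j) \<Delta>) = \<Delta>"
  proof -
    have "relabel (rank ?V \<circ> skip j) \<Delta> = relabel id \<Delta>"
      by (rule relabel_cong[of _ "{1..n}"]) (use assms rank_skip in \<open>auto simp: graph_on_def\<close>)
    then show ?thesis by (simp add: relabel_comp relabel_id)
  qed
  have 2: "relabel (skip j) (relabel (rank ?V) \<Gamma>) = \<Gamma>"
  proof -
    have "relabel (skip j \<circ> rank ?V) \<Gamma> = relabel id \<Gamma>"
    proof (rule relabel_cong[of _ ?V])
      fix v assume "v \<in> ?V"
      then obtain u where "u \<in> {1..n}" "v = skip j u" using skip_image[OF assms(1)] by blast
      then show "(skip j \<circ> rank ?V) v = id v" using rank_skip[OF assms(1)] by simp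
    qed (use assms in \<open>auto simp: graph_on_def\<close>)
    then show ?thesis by (simp add: relabel_comp relabel_id)
  qed
  show ?thesis using 1 2 by metis
qed

lemma relabel_Suc_eq_iff: "relabel Suc \<Gamma> = relabel Suc \<Gamma>' \<longleftrightarrow> \<Gamma> = \<Gamma>'"
  unfolding relabel_def by (rule inj_image_eq_iff) (simp add: prod.inj_map)

lemma lookup_coboundary_graph:
  assumes "graph_on {1..n} \<Delta>"
  shows "Poly_Mapping.lookup (coboundary_graph n \<Delta>) G = 
    - (\<Sum>(i, j) | i \<le> n \<and> j \<le> n \<and> i \<noteq> j. \<Sum>\<Delta>'\<in>proper_splittings (relabel (skip j) \<Delta>) j i.
          if relabel Suc \<Delta>' = G then eps_front \<Delta>' j else 0)"
  unfolding coboundary_graph_def lookup_uminus lookup_sum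
  by (intro arg_cong[of _ _ uminus] sum.cong) (auto simp: lookup_sum lookup_single when_def)

lemma graph_on_relabel_skip:
  assumes "graph_on {1..n} \<Delta>" "j \<le> n"
  shows "graph_on ({0..n} - {j}) (relabel (skip j) \<Delta>)"
  using graph_on_relabel[OF assms(1) inj_on_skip, of j] by (simp only: skip_image[OF assms(2)])

lemma lookup_scaleR_poly_mapping:
  "Poly_Mapping.lookup (c *\<^sub>R x) k = c *\<^sub>R Poly_Mapping.lookup x k"
proof -
  have "{k. c *\<^sub>R Poly_Mapping.lookup x k \<noteq> 0} \<subseteq> {k. Poly_Mapping.lookup x k \<noteq> 0}" by auto
  then have "finite {k. c *\<^sub>R Poly_Mapping.lookup x k \<noteq> 0}"
    by (rule finite_subset) simp
  then show ?thesis by (simp add: scaleR_poly_mapping_def)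
qed

text \<open>Once the sums are exchanged, a pair \<open>(i, j)\<close> singles out one graph
  \<Delta>, the relabelled contraction of \<Gamma>. If it is not among the keys of \<delta>, its
  coefficient is 0 and the formula still holds.\<close>

lemma lookup_coboundary_relabel_Suc:
  assumes \<delta>: "\<delta> \<in> symmetric_combs n" and \<Gamma>: "graph_on {0..n} \<Gamma>"
  shows "Poly_Mapping.lookup (coboundary n \<delta>) (relabel Suc \<Gamma>) = coboundary_coeff \<delta> {0..n} \<Gamma>"
proof -
  let ?K = "Poly_Mapping.keys \<delta>" and ?I = "{(i, j). i \<le> n \<and> j \<le> n \<and> i \<noteq> j}"
  have K: "graph_on {1..n} \<Delta>" if "\<Delta> \<in> ?K" for \<Delta>
    using \<delta> that by (auto simp: symmetric_combs_def mem_vectorial_graphs)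
  have inner: "(\<Sum>\<Delta>'\<in>proper_splittings (relabel (skip j) \<Delta>) j i.
          if relabel Suc \<Delta>' = relabel Suc \<Gamma> then eps_front \<Delta>' j else 0) =
        (if contractible \<Gamma> j i \<and> \<Delta> = relabel (rank ({0..n} - {j})) (contract \<Gamma> j i) then eps_front \<Gamma> j else 0)"
    if "\<Delta> \<in> ?K" "(i, j) \<in> ?I" for \<Delta> i j
  proof -
    have ij: "i \<in> {0..n}" "j \<in> {0..n}" "i \<noteq> j" "j \<le> n" using that(2) by auto
    note g = graph_on_relabel_skip[OF K[OF that(1)] ij(4)]
    have "(\<Sum>\<Delta>'\<in>proper_splittings (relabel (skip j) \<Delta>) j i.
          if relabel Suc \<Delta>' = relabel Suc \<Gamma> then eps_front \<Delta>' j else 0) =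
        (if \<Gamma> \<in> proper_splittings (relabel (skip j) \<Delta>) j i then eps_front \<Gamma> j else 0)"
      using finite_proper_splittings[OF g] by (simp add: relabel_Suc_eq_iff)
    also have "\<Gamma> \<in> proper_splittings (relabel (skip j) \<Delta>) j i \<longleftrightarrow>
        contractible \<Gamma> j i \<and> relabel (skip j) \<Delta> = contract \<Gamma> j i"
      by (rule mem_proper_splittings_iff[OF g _ ij(1-3) \<Gamma>]) simp
    also have "\<dots> \<longleftrightarrow> contractible \<Gamma> j i \<and> \<Delta> = relabel (rank ({0..n} - {j})) (contract \<Gamma> j i)"
    proof -
      have "contractible \<Gamma> j i \<Longrightarrow> graph_on ({0..n} - {j}) (contract \<Gamma> j i)"
        by (rule graph_on_contract[OF \<Gamma>]) (auto simp: contractible_def)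
      then show ?thesis
        using relabel_skip_eq_iff[OF ij(4) K[OF that(1)]] by blast
    qed
    finally show ?thesis .
  qed
  have "Poly_Mapping.lookup (coboundary n \<delta>) (relabel Suc \<Gamma>) = 
     (\<Sum>\<Delta>\<in>?K. Poly_Mapping.lookup \<delta> \<Delta> * - (\<Sum>(i, j)\<in>?I. 
        if contractible \<Gamma> j i \<and> \<Delta> = relabel (rank ({0..n} - {j})) (contract \<Gamma> j i) then eps_front \<Gamma> j else 0))"
    unfolding coboundary_def lookup_sum lookup_scaleR_poly_mapping real_scaleR_def
    by (intro sum.cong refl arg_cong2[of _ _ _ _ "(*)"], subst lookup_coboundary_graph, (rule K, assumption))
       (intro arg_cong[of _ _ uminus] sum.cong refl, use inner in auto)
  also have "\<dots> = - (\<Sum>(i, j)\<in>?I. \<Sum>\<Delta>\<in>?K. Poly_Mapping.lookup \<delta> \<Delta> * 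
       (if contractible \<Gamma> j i \<and> \<Delta> = relabel (rank ({0..n} - {j})) (contract \<Gamma> j i) then eps_front \<Gamma> j else 0))"
    unfolding mult_minus_right sum_negf sum_distrib_left
    by (subst sum.swap) (simp add: case_prod_unfold)
  also have "\<dots> = - (\<Sum>(i, j)\<in>?I. if contractible \<Gamma> j i then 
       eps_front \<Gamma> j * coeff_on \<delta> ({0..n} - {j}) (contract \<Gamma> j i) else 0)"
  proof (intro arg_cong[of _ _ uminus] sum.cong refl, clarify)
    fix i j
    show "(\<Sum>\<Delta>\<in>?K. Poly_Mapping.lookup \<delta> \<Delta> * 
       (if contractible \<Gamma> j i \<and> \<Delta> = relabel (rank ({0..n} - {j})) (contract \<Gamma> j i) then eps_front \<Gamma> j else 0)) =
       (if contractible \<Gamma> j i then 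
       eps_front \<Gamma> j * coeff_on \<delta> ({0..n} - {j}) (contract \<Gamma> j i) else 0)"
      by (cases "contractible \<Gamma> j i") 
        (simp_all add: coeff_on_def if_distrib[of "(*) _"] in_keys_iff cong: if_cong)
  qed
  also have "(\<Sum>(i, j)\<in>?I. if contractible \<Gamma> j i then 
       eps_front \<Gamma> j * coeff_on \<delta> ({0..n} - {j}) (contract \<Gamma> j i) else 0) = 
     (\<Sum>(j, i) | contractible \<Gamma> j i. eps_front \<Gamma> j * coeff_on \<delta> ({0..n} - {j}) (contract \<Gamma> j i))"
  proof -
    let ?f = "\<lambda>j i. eps_front \<Gamma> j * coeff_on \<delta> ({0..n} - {j}) (contract \<Gamma> j i)"
    have fin: "finite ?I" by (rule finite_subset[of _ "{..n} \<times> {..n}"]) auto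
    have bound: "i \<le> n \<and> j \<le> n \<and> i \<noteq> j" if "contractible \<Gamma> j i" for i j
      using that graph_onD[OF \<Gamma>, of j i] by (auto simp: contractible_def)
    have "(\<Sum>(i, j)\<in>?I. if contractible \<Gamma> j i then ?f j i else 0) = 
       (\<Sum>x\<in>?I. if contractible \<Gamma> (snd x) (fst x) then ?f (snd x) (fst x) else 0)"
      by (simp add: case_prod_unfold)
    also have "\<dots> = (\<Sum>x\<in>{x \<in> ?I. contractible \<Gamma> (snd x) (fst x)}. ?f (snd x) (fst x))"
      by (rule sum.inter_filter[symmetric, OF fin])
    also have "\<dots> = (\<Sum>(j, i) | contractible \<Gamma> j i. ?f j i)"
      by (rule sum.reindex_bij_witness[of _ prod.swap prod.swap]) (use bound in auto)
    finally show ?thesis .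
  qed
  finally show ?thesis by (simp add: coboundary_coeff_def)
qed

text \<open>The shift from \<open>{0..n}\<close> to \<open>{1..Suc n}\<close> is increasing and
  costs no sign.\<close>

lemma lookup_coboundary:
  assumes \<delta>: "\<delta> \<in> symmetric_combs n" and G: "graph_on {1..Suc n} G"
  shows "Poly_Mapping.lookup (coboundary n \<delta>) G = coboundary_coeff \<delta> {1..Suc n} G"
proof -
  define \<Gamma> where "\<Gamma> = relabel (\<lambda>x. x - 1) G"
  have im: "(\<lambda>x. x - 1) ` {1..Suc n} = {0..n}" "Suc ` {0..n} = {1..Suc n}"
    by (force simp: image_iff intro: bexI[of _ "Suc _"])+
  have inj: "inj_on (\<lambda>x::nat. x - 1) {1..Suc n}" by (auto simp: inj_on_def)
  have \<Gamma>: "graph_on {0..n} \<Gamma>"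
    using graph_on_relabel[OF G inj] unfolding im \<Gamma>_def .
  have "relabel (Suc \<circ> (\<lambda>x. x - 1)) G = relabel id G"
    by (rule relabel_cong[of _ "{1..Suc n}"]) (use G in \<open>auto simp: graph_on_def\<close>)
  then have eq: "relabel Suc \<Gamma> = G" by (simp add: \<Gamma>_def relabel_comp relabel_id)
  have "eps_deb \<Gamma> Suc = 1"
    by (simp add: eps_deb_eq_inversion_sign[OF \<Gamma>] inversion_sign_strict_mono strict_mono_on_def)
  then have "coboundary_coeff \<delta> {1..Suc n} G = coboundary_coeff \<delta> {0..n} \<Gamma>"
    using coboundary_coeff_relabel[OF \<delta> _ _ \<Gamma>, of Suc] unfolding im eq by simp
  then show ?thesis using lookup_coboundary_relabel_Suc[OF \<delta> \<Gamma>] eq by simp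
qed

lemma lookup_coboundary_eq_0:
  assumes \<delta>: "\<delta> \<in> symmetric_combs n" and G: "\<not> graph_on {1..Suc n} G"
  shows "Poly_Mapping.lookup (coboundary n \<delta>) G = 0"
proof -
  have "Poly_Mapping.lookup (coboundary_graph n \<Delta>) G = 0" if "\<Delta> \<in> Poly_Mapping.keys \<delta>" for \<Delta>
  proof -
    have \<Delta>: "graph_on {1..n} \<Delta>"
      using \<delta> that by (auto simp: symmetric_combs_def mem_vectorial_graphs)
    have "relabel Suc \<Gamma> \<noteq> G" if "i \<le> n" "j \<le> n" "\<Gamma> \<in> proper_splittings (relabel (skip j) \<Delta>) j i" for i j \<Gamma>
    proof
      assume "relabel Suc \<Gamma> = G"
      moreover have "graph_on {0..n} \<Gamma>"
        by (rule graph_on_proper_splittings[OF graph_on_relabel_skip[OF \<Delta> that(2)] _ _ that(3)]) (use that in auto)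
      ultimately have "graph_on (Suc ` {0..n}) G" using graph_on_relabel[of "{0..n}" \<Gamma> Suc] by simp
      then show False using G by (simp add: image_Suc_atLeastAtMost)
    qed
    then show ?thesis
      unfolding lookup_coboundary_graph[OF \<Delta>] by (auto intro!: sum.neutral)
  qed
  then show ?thesis by (simp add: coboundary_def lookup_sum lookup_scaleR_poly_mapping)
qed

lemma coboundary_symmetric:
  assumes "\<delta> \<in> symmetric_combs n"
  shows "coboundary n \<delta> \<in> symmetric_combs (Suc n)"
  unfolding symmetric_combs_def
proof (intro CollectI conjI ballI allI impI subsetI)
  fix G assume "G \<in> Poly_Mapping.keys (coboundary n \<delta>)"
  then show "G \<in> vectorial_graphs (Suc n)"
    using lookup_coboundary_eq_0[OF assms, of G] by (auto simp: mem_vectorial_graphs in_keys_iff)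
next
  fix G \<sigma> assume "G \<in> vectorial_graphs (Suc n)" and \<sigma>: "\<sigma> permutes {1..Suc n}"
  then have G: "graph_on {1..Suc n} G" by (simp add: mem_vectorial_graphs)
  show "Poly_Mapping.lookup (coboundary n \<delta>) (relabel \<sigma> G) = eps_deb G \<sigma> * Poly_Mapping.lookup (coboundary n \<delta>) G"
    using coboundary_coeff_relabel[OF assms _ _ G permutes_inj_on[OF \<sigma>]]
      lookup_coboundary[OF assms G] lookup_coboundary[OF assms relabel_permutes[OF \<sigma> G]]
    by (simp add: permutes_image[OF \<sigma>] del: atLeastAtMost_iff One_nat_def)
qed

section \<open>Linearity of the coboundary; cocycles and coboundaries as subspaces\<close>

lemma symmetric_combs_0: "0 \<in> symmetric_combs n"
  by (simp add: symmetric_combs_def)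

lemma symmetric_combs_add:
  "x \<in> symmetric_combs n \<Longrightarrow> y \<in> symmetric_combs n \<Longrightarrow> x + y \<in> symmetric_combs n"
  using Poly_Mapping.keys_add[of x y] by (auto simp: symmetric_combs_def lookup_add distrib_left)

lemma symmetric_combs_scaleR:
  "x \<in> symmetric_combs n \<Longrightarrow> c *\<^sub>R x \<in> symmetric_combs n"
  by (auto simp: symmetric_combs_def lookup_scaleR_poly_mapping in_keys_iff subset_iff)

lemma coboundary_coeff_add:
  "coboundary_coeff (x + y) V \<Gamma> = coboundary_coeff x V \<Gamma> + coboundary_coeff y V \<Gamma>"
  by (simp add: coboundary_coeff_def coeff_on_def lookup_add distrib_left sum.distrib case_prod_unfold)

lemma coboundary_coeff_scaleR:
  "coboundary_coeff (c *\<^sub>R x) V \<Gamma> = c * coboundary_coeff x V \<Gamma>"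
  by (simp add: coboundary_coeff_def coeff_on_def lookup_scaleR_poly_mapping sum_distrib_left 
      case_prod_unfold mult.left_commute)

text \<open>The defining sum runs over the keys, which change under addition; the formula for the
  coefficients does not mention them and is linear.\<close>

lemma coboundary_add:
  assumes "x \<in> symmetric_combs n" "y \<in> symmetric_combs n"
  shows "coboundary n (x + y) = coboundary n x + coboundary n y"
proof (rule poly_mapping_eqI)
  fix G
  show "Poly_Mapping.lookup (coboundary n (x + y)) G = Poly_Mapping.lookup (coboundary n x + coboundary n y) G"
    using assms symmetric_combs_add[OF assms]
    by (cases "graph_on {1..Suc n} G")
       (simp_all add: lookup_coboundary lookup_coboundary_eq_0 lookup_add coboundary_coeff_add)
qed

lemma coboundary_scaleR:
  assumes "x \<in> symmetric_combs n"
  shows "coboundary n (c *\<^sub>R x) = c *\<^sub>R coboundary n x"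
proof (rule poly_mapping_eqI)
  fix G
  show "Poly_Mapping.lookup (coboundary n (c *\<^sub>R x)) G = Poly_Mapping.lookup (c *\<^sub>R coboundary n x) G"
    using assms symmetric_combs_scaleR[OF assms]
    by (cases "graph_on {1..Suc n} G")
       (simp_all add: lookup_coboundary lookup_coboundary_eq_0 lookup_scaleR_poly_mapping coboundary_coeff_scaleR)
qed

lemma subspace_symmetric_combs: "subspace (symmetric_combs n)"
  by (simp add: subspace_def symmetric_combs_0 symmetric_combs_add symmetric_combs_scaleR)

lemma coboundary_0: "coboundary n 0 = 0"
  by (simp add: coboundary_def)

lemma subspace_cocycles: "subspace (cocycles n)"
  by (auto simp: subspace_def cocycles_def symmetric_combs_0 symmetric_combs_add symmetric_combs_scaleR
      coboundary_add coboundary_scaleR coboundary_0)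

text \<open>On the single vertex \<open>0\<close> there is no pair of distinct vertices. Hence the
  convention for coboundaries in degree 1 agrees with the general formula.\<close>

lemma coboundary_0_left: "coboundary 0 x = 0"
proof -
  have "{(i, j). i \<le> (0::nat) \<and> j \<le> (0::nat) \<and> i \<noteq> j} = {}" by auto
  then show ?thesis
    by (simp only: coboundary_def coboundary_graph_def sum.empty minus_zero scaleR_zero_right sum.neutral_const)
qed

lemma coboundaries_eq:
  assumes "n \<ge> 1"
  shows "coboundaries n = coboundary (n - 1) ` symmetric_combs (n - 1)"
proof (cases "n = 1")
  case True
  then show ?thesis
    using symmetric_combs_0[of 0] by (auto simp: coboundaries_def coboundary_0_left)
next
  case False
  then show ?thesis using assms by (simp add: coboundaries_def)
qed

lemma subspace_coboundaries: "subspace (coboundaries n)"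
proof (cases "n \<le> 1")
  case True
  then show ?thesis by (simp add: coboundaries_def subspace_def)
next
  case False
  then have "coboundaries n = coboundary (n - 1) ` symmetric_combs (n - 1)"
    by (simp add: coboundaries_def)
  moreover have "subspace (coboundary m ` symmetric_combs m)" for m
    unfolding subspace_def
  proof (intro conjI ballI allI)
    show "0 \<in> coboundary m ` symmetric_combs m"
      using symmetric_combs_0 coboundary_0 by (metis image_eqI)
    fix x y :: comb and c assume "x \<in> coboundary m ` symmetric_combs m" 
    then show "c *\<^sub>R x \<in> coboundary m ` symmetric_combs m"
      by (auto simp: symmetric_combs_scaleR simp flip: coboundary_scaleR)
    assume "y \<in> coboundary m ` symmetric_combs m"
    with \<open>x \<in> _\<close> show "x + y \<in> coboundary m ` symmetric_combs m"
      by (auto simp: symmetric_combs_add simp flip: coboundary_add)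
  qed
  ultimately show ?thesis by simp
qed

section \<open>The contracting homotopy\<close>

definition leaves :: "nat set \<Rightarrow> vgraph \<Rightarrow> nat set" where
  "leaves V \<Gamma> = {b \<in> V. \<forall>a. (a, b) \<notin> \<Gamma>}"

text \<open>The sign makes the components consisting of a single vertex or a single arrow between two
  vertices, where the homotopy identity would otherwise come out negative, agree with all others.\<close>

definition leaf_sign :: "vgraph \<Rightarrow> nat \<Rightarrow> real" where
  "leaf_sign \<Gamma> b = (if b \<in> Domain \<Gamma> then 1 else - 1)"

text \<open>The vertex \<open>0\<close> stands in front of all vertices of \<open>W\<close>, so
  attaching it affects the signs in the same way whatever leaf it is attached to.\<close>

definition leaf_sum :: "comb \<Rightarrow> nat set \<Rightarrow> vgraph \<Rightarrow> real" where
  "leaf_sum \<delta> W \<Gamma> =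
     (\<Sum>b\<in>leaves W \<Gamma>. leaf_sign \<Gamma> b * coeff_on \<delta> (insert 0 W) (insert (0, b) \<Gamma>))"

lemma finite_leaves: "finite W \<Longrightarrow> finite (leaves W \<Gamma>)"
  by (simp add: leaves_def)

lemma leaves_relabel:
  assumes "graph_on W \<Gamma>" "inj_on \<sigma> W"
  shows "leaves (\<sigma> ` W) (relabel \<sigma> \<Gamma>) = \<sigma> ` leaves W \<Gamma>"
proof -
  have "(\<forall>a. (a, \<sigma> b) \<notin> relabel \<sigma> \<Gamma>) \<longleftrightarrow> (\<forall>a. (a, b) \<notin> \<Gamma>)" if "b \<in> W" for b
    using mem_relabel_iff[OF assms _ that] graph_onD[OF assms(1)] by (metis relabelE prod.inject)
  then show ?thesis by (auto simp: leaves_def)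
qed

lemma graph_on_insert_leaf:
  assumes "graph_on W \<Gamma>" "0 \<notin> W" "b \<in> W"
  shows "graph_on (insert 0 W) (insert (0, b) \<Gamma>)"
  using assms by (auto simp: graph_on_def single_valued_def)

lemma inj_on_extend_0:
  assumes "inj_on \<sigma> W" "0 \<notin> W" "(0::nat) \<notin> \<sigma> ` W"
  shows "inj_on (\<sigma>(0 := 0)) (insert (0::nat) W)"
  unfolding inj_on_insert
proof
  show "inj_on (\<sigma>(0 := 0)) W" by (rule inj_on_fun_updI[OF assms(1,3)])
  have "(\<sigma>(0 := 0)) ` (W - {0}) = \<sigma> ` (W - {0})" by (rule image_cong) auto
  then show "(\<sigma>(0 := 0)) 0 \<notin> (\<sigma>(0 := 0)) ` (W - {0})"
    using assms(3) by (metis Diff_empty Diff_insert0 assms(2) fun_upd_same)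
qed

text \<open>The smallest vertex is fixed, and no image lies below it, so it takes part in no
  inversion.\<close>

lemma eps_deb_insert_leaf:
  assumes "graph_on W \<Gamma>" "finite W" "0 \<notin> W" "b \<in> W" "inj_on \<sigma> W" "0 \<notin> \<sigma> ` W"
  shows "eps_deb (insert (0, b) \<Gamma>) (\<sigma>(0 := 0)) = eps_deb \<Gamma> \<sigma>"
proof -
  let ?D = "Domain \<Gamma>" and ?\<tau> = "\<sigma>(0 := 0)"
  have D: "?D \<subseteq> W" "finite ?D"
    using graph_on_Domain[OF assms(1)] finite_subset[OF _ assms(2)] by blast+
  then have "0 \<notin> ?D" using assms(3) by blast
  have inj: "inj_on ?\<tau> (insert 0 ?D)"
    by (rule inj_on_subset[OF inj_on_extend_0[OF assms(5,3,6)]]) (use D in auto)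
  have "inversion_sign (insert 0 ?D) ?\<tau> = inversion_sign ?D ?\<tau>"
    using inversion_sign_remove[OF _ _ inj, of 0] D \<open>0 \<notin> ?D\<close> by simp
  also have "\<dots> = inversion_sign ?D \<sigma>"
    by (rule inversion_sign_cong) (use \<open>0 \<notin> ?D\<close> in auto)
  finally show ?thesis
    using graph_on_insert_leaf[OF assms(1,3,4)] assms(1,2)
    by (simp add: eps_deb_eq_inversion_sign[where V = W] eps_deb_eq_inversion_sign[where V = "insert 0 W"])
qed

lemma leaf_sum_relabel:
  assumes \<delta>: "\<delta> \<in> symmetric_combs (Suc (card W))" and W: "finite W" "0 \<notin> W" and \<Gamma>: "graph_on W \<Gamma>"
    and \<sigma>: "inj_on \<sigma> W" "0 \<notin> \<sigma> ` W"
  shows "leaf_sum \<delta> (\<sigma> ` W) (relabel \<sigma> \<Gamma>) = eps_deb \<Gamma> \<sigma> * leaf_sum \<delta> W \<Gamma>"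
proof -
  let ?\<tau> = "\<sigma>(0 := 0)"
  have inj: "inj_on ?\<tau> (insert 0 W)"
    by (rule inj_on_extend_0[OF \<sigma>(1) W(2) \<sigma>(2)])
  have \<tau>: "?\<tau> v = \<sigma> v" if "v \<in> W" for v using that W(2) by (metis fun_upd_other)
  have im: "?\<tau> ` insert 0 W = insert 0 (\<sigma> ` W)"
    by (simp only: image_insert image_cong[OF refl \<tau>] fun_upd_same)
  have "leaf_sum \<delta> (\<sigma> ` W) (relabel \<sigma> \<Gamma>) = (\<Sum>b\<in>leaves W \<Gamma>. leaf_sign (relabel \<sigma> \<Gamma>) (\<sigma> b) *
      coeff_on \<delta> (insert 0 (\<sigma> ` W)) (insert (0, \<sigma> b) (relabel \<sigma> \<Gamma>)))"
    unfolding leaf_sum_def leaves_relabel[OF \<Gamma> \<sigma>(1)]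
    by (rule sum.reindex_cong[OF inj_on_subset[OF \<sigma>(1)] refl refl]) (auto simp: leaves_def)
  also have "\<dots> = (\<Sum>b\<in>leaves W \<Gamma>. eps_deb \<Gamma> \<sigma> * 
      (leaf_sign \<Gamma> b * coeff_on \<delta> (insert 0 W) (insert (0, b) \<Gamma>)))"
  proof (rule sum.cong, rule refl)
    fix b assume "b \<in> leaves W \<Gamma>"
    then have b: "b \<in> W" by (simp add: leaves_def)
    have "\<sigma> b \<in> \<sigma> ` Domain \<Gamma> \<longleftrightarrow> b \<in> Domain \<Gamma>"
      using inj_on_image_mem_iff[OF \<sigma>(1) b graph_on_Domain[OF \<Gamma>]] .
    then have sign: "leaf_sign (relabel \<sigma> \<Gamma>) (\<sigma> b) = leaf_sign \<Gamma> b"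
      by (simp add: leaf_sign_def Domain_relabel)
    have "relabel ?\<tau> \<Gamma> = relabel \<sigma> \<Gamma>"
      by (rule relabel_cong[of _ W]) (use \<Gamma> \<tau> in \<open>auto simp: graph_on_def\<close>)
    then have "relabel ?\<tau> (insert (0, b) \<Gamma>) = insert (0, \<sigma> b) (relabel \<sigma> \<Gamma>)"
      using \<tau>[OF b] by (simp add: relabel_insert)
    then have "coeff_on \<delta> (insert 0 (\<sigma> ` W)) (insert (0, \<sigma> b) (relabel \<sigma> \<Gamma>)) =
       eps_deb \<Gamma> \<sigma> * coeff_on \<delta> (insert 0 W) (insert (0, b) \<Gamma>)"
      using coeff_on_relabel[OF _ _ graph_on_insert_leaf[OF \<Gamma> W(2) b] inj] \<delta> W
      by (simp only: im eps_deb_insert_leaf[OF \<Gamma> W b \<sigma>] card_insert_disjoint finite_insert simp_thms)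
    then show "leaf_sign (relabel \<sigma> \<Gamma>) (\<sigma> b) *
      coeff_on \<delta> (insert 0 (\<sigma> ` W)) (insert (0, \<sigma> b) (relabel \<sigma> \<Gamma>)) = eps_deb \<Gamma> \<sigma> * 
      (leaf_sign \<Gamma> b * coeff_on \<delta> (insert 0 W) (insert (0, b) \<Gamma>))"
      by (simp only: sign mult.left_commute)
  qed
  finally show ?thesis by (simp add: leaf_sum_def sum_distrib_left)
qed

text \<open>On leafless graphs the sum is empty, so that the quotient \<open>0 / 0\<close> is \<open>0\<close> as desired.\<close>

definition homotopy :: "nat \<Rightarrow> comb \<Rightarrow> comb" where
  "homotopy n \<delta> = (\<Sum>\<Gamma>\<in>vectorial_graphs n.
     Poly_Mapping.single \<Gamma> (leaf_sum \<delta> {1..n} \<Gamma> / card (leaves {1..n} \<Gamma>)))"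

lemma lookup_homotopy:
  "Poly_Mapping.lookup (homotopy n \<delta>) \<Gamma> =
     (if graph_on {1..n} \<Gamma> then leaf_sum \<delta> {1..n} \<Gamma> / card (leaves {1..n} \<Gamma>) else 0)"
  using finite_vectorial_graphs[of n]
  by (simp add: homotopy_def lookup_sum lookup_single when_def mem_vectorial_graphs)

lemma card_leaves_relabel:
  assumes "graph_on W \<Gamma>" "inj_on \<sigma> W"
  shows "card (leaves (\<sigma> ` W) (relabel \<sigma> \<Gamma>)) = card (leaves W \<Gamma>)"
  unfolding leaves_relabel[OF assms]
  by (rule card_image) (use assms(2) in \<open>auto simp: leaves_def inj_on_def\<close>)

lemma homotopy_symmetric:
  assumes "\<delta> \<in> symmetric_combs (Suc n)"
  shows "homotopy n \<delta> \<in> symmetric_combs n"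
  unfolding symmetric_combs_def
proof (intro CollectI conjI ballI allI impI subsetI)
  fix \<Gamma> assume "\<Gamma> \<in> Poly_Mapping.keys (homotopy n \<delta>)"
  then show "\<Gamma> \<in> vectorial_graphs n"
    by (auto simp: lookup_homotopy mem_vectorial_graphs in_keys_iff split: if_splits)
next
  fix \<Gamma> \<sigma> assume "\<Gamma> \<in> vectorial_graphs n" and \<sigma>: "\<sigma> permutes {1..n}"
  then have \<Gamma>: "graph_on {1..n} \<Gamma>" by (simp add: mem_vectorial_graphs)
  note inj = permutes_inj_on[OF \<sigma>, of "{1..n}"] and im = permutes_image[OF \<sigma>]
  have "leaf_sum \<delta> {1..n} (relabel \<sigma> \<Gamma>) = eps_deb \<Gamma> \<sigma> * leaf_sum \<delta> {1..n} \<Gamma>"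
    using leaf_sum_relabel[OF _ _ _ \<Gamma> inj, of \<delta>] assms unfolding im by simp
  moreover have "card (leaves {1..n} (relabel \<sigma> \<Gamma>)) = card (leaves {1..n} \<Gamma>)"
    using card_leaves_relabel[OF \<Gamma> inj] unfolding im .
  ultimately show "Poly_Mapping.lookup (homotopy n \<delta>) (relabel \<sigma> \<Gamma>) = 
      eps_deb \<Gamma> \<sigma> * Poly_Mapping.lookup (homotopy n \<delta>) \<Gamma>"
    using \<Gamma> relabel_permutes[OF \<sigma> \<Gamma>] by (simp add: lookup_homotopy)
qed

text \<open>The coboundary of a homotopy evaluates it on sets from which a vertex has been deleted;
  there the defining formula holds without renumbering, as ranks are increasing and avoid
  \<open>0\<close>.\<close>

lemma coeff_on_homotopy:
  assumes \<delta>: "\<delta> \<in> symmetric_combs (Suc n)" and W: "finite W" "0 \<notin> W" "card W = n" and \<Gamma>: "graph_on W \<Gamma>"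
  shows "coeff_on (homotopy n \<delta>) W \<Gamma> = leaf_sum \<delta> W \<Gamma> / card (leaves W \<Gamma>)"
proof -
  let ?r = "rank W"
  have im: "?r ` W = {1..n}" using rank_image[OF W(1)] W(3) by simp
  note inj = inj_on_rank[OF W(1)]
  have "eps_deb \<Gamma> ?r = 1"
    unfolding eps_deb_eq_inversion_sign[OF \<Gamma> W(1)]
    by (rule inversion_sign_strict_mono)
       (rule monotone_on_subset[OF strict_mono_on_rank[OF W(1)] graph_on_Domain[OF \<Gamma>]])
  then have "leaf_sum \<delta> {1..n} (relabel ?r \<Gamma>) = leaf_sum \<delta> W \<Gamma>"
    using leaf_sum_relabel[OF _ W(1,2) \<Gamma> inj] \<delta> W(3) unfolding im by simp
  then show ?thesis
    using graph_on_relabel[OF \<Gamma> inj] card_leaves_relabel[OF \<Gamma> inj]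
    unfolding im by (simp add: coeff_on_def lookup_homotopy)
qed

text \<open>The head \<open>i\<close> is no leaf of \<Gamma>. If \<open>j\<close> is a leaf,
  contractibility says that \<open>i\<close> has no other incoming arrow, so \<open>i\<close>
  becomes a leaf in place of \<open>j\<close>. Otherwise \<open>i\<close> inherits an incoming arrow
  of \<open>j\<close> and is still no leaf.\<close>

lemma leaves_contract:
  assumes \<Gamma>: "graph_on W \<Gamma>" and c: "contractible \<Gamma> j i"
  shows "leaves (W - {j}) (contract \<Gamma> j i) =
    (if j \<in> leaves W \<Gamma> then insert i (leaves W \<Gamma> - {j}) else leaves W \<Gamma>)"
proof -
  have ji: "(j, i) \<in> \<Gamma>" "i \<noteq> j" using c by (auto simp: contractible_def)
  have V: "i \<in> W" "j \<in> W" using graph_onD[OF \<Gamma> ji(1)] by auto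
  have jj: "(j, j) \<notin> \<Gamma>" using graph_on_unique[OF \<Gamma> ji(1), of j] ji(2) by blast
  have other: "(\<forall>a. (a, b) \<notin> contract \<Gamma> j i) \<longleftrightarrow> (\<forall>a. (a, b) \<notin> \<Gamma>)" if "b \<noteq> i" "b \<noteq> j" for b
  proof -
    have "(j, b) \<notin> \<Gamma>" using that graph_on_unique[OF \<Gamma> ji(1), of b] by blast
    then show ?thesis using that by (metis mem_contract_iff[OF ji(2)])
  qed
  have i: "(\<forall>a. (a, i) \<notin> contract \<Gamma> j i) \<longleftrightarrow> (\<forall>a. (a, j) \<notin> \<Gamma>)"
  proof
    assume "\<forall>a. (a, i) \<notin> contract \<Gamma> j i"
    then show "\<forall>a. (a, j) \<notin> \<Gamma>" using jj by (metis mem_contract_iff[OF ji(2)])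
  next
    assume "\<forall>a. (a, j) \<notin> \<Gamma>"
    moreover from this have "\<not> (\<exists>a. a \<noteq> j \<and> (a, i) \<in> \<Gamma>)"
      using c by (auto simp: contractible_def)
    ultimately show "\<forall>a. (a, i) \<notin> contract \<Gamma> j i" by (auto simp: mem_contract_iff[OF ji(2)])
  qed
  have "b \<in> leaves (W - {j}) (contract \<Gamma> j i) \<longleftrightarrow>
     b \<in> (if j \<in> leaves W \<Gamma> then insert i (leaves W \<Gamma> - {j}) else leaves W \<Gamma>)" for b
  proof (cases "b = i \<or> b = j")
    case True
    then show ?thesis using i V ji by (auto simp: leaves_def)
  next
    case False
    then show ?thesis using other by (auto simp: leaves_def)
  qed
  then show ?thesis by blast
qed

lemma card_leaves_contract:
  assumes "finite W" "graph_on W \<Gamma>" "contractible \<Gamma> j i"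
  shows "card (leaves (W - {j}) (contract \<Gamma> j i)) = card (leaves W \<Gamma>)"
proof (cases "j \<in> leaves W \<Gamma>")
  case True
  have "i \<notin> leaves W \<Gamma>" using assms(3) by (auto simp: leaves_def contractible_def)
  moreover have "card (leaves W \<Gamma>) > 0"
    using True finite_leaves[OF assms(1)] card_gt_0_iff by blast
  ultimately show ?thesis
    using True finite_leaves[OF assms(1), of \<Gamma>] by (simp add: leaves_contract[OF assms(2,3)])
qed (simp add: leaves_contract[OF assms(2,3)])

lemma eps_front_insert_leaf:
  assumes "graph_on W \<Gamma>" "finite W" "0 \<notin> W" "b \<in> W" "j \<noteq> 0"
  shows "eps_front (insert (0, b) \<Gamma>) j = - eps_front \<Gamma> j"
proof -
  have "0 \<notin> Domain \<Gamma>" using graph_on_Domain[OF assms(1)] assms(3) by blast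
  moreover have "{a \<in> Domain (insert (0, b) \<Gamma>). a < j} = insert 0 {a \<in> Domain \<Gamma>. a < j}"
    using assms(5) by auto
  moreover have "finite {a \<in> Domain \<Gamma>. a < j}" by simp
  ultimately have "card {a \<in> Domain (insert (0, b) \<Gamma>). a < j} = Suc (card {a \<in> Domain \<Gamma>. a < j})"
    by (metis (mono_tags, lifting) card_insert_disjoint mem_Collect_eq)
  then show ?thesis
    by (simp only: eps_front_eq[OF assms(1)] eps_front_eq[OF graph_on_insert_leaf[OF assms(1,3,4)]]) simp
qed

text \<open>Renaming the leaf \<open>b\<close> to \<open>0\<close> moves it to the front, whence the sign.\<close>

lemma coeff_on_rename_leaf:
  assumes \<delta>: "\<delta> \<in> symmetric_combs (card W)" and W: "finite W" "0 \<notin> W" and \<Gamma>: "graph_on W \<Gamma>"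
    and b: "b \<in> leaves W \<Gamma>" and bc: "(b, c) \<in> \<Gamma>"
  shows "eps_front \<Gamma> b * coeff_on \<delta> (insert 0 W - {b}) (insert (0, c) (contract \<Gamma> b c)) = coeff_on \<delta> W \<Gamma>"
proof -
  let ?\<sigma> = "id(b := 0)"
  have leaf: "\<forall>a. (a, b) \<notin> \<Gamma>" and "b \<in> W" using b by (auto simp: leaves_def)
  have "b \<noteq> c" using bc leaf by blast
  have inj: "inj_on ?\<sigma> W" by (rule inj_on_fun_updI) (use W(2) in simp_all)
  have "?\<sigma> ` (W - {b}) = id ` (W - {b})" by (rule image_cong) simp_all
  then have "?\<sigma> ` insert b (W - {b}) = insert 0 (W - {b})"
    by (simp only: image_insert fun_upd_same image_id id_apply)
  then have im: "?\<sigma> ` W = insert 0 W - {b}"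
    using W(2) \<open>b \<in> W\<close> by (metis insert_Diff insert_Diff_if singletonD)
  have rel: "relabel ?\<sigma> \<Gamma> = insert (0, c) (contract \<Gamma> b c)"
  proof -
    have "(x, y) \<in> relabel ?\<sigma> \<Gamma> \<longleftrightarrow> x = 0 \<and> y = c \<or> (x, y) \<in> contract \<Gamma> b c" for x y
    proof
      assume "(x, y) \<in> relabel ?\<sigma> \<Gamma>"
      then obtain u v where "x = ?\<sigma> u" "y = ?\<sigma> v" "(u, v) \<in> \<Gamma>" by (auto simp: relabel_def)
      moreover from this have "v \<noteq> b" using leaf by blast
      moreover from calculation have "u = b \<Longrightarrow> v = c" using graph_on_unique[OF \<Gamma> _ bc] by blast
      ultimately show "x = 0 \<and> y = c \<or> (x, y) \<in> contract \<Gamma> b c"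
        using \<open>b \<noteq> c\<close> by (auto simp: mem_contract_iff)
    next
      assume "x = 0 \<and> y = c \<or> (x, y) \<in> contract \<Gamma> b c"
      then show "(x, y) \<in> relabel ?\<sigma> \<Gamma>"
      proof
        assume "x = 0 \<and> y = c"
        then show ?thesis using bc \<open>b \<noteq> c\<close> unfolding relabel_def
          by (intro image_eqI[of _ _ "(b, c)"]) auto
      next
        assume "(x, y) \<in> contract \<Gamma> b c"
        then show ?thesis using \<open>b \<noteq> c\<close> leaf unfolding relabel_def
          by (intro image_eqI[of _ _ "(x, y)"]) (auto simp: mem_contract_iff)
      qed
    qed
    then show ?thesis by auto
  qed
  have D: "finite (Domain \<Gamma>)" "Domain \<Gamma> \<subseteq> W" "b \<in> Domain \<Gamma>"
    using graph_on_Domain[OF \<Gamma>] W(1) finite_subset bc by blast+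
  have "inversion_sign (Domain \<Gamma> - {b}) ?\<sigma> = 1"
    by (rule inversion_sign_strict_mono) (auto simp: strict_mono_on_def)
  then have "eps_front \<Gamma> b * eps_deb \<Gamma> ?\<sigma> = 1"
    using inversion_sign_remove[OF D(1,3) inj_on_subset[OF inj D(2)]]
    by (simp add: eps_front_eq[OF \<Gamma>] eps_deb_eq_inversion_sign[OF \<Gamma> W(1)])
  moreover have "coeff_on \<delta> (insert 0 W - {b}) (insert (0, c) (contract \<Gamma> b c)) = eps_deb \<Gamma> ?\<sigma> * coeff_on \<delta> W \<Gamma>"
    using coeff_on_relabel[OF \<delta> W(1) \<Gamma> inj] unfolding im rel .
  ultimately show ?thesis by (simp flip: mult.assoc)
qed

lemma contract_insert_leaf:
  assumes "b \<noteq> j" "j \<noteq> 0"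
  shows "contract (insert (0, b) \<Gamma>) j i = insert (0, b) (contract \<Gamma> j i)"
  using assms by (auto simp: contract_def)

text \<open>The new arrow only gives \<open>b\<close> an incoming arrow. An arrow from the leaf
  \<open>b\<close> to \<open>i\<close> was contractible when \<open>i\<close> had no further arrows,
  and is now contractible when \<open>i\<close> has some, so its status flips. The new arrow itself
  is contractible only if \<open>b\<close> was isolated. No other arrow is affected.\<close>

lemma contractible_insert_leaf:
  assumes \<Gamma>: "graph_on W \<Gamma>" and W: "0 \<notin> W" and b: "b \<in> leaves W \<Gamma>"
  shows "contractible (insert (0, b) \<Gamma>) j i \<longleftrightarrow> contractible \<Gamma> j i \<and> j \<noteq> b \<or>
     j = 0 \<and> i = b \<and> b \<notin> Domain \<Gamma> \<or> j = b \<and> (b, i) \<in> \<Gamma> \<and> \<not> contractible \<Gamma> b i"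
proof -
  have leaf: "(a, b) \<notin> \<Gamma>" for a using b by (simp add: leaves_def)
  have "b \<noteq> 0" using b W by (metis (no_types, lifting) leaves_def mem_Collect_eq)
  have z: "(0, a) \<notin> \<Gamma>" "(a, 0) \<notin> \<Gamma>" for a using graph_onD[OF \<Gamma>] W by blast+
  have P: "(\<exists>a. (a, j) \<in> insert (0, b) \<Gamma>) \<longleftrightarrow> j = b \<or> (\<exists>a. (a, j) \<in> \<Gamma>)"
    and Q: "(\<exists>c. (i, c) \<in> insert (0, b) \<Gamma>) \<longleftrightarrow> i = 0 \<or> (\<exists>c. (i, c) \<in> \<Gamma>)"
      "(\<exists>a. a \<noteq> j \<and> (a, i) \<in> insert (0, b) \<Gamma>) \<longleftrightarrow> j \<noteq> 0 \<and> i = b \<or> (\<exists>a. a \<noteq> j \<and> (a, i) \<in> \<Gamma>)"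
    and ji: "(j, i) \<in> insert (0, b) \<Gamma> \<longleftrightarrow> j = 0 \<and> i = b \<or> (j, i) \<in> \<Gamma>"
    by auto
  consider "j = 0" | "j = b" | "j \<noteq> 0" "j \<noteq> b" by blast
  then show ?thesis
  proof cases
    case 1
    then show ?thesis
      unfolding contractible_def P Q ji using \<open>b \<noteq> 0\<close> leaf z by auto
  next
    case 2
    then show ?thesis
      unfolding contractible_def P Q ji using \<open>b \<noteq> 0\<close> leaf z by auto
  next
    case 3
    then show ?thesis
      unfolding contractible_def P Q ji using leaf z by auto
  qed
qed

lemma eps_deb_rank:
  assumes "graph_on V \<Gamma>" "finite V"
  shows "eps_deb \<Gamma> (rank V) = 1"
  unfolding eps_deb_eq_inversion_sign[OF assms]
  by (rule inversion_sign_strict_mono)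
     (rule monotone_on_subset[OF strict_mono_on_rank[OF assms(2)] graph_on_Domain[OF assms(1)]])

lemma coeff_on_coboundary:
  assumes \<delta>: "\<delta> \<in> symmetric_combs n" and V: "finite V" "card V = Suc n" and \<Gamma>: "graph_on V \<Gamma>"
  shows "coeff_on (coboundary n \<delta>) V \<Gamma> = coboundary_coeff \<delta> V \<Gamma>"
proof -
  have im: "rank V ` V = {1..Suc n}" using rank_image[OF V(1)] V(2) by simp
  note inj = inj_on_rank[OF V(1)]
  have "coeff_on (coboundary n \<delta>) V \<Gamma> = coboundary_coeff \<delta> {1..Suc n} (relabel (rank V) \<Gamma>)"
    unfolding coeff_on_def
    by (rule lookup_coboundary[OF \<delta>]) (use graph_on_relabel[OF \<Gamma> inj] im in simp)
  also have "\<dots> = coboundary_coeff \<delta> V \<Gamma>"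
    using coboundary_coeff_relabel[OF \<delta> V \<Gamma> inj] eps_deb_rank[OF \<Gamma> V(1)] unfolding im by simp
  finally show ?thesis .
qed

text \<open>If \<open>j\<close> is a leaf, then \<open>i\<close> is isolated after the contraction,
  so its leaf sign is -1, and attaching \<open>0\<close> to it restores \<Gamma> with
  \<open>j\<close> renamed to \<open>0\<close>. This extra leaf is responsible for the subtracted
  coefficient; all other leaves are those of \<Gamma>.\<close>

lemma leaf_sum_contract:
  assumes \<delta>: "\<delta> \<in> symmetric_combs (card W)" and W: "finite W" "0 \<notin> W" and \<Gamma>: "graph_on W \<Gamma>"
    and c: "contractible \<Gamma> j i"
  shows "eps_front \<Gamma> j * leaf_sum \<delta> (W - {j}) (contract \<Gamma> j i) =
    (\<Sum>b\<in>leaves W \<Gamma> - {j}. leaf_sign \<Gamma> b *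
       (eps_front \<Gamma> j * coeff_on \<delta> (insert 0 W - {j}) (insert (0, b) (contract \<Gamma> j i))))
    - (if j \<in> leaves W \<Gamma> then coeff_on \<delta> W \<Gamma> else 0)"
proof -
  let ?g = "\<lambda>b. leaf_sign (contract \<Gamma> j i) b * coeff_on \<delta> (insert 0 W - {j}) (insert (0, b) (contract \<Gamma> j i))"
  have ji: "(j, i) \<in> \<Gamma>" "i \<noteq> j" using c by (auto simp: contractible_def)
  have V: "i \<in> W" "j \<in> W" using graph_onD[OF \<Gamma> ji(1)] by auto
  then have "j \<noteq> 0" using W(2) by metis
  then have V0: "insert 0 (W - {j}) = insert 0 W - {j}" by auto
  have fin: "finite (leaves W \<Gamma>)" by (rule finite_leaves[OF W(1)])
  have sign: "leaf_sign (contract \<Gamma> j i) b = leaf_sign \<Gamma> b" if "b \<noteq> j" for b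
    using that by (simp add: leaf_sign_def Domain_contract)
  have "eps_front \<Gamma> j * leaf_sum \<delta> (W - {j}) (contract \<Gamma> j i) =
     eps_front \<Gamma> j * sum ?g (leaves W \<Gamma> - {j}) - (if j \<in> leaves W \<Gamma> then coeff_on \<delta> W \<Gamma> else 0)"
  proof (cases "j \<in> leaves W \<Gamma>")
    case True
    have "i \<notin> Domain \<Gamma>"
      using True c by (auto simp: contractible_def leaves_def)
    then have i: "leaf_sign (contract \<Gamma> j i) i = - 1"
      by (simp add: leaf_sign_def Domain_contract)
    have "i \<notin> leaves W \<Gamma>" using ji by (auto simp: leaves_def)
    then have "leaf_sum \<delta> (W - {j}) (contract \<Gamma> j i) = ?g i + sum ?g (leaves W \<Gamma> - {j})"
      using True fin by (simp add: leaf_sum_def leaves_contract[OF \<Gamma> c] V0)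
    moreover have "eps_front \<Gamma> j * ?g i = - coeff_on \<delta> W \<Gamma>"
      using coeff_on_rename_leaf[OF \<delta> W \<Gamma> True ji(1)] by (simp add: i)
    ultimately show ?thesis using True by (simp add: distrib_left)
  next
    case False
    then show ?thesis by (simp add: leaf_sum_def leaves_contract[OF \<Gamma> c] V0)
  qed
  also have "eps_front \<Gamma> j * sum ?g (leaves W \<Gamma> - {j}) = (\<Sum>b\<in>leaves W \<Gamma> - {j}. leaf_sign \<Gamma> b *
       (eps_front \<Gamma> j * coeff_on \<delta> (insert 0 W - {j}) (insert (0, b) (contract \<Gamma> j i))))"
    unfolding sum_distrib_left by (rule sum.cong) (simp_all add: sign mult.left_commute)
  finally show ?thesis .
qed

text \<open>For arrows not starting at \<open>b\<close>, the front sign negated by the new arrow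
  cancels the minus sign of the coboundary. The arrows peculiar to the enlarged graph, at most one,
  give back the coefficient of \<Gamma>.\<close>

lemma coboundary_coeff_insert_leaf:
  assumes \<delta>: "\<delta> \<in> symmetric_combs (card W)" and W: "finite W" "0 \<notin> W" and \<Gamma>: "graph_on W \<Gamma>"
    and b: "b \<in> leaves W \<Gamma>"
  shows "leaf_sign \<Gamma> b * coboundary_coeff \<delta> (insert 0 W) (insert (0, b) \<Gamma>) =
    (\<Sum>(j, i) | contractible \<Gamma> j i \<and> j \<noteq> b. leaf_sign \<Gamma> b *
       (eps_front \<Gamma> j * coeff_on \<delta> (insert 0 W - {j}) (insert (0, b) (contract \<Gamma> j i))))
    + (if \<exists>c. contractible \<Gamma> b c then 0 else coeff_on \<delta> W \<Gamma>)"
proof -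
  let ?\<Gamma>b = "insert (0, b) \<Gamma>"
  let ?f = "\<lambda>(j, i). eps_front ?\<Gamma>b j * coeff_on \<delta> (insert 0 W - {j}) (contract ?\<Gamma>b j i)"
  let ?A = "{(j, i). contractible \<Gamma> j i \<and> j \<noteq> b}"
  let ?X = "{(j, i). j = 0 \<and> i = b \<and> b \<notin> Domain \<Gamma> \<or> j = b \<and> (b, i) \<in> \<Gamma> \<and> \<not> contractible \<Gamma> b i}"
  have bW: "b \<in> W" "\<And>a. (a, b) \<notin> \<Gamma>" using b by (auto simp: leaves_def)
  have nz: "v \<noteq> 0" if "v \<in> W" for v using that W(2) by metis
  have sub: "?A \<subseteq> \<Gamma>" "?X \<subseteq> insert (0, b) \<Gamma>" by (auto simp: contractible_def)
  then have fin: "finite ?A" "finite ?X"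
    using graph_on_finite[OF \<Gamma> W(1)] by (auto intro: finite_subset)
  have jA: "j \<noteq> 0" if "(j, i) \<in> ?A" for j i
    using that sub(1) graph_onD(1)[OF \<Gamma>] nz by blast
  have disj: "?A \<inter> ?X = {}" using jA by auto
  have "{(j, i). contractible ?\<Gamma>b j i} = ?A \<union> ?X"
    unfolding contractible_insert_leaf[OF \<Gamma> W(2) b] by auto
  then have cb: "coboundary_coeff \<delta> (insert 0 W) ?\<Gamma>b = - (sum ?f ?A + sum ?f ?X)"
    by (simp only: coboundary_coeff_def sum.union_disjoint[OF fin disj])
  have A: "sum ?f ?A = - (\<Sum>(j, i)\<in>?A. eps_front \<Gamma> j *
       coeff_on \<delta> (insert 0 W - {j}) (insert (0, b) (contract \<Gamma> j i)))"
    unfolding sum_negf[symmetric]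
  proof (rule sum.cong, rule refl)
    fix x assume "x \<in> ?A"
    moreover obtain j i where x: "x = (j, i)" by force
    ultimately have j: "j \<noteq> b" "j \<noteq> 0" using jA by auto
    then show "?f x = - (case x of (j, i) \<Rightarrow> eps_front \<Gamma> j *
       coeff_on \<delta> (insert 0 W - {j}) (insert (0, b) (contract \<Gamma> j i)))"
      using eps_front_insert_leaf[OF \<Gamma> W bW(1) j(2)] contract_insert_leaf[of b j] by (simp add: x)
  qed
  \<comment> \<open>If \<open>b\<close> is isolated, contracting the new arrow restores \<Gamma>,
    and the leaf sign -1 compensates the minus sign. If the arrow of \<open>b\<close> is
    contractible in \<Gamma>, it no longer is after the insertion and nothing remains. Otherwise
    contracting it renames \<open>b\<close> to \<open>0\<close>, and the negated front sign
    compensates.\<close>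
  have X: "leaf_sign \<Gamma> b * - sum ?f ?X = (if \<exists>c. contractible \<Gamma> b c then 0 else coeff_on \<delta> W \<Gamma>)"
  proof (cases "b \<in> Domain \<Gamma>")
    case False
    then have X: "?X = {(0, b)}" by auto
    have "contract ?\<Gamma>b 0 b = \<Gamma>"
    proof -
      have "(0, a) \<notin> \<Gamma>" "(a, 0) \<notin> \<Gamma>" for a using graph_onD[OF \<Gamma>] W(2) by blast+
      then have "(x, y) \<in> contract ?\<Gamma>b 0 b \<longleftrightarrow> (x, y) \<in> \<Gamma>" for x y
        using nz[OF bW(1)] mem_contract_iff[of b 0 x y ?\<Gamma>b] by (metis insert_iff prod.inject)
      then show ?thesis by auto
    qed
    moreover have "eps_front ?\<Gamma>b 0 = 1" by (simp add: eps_front_def)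
    moreover have "insert 0 W - {0} = W" using W(2) by simp
    moreover have "\<not> (\<exists>c. contractible \<Gamma> b c)" using False by (auto simp: contractible_def)
    ultimately show ?thesis unfolding X using False by (simp add: leaf_sign_def)
  next
    case True
    then obtain c where bc: "(b, c) \<in> \<Gamma>" by auto
    have u: "(b, i) \<in> \<Gamma> \<longleftrightarrow> i = c" for i using graph_on_unique[OF \<Gamma> bc] bc by blast
    show ?thesis
    proof (cases "contractible \<Gamma> b c")
      case c: True
      then have X: "?X = {}" using True u by auto
      have "\<exists>c. contractible \<Gamma> b c" using c by blast
      then show ?thesis by (simp only: X sum.empty mult_zero_right minus_zero if_True)
    next
      case nc: False
      then have X: "?X = {(b, c)}" using True u by auto
      have nc': "\<not> (\<exists>c. contractible \<Gamma> b c)" using nc u by (auto simp: contractible_def)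
      have "contract ?\<Gamma>b b c = insert (0, c) (contract \<Gamma> b c)"
        using nz[OF bW(1)] bW(2) bc by (auto simp: contract_def)
      then have "sum ?f ?X = - coeff_on \<delta> W \<Gamma>"
        unfolding X using eps_front_insert_leaf[OF \<Gamma> W bW(1) nz[OF bW(1)]] 
          coeff_on_rename_leaf[OF \<delta> W \<Gamma> b bc] by simp
      then show ?thesis using True nc' by (simp add: leaf_sign_def)
    qed
  qed
  have "leaf_sign \<Gamma> b * - sum ?f ?A = (\<Sum>(j, i)\<in>?A. leaf_sign \<Gamma> b * (eps_front \<Gamma> j *
       coeff_on \<delta> (insert 0 W - {j}) (insert (0, b) (contract \<Gamma> j i))))"
    unfolding A minus_minus sum_distrib_left by (rule sum.cong) auto
  then show ?thesis unfolding cb minus_add_distrib distrib_left X by (simp only:)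
qed

text \<open>The double sums over leaves \<open>b\<close> and contractible arrows not starting at
  \<open>b\<close> agree and cancel. A leaf whose arrow is contractible in \<Gamma> contributes its
  copy of the coefficient through the second sum, any other leaf through the first, so the copies
  number exactly the leaves.\<close>

lemma leaf_sum_homotopy:
  assumes \<delta>: "\<delta> \<in> symmetric_combs (card W)" and W: "finite W" "0 \<notin> W" and \<Gamma>: "graph_on W \<Gamma>"
  shows "(\<Sum>b\<in>leaves W \<Gamma>. leaf_sign \<Gamma> b * coboundary_coeff \<delta> (insert 0 W) (insert (0, b) \<Gamma>))
    - (\<Sum>(j, i) | contractible \<Gamma> j i. eps_front \<Gamma> j * leaf_sum \<delta> (W - {j}) (contract \<Gamma> j i))
    = card (leaves W \<Gamma>) * coeff_on \<delta> W \<Gamma>"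
proof -
  let ?A = "{(j, i). contractible \<Gamma> j i}" and ?L = "leaves W \<Gamma>" and ?C = "coeff_on \<delta> W \<Gamma>"
  let ?T = "\<lambda>b (j, i). leaf_sign \<Gamma> b *
       (eps_front \<Gamma> j * coeff_on \<delta> (insert 0 W - {j}) (insert (0, b) (contract \<Gamma> j i)))"
  have finL: "finite ?L" by (rule finite_leaves[OF W(1)])
  have subA: "?A \<subseteq> \<Gamma>" by (auto simp: contractible_def)
  then have finA: "finite ?A" using graph_on_finite[OF \<Gamma> W(1)] finite_subset by blast
  let ?M = "{b \<in> ?L. \<exists>c. contractible \<Gamma> b c}"
  have "(\<Sum>(j, i)\<in>?A. eps_front \<Gamma> j * leaf_sum \<delta> (W - {j}) (contract \<Gamma> j i)) =
    (\<Sum>x\<in>?A. (\<Sum>b\<in>{b \<in> ?L. b \<noteq> fst x}. ?T b x) - (if fst x \<in> ?L then ?C else 0))"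
  proof (rule sum.cong, rule refl)
    fix x assume "x \<in> ?A"
    moreover obtain j i where x: "x = (j, i)" by force
    moreover have "?L - {j} = {b \<in> ?L. b \<noteq> j}" by auto
    ultimately show "(case x of (j, i) \<Rightarrow> eps_front \<Gamma> j * leaf_sum \<delta> (W - {j}) (contract \<Gamma> j i)) =
       (\<Sum>b\<in>{b \<in> ?L. b \<noteq> fst x}. ?T b x) - (if fst x \<in> ?L then ?C else 0)"
      using leaf_sum_contract[OF \<delta> W \<Gamma>, of j i] by simp
  qed
  also have "\<dots> = (\<Sum>x\<in>?A. \<Sum>b\<in>{b \<in> ?L. b \<noteq> fst x}. ?T b x) - (\<Sum>x\<in>?A. if fst x \<in> ?L then ?C else 0)"
    by (rule sum_subtractf)
  also have "(\<Sum>x\<in>?A. \<Sum>b\<in>{b \<in> ?L. b \<noteq> fst x}. ?T b x) = (\<Sum>b\<in>?L. \<Sum>x\<in>{x \<in> ?A. b \<noteq> fst x}. ?T b x)"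
    by (rule sum.swap_restrict[OF finA finL])
  also have "(\<Sum>x\<in>?A. if fst x \<in> ?L then ?C else 0) = card {x \<in> ?A. fst x \<in> ?L} * ?C"
    unfolding sum.inter_filter[OF finA, symmetric] by simp
  \<comment> \<open>An arrow is determined by its source, so counting contractible arrows that start
    at leaves is counting leaves.\<close>
  also have "card {x \<in> ?A. fst x \<in> ?L} = card ?M"
  proof (rule bij_betw_same_card[of fst])
    have "inj_on fst \<Gamma>" using graph_on_unique[OF \<Gamma>] by (auto simp: inj_on_def)
    then show "bij_betw fst {x \<in> ?A. fst x \<in> ?L} ?M"
      using subA by (auto simp: bij_betw_def image_iff intro: inj_on_subset)
  qed
  finally have 1: "(\<Sum>(j, i)\<in>?A. eps_front \<Gamma> j * leaf_sum \<delta> (W - {j}) (contract \<Gamma> j i)) =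
     (\<Sum>b\<in>?L. \<Sum>x\<in>{x \<in> ?A. b \<noteq> fst x}. ?T b x) - card ?M * ?C" .
  have "(\<Sum>b\<in>?L. leaf_sign \<Gamma> b * coboundary_coeff \<delta> (insert 0 W) (insert (0, b) \<Gamma>)) =
     (\<Sum>b\<in>?L. (\<Sum>x\<in>{x \<in> ?A. b \<noteq> fst x}. ?T b x) + (if \<exists>c. contractible \<Gamma> b c then 0 else ?C))"
  proof (rule sum.cong, rule refl)
    fix b assume b: "b \<in> ?L"
    have "{x \<in> ?A. b \<noteq> fst x} = {(j, i). contractible \<Gamma> j i \<and> j \<noteq> b}" by auto
    then show "leaf_sign \<Gamma> b * coboundary_coeff \<delta> (insert 0 W) (insert (0, b) \<Gamma>) = 
       (\<Sum>x\<in>{x \<in> ?A. b \<noteq> fst x}. ?T b x) + (if \<exists>c. contractible \<Gamma> b c then 0 else ?C)"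
      using coboundary_coeff_insert_leaf[OF \<delta> W \<Gamma> b] by simp
  qed
  also have "\<dots> = (\<Sum>b\<in>?L. \<Sum>x\<in>{x \<in> ?A. b \<noteq> fst x}. ?T b x) + (\<Sum>b\<in>?L. if \<exists>c. contractible \<Gamma> b c then 0 else ?C)"
    by (rule sum.distrib)
  also have "(\<Sum>b\<in>?L. if \<exists>c. contractible \<Gamma> b c then 0 else ?C) = card (?L - ?M) * ?C"
  proof -
    have "(\<Sum>b\<in>?L. if \<exists>c. contractible \<Gamma> b c then 0 else ?C) = 
        (\<Sum>b\<in>?L. if \<not> (\<exists>c. contractible \<Gamma> b c) then ?C else 0)"
      by (rule sum.cong) auto
    also have "\<dots> = card {b \<in> ?L. \<not> (\<exists>c. contractible \<Gamma> b c)} * ?C"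
      unfolding sum.inter_filter[OF finL, symmetric] by simp
    also have "{b \<in> ?L. \<not> (\<exists>c. contractible \<Gamma> b c)} = ?L - ?M" by auto
    finally show ?thesis .
  qed
  finally have 2: "(\<Sum>b\<in>?L. leaf_sign \<Gamma> b * coboundary_coeff \<delta> (insert 0 W) (insert (0, b) \<Gamma>)) =
     (\<Sum>b\<in>?L. \<Sum>x\<in>{x \<in> ?A. b \<noteq> fst x}. ?T b x) + card (?L - ?M) * ?C" .
  have "card ?L = card ?M + card (?L - ?M)"
    using card_Un_disjoint[of ?M "?L - ?M"] finL by (simp add: Un_absorb1)
  then show ?thesis
    unfolding 1 2 by (simp add: distrib_right)
qed

text \<open>A graph and its contractions have equally many leaves, so the same denominator occurs in
  both terms and can be taken out.\<close>

lemma coboundary_homotopy: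
  assumes \<delta>: "\<delta> \<in> symmetric_combs (Suc m)" and \<Gamma>: "graph_on {1..Suc m} \<Gamma>"
  shows "Poly_Mapping.lookup (coboundary m (homotopy m \<delta>)) \<Gamma> +
      Poly_Mapping.lookup (homotopy (Suc m) (coboundary (Suc m) \<delta>)) \<Gamma> =
    (if leaves {1..Suc m} \<Gamma> = {} then 0 else Poly_Mapping.lookup \<delta> \<Gamma>)"
proof -
  let ?W = "{1..Suc m}"
  let ?L = "leaves ?W \<Gamma>"
  have W: "finite ?W" "0 \<notin> ?W" "card ?W = Suc m" by simp_all
  have \<delta>': "\<delta> \<in> symmetric_combs (card ?W)" using \<delta> by simp
  have "leaf_sum (coboundary (Suc m) \<delta>) ?W \<Gamma> =
     (\<Sum>b\<in>?L. leaf_sign \<Gamma> b * coboundary_coeff \<delta> (insert 0 ?W) (insert (0, b) \<Gamma>))"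
    unfolding leaf_sum_def
  proof (rule sum.cong, rule refl)
    fix b assume "b \<in> ?L"
    then have "b \<in> ?W" by (simp add: leaves_def)
    then show "leaf_sign \<Gamma> b * coeff_on (coboundary (Suc m) \<delta>) (insert 0 ?W) (insert (0, b) \<Gamma>) =
       leaf_sign \<Gamma> b * coboundary_coeff \<delta> (insert 0 ?W) (insert (0, b) \<Gamma>)"
      using coeff_on_coboundary[OF \<delta> _ _ graph_on_insert_leaf[OF \<Gamma> W(2)], of b]
      by (simp only: W card_insert_disjoint finite_insert simp_thms)
  qed
  then have 1: "Poly_Mapping.lookup (homotopy (Suc m) (coboundary (Suc m) \<delta>)) \<Gamma> = 
     (\<Sum>b\<in>?L. leaf_sign \<Gamma> b * coboundary_coeff \<delta> (insert 0 ?W) (insert (0, b) \<Gamma>)) / card ?L"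
    using \<Gamma> by (simp only: lookup_homotopy if_True)
  have "Poly_Mapping.lookup (coboundary m (homotopy m \<delta>)) \<Gamma> = 
     - (\<Sum>(j, i) | contractible \<Gamma> j i. eps_front \<Gamma> j * (leaf_sum \<delta> (?W - {j}) (contract \<Gamma> j i) / card ?L))"
    unfolding lookup_coboundary[OF homotopy_symmetric[OF \<delta>] \<Gamma>] coboundary_coeff_def
  proof (intro arg_cong[of _ _ uminus] sum.cong refl)
    fix x assume "x \<in> {(j, i). contractible \<Gamma> j i}"
    moreover obtain j i where x: "x = (j, i)" by force
    ultimately have c: "contractible \<Gamma> j i" by simp
    then have ji: "(j, i) \<in> \<Gamma>" "j \<noteq> i" by (auto simp: contractible_def)
    have "j \<in> ?W" using graph_onD[OF \<Gamma> ji(1)] by simp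
    then have "card (?W - {j}) = m" by simp
    then have "coeff_on (homotopy m \<delta>) (?W - {j}) (contract \<Gamma> j i) = 
       leaf_sum \<delta> (?W - {j}) (contract \<Gamma> j i) / card (leaves (?W - {j}) (contract \<Gamma> j i))"
      by (intro coeff_on_homotopy[OF \<delta>] graph_on_contract[OF \<Gamma> ji]) simp_all
    then show "(case x of (j, i) \<Rightarrow> eps_front \<Gamma> j * coeff_on (homotopy m \<delta>) (?W - {j}) (contract \<Gamma> j i)) =
       (case x of (j, i) \<Rightarrow> eps_front \<Gamma> j * (leaf_sum \<delta> (?W - {j}) (contract \<Gamma> j i) / card ?L))"
      by (simp only: x prod.case card_leaves_contract[OF W(1) \<Gamma> c])
  qed
  also have "\<dots> = - (\<Sum>(j, i) | contractible \<Gamma> j i. eps_front \<Gamma> j * leaf_sum \<delta> (?W - {j}) (contract \<Gamma> j i)) / card ?L"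
    by (simp add: sum_divide_distrib case_prod_unfold)
  finally have 2: "Poly_Mapping.lookup (coboundary m (homotopy m \<delta>)) \<Gamma> = 
     - (\<Sum>(j, i) | contractible \<Gamma> j i. eps_front \<Gamma> j * leaf_sum \<delta> (?W - {j}) (contract \<Gamma> j i)) / card ?L" .
  have "Poly_Mapping.lookup (coboundary m (homotopy m \<delta>)) \<Gamma> +
      Poly_Mapping.lookup (homotopy (Suc m) (coboundary (Suc m) \<delta>)) \<Gamma> =
     ((\<Sum>b\<in>?L. leaf_sign \<Gamma> b * coboundary_coeff \<delta> (insert 0 ?W) (insert (0, b) \<Gamma>)) -
     (\<Sum>(j, i) | contractible \<Gamma> j i. eps_front \<Gamma> j * leaf_sum \<delta> (?W - {j}) (contract \<Gamma> j i))) / card ?L"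
    unfolding 1 2 by (simp add: diff_divide_distrib)
  also have "\<dots> = card ?L * Poly_Mapping.lookup \<delta> \<Gamma> / card ?L"
    unfolding leaf_sum_homotopy[OF \<delta>' W(1,2) \<Gamma>] coeff_on_atLeast1[OF \<Gamma>] ..
  \<comment> \<open>Without leaves the quotient is a division by zero, hence 0, as the first branch
    demands.\<close>
  finally show ?thesis using finite_leaves[OF W(1), of \<Gamma>] by auto
qed

section \<open>Leafless graphs\<close>

definition perm_graph :: "nat set \<Rightarrow> (nat \<Rightarrow> nat) \<Rightarrow> vgraph" where
  "perm_graph V p = (\<lambda>v. (v, p v)) ` V"

lemma mem_perm_graph: "(a, b) \<in> perm_graph V p \<longleftrightarrow> a \<in> V \<and> b = p a"
  by (auto simp: perm_graph_def)

lemma Domain_perm_graph: "Domain (perm_graph V p) = V"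
  by (force simp: perm_graph_def)

lemma graph_on_perm_graph: "p permutes V \<Longrightarrow> graph_on V (perm_graph V p)"
  by (auto simp: graph_on_def perm_graph_def single_valued_def permutes_in_image)

lemma leaves_perm_graph:
  assumes "p permutes V"
  shows "leaves V (perm_graph V p) = {}"
proof -
  have "\<exists>a\<in>V. b = p a" if "b \<in> V" for b
    using that permutes_image[OF assms] by blast
  then show ?thesis by (auto simp: leaves_def mem_perm_graph)
qed

lemma leafless_imp_perm_graph:
  assumes V: "finite V" and \<Gamma>: "graph_on V \<Gamma>" and l: "leaves V \<Gamma> = {}"
  obtains p where "p permutes V" "\<Gamma> = perm_graph V p"
proof -
  note fin = graph_on_finite[OF \<Gamma> V]
  \<comment> \<open>Every vertex is the head of an arrow and the source of at most one, so there are
    as many arrows as vertices and every vertex is a source.\<close>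
  have "V \<subseteq> snd ` \<Gamma>" using l by (force simp: leaves_def)
  then have "card V \<le> card \<Gamma>"
    using fin by (meson card_image_le card_mono finite_imageI le_trans)
  moreover have "inj_on fst \<Gamma>" using graph_on_unique[OF \<Gamma>] by (auto simp: inj_on_def)
  then have "card \<Gamma> = card (Domain \<Gamma>)" by (simp add: Domain_fst card_image)
  ultimately have D: "Domain \<Gamma> = V"
    using V graph_on_Domain[OF \<Gamma>] by (metis card_seteq)
  define p where "p v = (if v \<in> V then THE c. (v, c) \<in> \<Gamma> else v)" for v
  have p: "(v, c) \<in> \<Gamma> \<longleftrightarrow> v \<in> V \<and> c = p v" for v c
  proof
    assume vc: "(v, c) \<in> \<Gamma>"
    then have "(THE c. (v, c) \<in> \<Gamma>) = c" using graph_on_unique[OF \<Gamma>] by blast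
    then show "v \<in> V \<and> c = p v" using graph_onD[OF \<Gamma> vc] by (simp add: p_def)
  next
    assume v: "v \<in> V \<and> c = p v"
    then obtain d where vd: "(v, d) \<in> \<Gamma>" using D by blast
    then have "(THE c. (v, c) \<in> \<Gamma>) = d" using graph_on_unique[OF \<Gamma>] by blast
    then show "(v, c) \<in> \<Gamma>" using v vd by (simp add: p_def)
  qed
  have "p ` V = V"
  proof
    show "p ` V \<subseteq> V" using p graph_onD(2)[OF \<Gamma>] by blast
    show "V \<subseteq> p ` V" using l p by (force simp: leaves_def)
  qed
  then have "p permutes V"
    by (intro bij_imp_permutes) (auto simp: bij_betw_def p_def intro: eq_card_imp_inj_on[OF V])
  moreover have "\<Gamma> = perm_graph V p" using p by (auto simp: mem_perm_graph)
  ultimately show thesis by (rule that)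
qed

text \<open>Both sides are multiplicative and equal -1 on transpositions of elements of
  \<open>V\<close>. It applies to permutation graphs because there every vertex has an outgoing
  arrow.\<close>

lemma inversion_sign_eq_sign:
  assumes "finite V" "\<sigma> permutes V"
  shows "inversion_sign V \<sigma> = sign \<sigma>"
  using assms(2,1)
proof (induction rule: permutes_induct)
  case id
  then show ?case by (simp add: inversion_sign_strict_mono strict_mono_on_def)
next
  case (swap a b p)
  have "inversion_sign V (transpose a b \<circ> p) = inversion_sign (p ` V) (transpose a b) * inversion_sign V p"
    by (rule inversion_sign_compose) (use swap assms(1) in \<open>auto intro: permutes_inj_on inj_on_subset[OF inj_transpose]\<close>)
  moreover have "sign (transpose a b \<circ> p) = sign (transpose a b) * sign p"
    using swap assms(1) by (intro sign_compose) (auto intro: permutation_permutes[THEN iffD2] permutation_swap_id)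
  moreover have "inversion_sign (p ` V) (transpose a b) = - 1"
    using swap assms(1) by (simp add: permutes_image inversion_sign_transpose)
  moreover have "sign (transpose a b) = - 1"
    using swap by (simp add: sign_swap_id)
  moreover have "inversion_sign V p = sign p" using swap by simp
  ultimately show ?case
    by (simp only: of_int_mult of_int_minus of_int_1)
qed

lemma eps_deb_perm_graph:
  assumes "finite V" "p permutes V" "\<sigma> permutes V"
  shows "eps_deb (perm_graph V p) \<sigma> = sign \<sigma>"
  using eps_deb_eq_inversion_sign[OF graph_on_perm_graph[OF assms(2)] assms(1)]
  by (simp add: Domain_perm_graph inversion_sign_eq_sign assms)

lemma relabel_perm_graph_commute:
  assumes "\<sigma> permutes V" "\<And>v. v \<in> V \<Longrightarrow> \<sigma> (p v) = q (\<sigma> v)"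
  shows "relabel \<sigma> (perm_graph V p) = perm_graph V q"
proof -
  have "relabel \<sigma> (perm_graph V p) = (\<lambda>v. (\<sigma> v, \<sigma> (p v))) ` V"
    by (simp add: relabel_def perm_graph_def image_image)
  also have "\<dots> = (\<lambda>v. (\<sigma> v, q (\<sigma> v))) ` V"
    by (rule image_cong) (simp_all add: assms(2))
  also have "\<dots> = (\<lambda>v. (v, q v)) ` \<sigma> ` V" by (simp add: image_image)
  finally show ?thesis by (simp add: permutes_image[OF assms(1)] perm_graph_def)
qed

text \<open>A permutation commuting with \<open>p\<close> fixes the graph; if it is odd, symmetry
  equates the coefficient with its negative.\<close>

lemma coeff_on_perm_graph_eq_0:
  assumes \<delta>: "\<delta> \<in> symmetric_combs (card V)" and V: "finite V" and p: "p permutes V"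
    and \<sigma>: "\<sigma> permutes V" "\<And>v. v \<in> V \<Longrightarrow> \<sigma> (p v) = p (\<sigma> v)" "sign \<sigma> = - 1"
  shows "coeff_on \<delta> V (perm_graph V p) = 0"
proof -
  have "relabel \<sigma> (perm_graph V p) = perm_graph V p"
    by (rule relabel_perm_graph_commute[OF \<sigma>(1)]) (rule \<sigma>(2))
  then have "coeff_on \<delta> V (perm_graph V p) = - coeff_on \<delta> V (perm_graph V p)"
    using coeff_on_relabel[OF \<delta> V graph_on_perm_graph[OF p] permutes_inj_on[OF \<sigma>(1)]]
    by (simp add: permutes_image[OF \<sigma>(1)] 
         eps_deb_perm_graph[OF V p \<sigma>(1)] \<sigma>(3))
  then show ?thesis by simp
qed

section \<open>Cycles of permutations and odd automorphisms\<close>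

definition is_cycle :: "('a \<Rightarrow> 'a) \<Rightarrow> 'a list \<Rightarrow> bool" where
  "is_cycle p cs \<longleftrightarrow> cs \<noteq> [] \<and> distinct cs \<and> (\<forall>k<length cs. p (cs ! k) = cs ! (Suc k mod length cs))"

lemma is_cycle_image:
  assumes "is_cycle p cs"
  shows "p ` set cs = set cs"
proof -
  have len: "length cs > 0" using assms by (simp add: is_cycle_def)
  have "map p cs = rotate1 cs"
    using assms len by (intro nth_equalityI) (auto simp: is_cycle_def nth_rotate1)
  then show ?thesis by (metis list.set_map set_rotate1)
qed

lemma is_cycle_mem_iff:
  assumes "is_cycle p cs" "inj p"
  shows "p v \<in> set cs \<longleftrightarrow> v \<in> set cs"
  using is_cycle_image[OF assms(1)] assms(2) by (metis inj_image_mem_iff)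

lemma is_cycle_funpow:
  assumes "is_cycle p cs" "k < length cs"
  shows "(p ^^ m) (cs ! k) = cs ! ((k + m) mod length cs)"
proof (induction m)
  case (Suc m)
  have "(k + m) mod length cs < length cs" using assms(2) by (intro mod_less_divisor) linarith
  then show ?case using Suc assms(1) by (simp add: is_cycle_def mod_Suc_eq)
qed (use assms in simp)

lemma least_power_is_cycle:
  assumes "is_cycle p cs" "v \<in> set cs"
  shows "least_power p v = length cs"
proof -
  obtain k where k: "k < length cs" "v = cs ! k" using assms(2) by (auto simp: in_set_conv_nth)
  have "distinct cs" using assms(1) by (simp add: is_cycle_def)
  have iff: "(p ^^ m) v = v \<longleftrightarrow> length cs dvd m" for m
  proof -
    have "(p ^^ m) v = v \<longleftrightarrow> (k + m) mod length cs = k mod length cs"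
    proof -
      have "(k + m) mod length cs < length cs" using k(1) by (intro mod_less_divisor) linarith
      then show ?thesis
        using is_cycle_funpow[OF assms(1) k(1)] k \<open>distinct cs\<close> by (simp add: nth_eq_iff_index_eq)
    qed
    also have "\<dots> \<longleftrightarrow> length cs dvd m"
      by (metis add_diff_cancel_left' le_add1 mod_eq_dvd_iff_nat)
    finally show ?thesis .
  qed
  have "length cs > 0" using k by linarith
  then show ?thesis
    unfolding least_power_def iff by (intro Least_equality) (auto dest: dvd_imp_le)
qed

lemma is_cycle_support:
  assumes "permutation p"
  shows "is_cycle p (support p x)"
proof -
  have "least_power p x > 0" "(p ^^ least_power p x) x = x"
    using least_power_of_permutation[OF assms] by auto
  moreover have "p ((p ^^ k) x) = (p ^^ Suc k) x" for k by simp
  ultimately show ?thesis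
    using cycle_of_permutation[OF assms, of x]
    by (auto simp: is_cycle_def mod_Suc simp del: upt_Suc funpow.simps)
qed

lemma sign_cycle_of_list:
  "distinct cs \<Longrightarrow> sign (cycle_of_list cs) = (- 1) ^ (length cs - 1)"
proof (induction cs rule: cycle_of_list.induct)
  case (1 i j cs)
  have "sign (cycle_of_list (i # j # cs)) = sign (transpose i j) * sign (cycle_of_list (j # cs))"
    unfolding cycle_of_list.simps by (rule sign_compose[OF permutation_swap_id permutation_of_cycle])
  then show ?case using 1 by (simp add: sign_swap_id del: cycle_of_list.simps)
qed simp_all

text \<open>The odd automorphism is the cycle alone: it agrees with \<open>p\<close> on the cycle,
  fixes everything else, and is odd because its length is even.\<close>

lemma coeff_on_even_cycle_eq_0:
  assumes \<delta>: "\<delta> \<in> symmetric_combs (card V)" and V: "finite V" and p: "p permutes V"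
    and cs: "is_cycle p cs" "even (length cs)" "set cs \<subseteq> V"
  shows "coeff_on \<delta> V (perm_graph V p) = 0"
proof -
  let ?\<sigma> = "cycle_of_list cs"
  have d: "distinct cs" "length cs > 0" using cs(1) by (auto simp: is_cycle_def)
  have "map ?\<sigma> cs = rotate1 cs" using cyclic_rotation[OF d(1), of 1] by simp
  moreover have "map p cs = rotate1 cs"
    using cs(1) d by (intro nth_equalityI) (auto simp: is_cycle_def nth_rotate1)
  ultimately have on: "?\<sigma> v = p v" if "v \<in> set cs" for v
    using that by (metis map_eq_conv)
  have off: "?\<sigma> v = v" if "v \<notin> set cs" for v using that by (rule id_outside_supp)
  show ?thesis
  proof (rule coeff_on_perm_graph_eq_0[OF \<delta> V p])
    show "?\<sigma> permutes V" using cycle_permutes cs(3) by (rule permutes_subset)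
    show "?\<sigma> (p v) = p (?\<sigma> v)" for v
      using on off is_cycle_mem_iff[OF cs(1) permutes_inj[OF p]] by (metis (no_types))
    show "sign ?\<sigma> = - 1" using sign_cycle_of_list[OF d(1)] cs(2) d(2) by simp
  qed
qed

text \<open>The product of the disjoint transpositions of corresponding entries.\<close>

lemma list_swap_permutation:
  assumes "length xs = length ys" "distinct (xs @ ys)"
  shows "\<exists>\<sigma>. \<sigma> permutes set xs \<union> set ys \<and> sign \<sigma> = (- 1) ^ length xs \<and>
     (\<forall>k<length xs. \<sigma> (xs ! k) = ys ! k \<and> \<sigma> (ys ! k) = xs ! k)"
  using assms
proof (induction xs ys rule: list_induct2)
  case Nil
  show ?case by (intro exI[of _ id]) (simp add: fun_eq_iff)
next
  case (Cons x xs y ys)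
  then obtain \<sigma> where \<sigma>: "\<sigma> permutes set xs \<union> set ys" "sign \<sigma> = (- 1) ^ length xs"
     "\<forall>k<length xs. \<sigma> (xs ! k) = ys ! k \<and> \<sigma> (ys ! k) = xs ! k"
    by auto
  have xy: "x \<noteq> y" "x \<notin> set xs \<union> set ys" "y \<notin> set xs \<union> set ys" using Cons.prems by auto
  let ?\<tau> = "transpose x y \<circ> \<sigma>"
  have "?\<tau> permutes set (x # xs) \<union> set (y # ys)"
    by (rule permutes_compose) (auto intro: permutes_subset[OF \<sigma>(1)] permutes_swap_id)
  moreover have "permutation \<sigma>" using \<sigma>(1) by (auto simp: permutation_permutes)
  then have "sign ?\<tau> = (- 1) ^ length (x # xs)"
    using sign_compose[OF permutation_swap_id, of \<sigma> x y] \<sigma>(2) xy(1) by (simp add: sign_swap_id)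
  moreover have "?\<tau> ((x # xs) ! k) = (y # ys) ! k \<and> ?\<tau> ((y # ys) ! k) = (x # xs) ! k"
    if "k < length (x # xs)" for k
  proof (cases k)
    case 0
    then show ?thesis using permutes_not_in[OF \<sigma>(1)] xy by simp
  next
    case (Suc l)
    then have l: "l < length xs" "l < length ys" using that Cons.hyps by auto
    then have "xs ! l \<noteq> x" "xs ! l \<noteq> y" "ys ! l \<noteq> x" "ys ! l \<noteq> y"
      using xy nth_mem by blast+
    then show ?thesis using \<sigma>(3) l Suc by (simp add: transpose_apply_other)
  qed
  ultimately show ?case by blast
qed

text \<open>Exchanging the two cycles position by position commutes with \<open>p\<close>, and is a
  product of an odd number of transpositions.\<close>

lemma coeff_on_equal_odd_cycles_eq_0:
  assumes \<delta>: "\<delta> \<in> symmetric_combs (card V)" and V: "finite V" and p: "p permutes V"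
    and xs: "is_cycle p xs" "set xs \<subseteq> V" and ys: "is_cycle p ys" "set ys \<subseteq> V"
    and len: "length xs = length ys" "odd (length xs)" and disj: "set xs \<inter> set ys = {}"
  shows "coeff_on \<delta> V (perm_graph V p) = 0"
proof -
  have "distinct (xs @ ys)" using xs ys disj by (simp add: is_cycle_def)
  then obtain \<sigma> where \<sigma>: "\<sigma> permutes set xs \<union> set ys" "sign \<sigma> = (- 1) ^ length xs"
     and sw: "\<And>k. k < length xs \<Longrightarrow> \<sigma> (xs ! k) = ys ! k" "\<And>k. k < length xs \<Longrightarrow> \<sigma> (ys ! k) = xs ! k"
    using list_swap_permutation[OF len(1)] by blast
  have step: "p (xs ! k) = xs ! (Suc k mod length xs)" "p (ys ! k) = ys ! (Suc k mod length xs)"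
    "Suc k mod length xs < length xs" if "k < length xs" for k
    using that xs(1) ys(1) len(1) by (auto simp: is_cycle_def intro: mod_less_divisor)
  have "\<sigma> (p v) = p (\<sigma> v)" for v
  proof (cases "v \<in> set xs \<union> set ys")
    case True
    then obtain k where "k < length xs" "v = xs ! k \<or> v = ys ! k"
      using len(1) by (metis Un_iff in_set_conv_nth)
    then show ?thesis using step[of k] sw[of k] sw[of "Suc k mod length xs"] by auto
  next
    case False
    then have "p v \<notin> set xs \<union> set ys"
      using is_cycle_mem_iff[OF xs(1) permutes_inj[OF p]] is_cycle_mem_iff[OF ys(1) permutes_inj[OF p]] by simp
    then show ?thesis using False permutes_not_in[OF \<sigma>(1)] by metis
  qed
  then show ?thesis
    using permutes_subset[OF \<sigma>(1), of V] xs(2) ys(2) \<sigma>(2) len(2)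
    by (intro coeff_on_perm_graph_eq_0[OF \<delta> V p, of \<sigma>]) simp_all
qed

text \<open>\<open>least_power p v\<close> is the length of the cycle through \<open>v\<close>; the
  second clause says that vertices on cycles of equal length lie on the same cycle. No choice of
  cycle lists is involved.\<close>

definition distinct_odd_cycles :: "'a set \<Rightarrow> ('a \<Rightarrow> 'a) \<Rightarrow> bool" where
  "distinct_odd_cycles V p \<longleftrightarrow> (\<forall>v\<in>V. odd (least_power p v)) \<and>
     (\<forall>u\<in>V. \<forall>v\<in>V. least_power p u = least_power p v \<longrightarrow> (\<exists>t. v = (p ^^ t) u))"

lemma permutes_imp_permutation: "p permutes V \<Longrightarrow> finite V \<Longrightarrow> permutation p"
  by (rule permutation_permutes[THEN iffD2]) (rule exI, rule conjI)

lemma set_support_subset: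
  assumes "p permutes V" "x \<in> V"
  shows "set (support p x) \<subseteq> V"
  using permutes_in_image[OF permutes_funpow[OF assms(1)]] assms(2) by auto

lemma coeff_on_not_distinct_odd_eq_0:
  assumes \<delta>: "\<delta> \<in> symmetric_combs (card V)" and V: "finite V" and p: "p permutes V"
    and nd: "\<not> distinct_odd_cycles V p"
  shows "coeff_on \<delta> V (perm_graph V p) = 0"
proof (cases "\<exists>v\<in>V. even (least_power p v)")
  case True
  then obtain v where v: "v \<in> V" "even (least_power p v)" by blast
  show ?thesis
    by (rule coeff_on_even_cycle_eq_0[OF \<delta> V p is_cycle_support[OF permutes_imp_permutation[OF p V]] 
          _ set_support_subset[OF p v(1)]]) (simp add: v(2))
next
  case False
  then obtain u v where uv: "u \<in> V" "v \<in> V" "least_power p u = least_power p v" "\<nexists>t. v = (p ^^ t) u"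
    using nd by (auto simp: distinct_odd_cycles_def)
  note perm = permutes_imp_permutation[OF p V]
  have "v \<in> set (support p v)" using least_power_of_permutation(2)[OF perm, of v] by force
  then have "set (support p u) \<noteq> set (support p v)"
    using uv(4) by auto
  then have "set (support p u) \<inter> set (support p v) = {}"
    using disjointD[OF disjoint_support[OF perm]] by blast
  then show ?thesis
    using uv False
    by (intro coeff_on_equal_odd_cycles_eq_0[OF \<delta> V p is_cycle_support[OF perm] set_support_subset[OF p uv(1)] 
         is_cycle_support[OF perm] set_support_subset[OF p uv(2)]]) auto
qed

lemma funpow_commute:
  assumes "\<And>v. \<sigma> (p v) = q (\<sigma> v)"
  shows "\<sigma> ((p ^^ m) v) = (q ^^ m) (\<sigma> v)"
  by (induction m) (simp_all add: assms)

lemma least_power_conjugate: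
  assumes "\<And>v. \<sigma> (p v) = q (\<sigma> v)" "inj \<sigma>"
  shows "least_power q (\<sigma> v) = least_power p v"
  unfolding least_power_def funpow_commute[of \<sigma> p q, OF assms(1), symmetric] inj_eq[OF assms(2)] ..

text \<open>Conjugation preserves cycle lengths, and these are distinct, so \<sigma> maps each cycle
  to itself and acts there as a power of \<open>p\<close>. Its order is therefore odd, and an odd
  power of its sign is 1.\<close>

lemma sign_centralizer:
  assumes V: "finite V" and p: "p permutes V" and \<sigma>: "\<sigma> permutes V" "\<And>v. \<sigma> (p v) = p (\<sigma> v)"
    and d: "distinct_odd_cycles V p"
  shows "sign \<sigma> = 1"
proof -
  note perm = permutes_imp_permutation[OF p V] permutes_imp_permutation[OF \<sigma>(1) V]
  \<comment> \<open>Any odd common multiple of the cycle lengths would serve; the product over all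
    vertices is one.\<close>
  define N where "N = (\<Prod>v\<in>V. least_power p v)"
  have "odd N" unfolding N_def using d V by (auto simp: distinct_odd_cycles_def even_prod_iff)
  have "(\<sigma> ^^ N) v = v" for v
  proof (cases "v \<in> V")
    case True
    then have "\<sigma> v \<in> V" "least_power p v = least_power p (\<sigma> v)"
      using permutes_in_image[OF \<sigma>(1)] least_power_conjugate[of \<sigma> p p, OF \<sigma>(2) permutes_inj[OF \<sigma>(1)]] by simp_all
    then obtain t where t: "\<sigma> v = (p ^^ t) v" using d True unfolding distinct_odd_cycles_def by blast
    have "(\<sigma> ^^ r) v = (p ^^ (t * r)) v" for r
    proof (induction r)
      case (Suc r)
      have "(\<sigma> ^^ Suc r) v = (p ^^ (t * r)) ((p ^^ t) v)"
        using Suc funpow_commute[of \<sigma> p p, OF \<sigma>(2)] t by simp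
      also have "\<dots> = (p ^^ (t * r + t)) v" by (simp only: funpow_add comp_apply)
      finally show ?case by (simp add: add.commute)
    qed simp
    moreover have "least_power p v dvd t * N"
      unfolding N_def using True V by (intro dvd_mult dvd_prodI) auto
    ultimately show ?thesis using least_power_dvd[OF perm(1)] by simp
  next
    case False
    then show ?thesis using permutes_not_in[OF permutes_funpow[OF \<sigma>(1)]] by blast
  qed
  then have "\<sigma> ^^ N = id" by auto
  moreover have "sign (\<sigma> ^^ r) = sign \<sigma> ^ r" for r
  proof (induction r)
    case (Suc r)
    then show ?case
      by (simp only: funpow.simps power_Suc sign_compose[OF perm(2) permutation_funpow[OF perm(2)]])
  qed simp
  ultimately have "sign \<sigma> ^ N = 1" by (metis sign_id)
  then show ?thesis using \<open>odd N\<close> by (cases \<sigma> rule: sign_cases) simp_all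
qed

text \<open>Contracting an arrow of an odd cycle produces an even cycle, so that one of the two graphs
  has an odd automorphism.\<close>

lemma coboundary_coeff_leafless_eq_0:
  assumes \<delta>: "\<delta> \<in> symmetric_combs n" and V: "finite V" "card V = Suc n" and \<Gamma>: "graph_on V \<Gamma>"
    and l: "leaves V \<Gamma> = {}"
  shows "coboundary_coeff \<delta> V \<Gamma> = 0"
proof -
  obtain p where p: "p permutes V" and \<Gamma>p: "\<Gamma> = perm_graph V p"
    using leafless_imp_perm_graph[OF V(1) \<Gamma> l] by blast
  note perm = permutes_imp_permutation[OF p V(1)]
  show ?thesis
  proof (cases "\<exists>v\<in>V. even (least_power p v)")
    case True
    then have "\<not> distinct_odd_cycles V p" by (auto simp: distinct_odd_cycles_def)
    \<comment> \<open>In this case the single contractions need not vanish, but their signed sum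
      does, since the coboundary is itself symmetric and \<Gamma> has an odd automorphism.\<close>
    then have "coeff_on (coboundary n \<delta>) V \<Gamma> = 0"
      unfolding \<Gamma>p using coboundary_symmetric[OF \<delta>] V p by (intro coeff_on_not_distinct_odd_eq_0) simp_all
    then show ?thesis using coeff_on_coboundary[OF \<delta> V \<Gamma>] by simp
  next
    case False
    have "coeff_on \<delta> (V - {j}) (contract \<Gamma> j i) = 0" if c: "contractible \<Gamma> j i" for j i
    proof -
      have ji: "(j, i) \<in> \<Gamma>" "j \<noteq> i" using c by (auto simp: contractible_def)
      then have pj: "i = p j" "j \<in> V" "i \<in> V" 
        using graph_onD[OF \<Gamma> ji(1)] by (simp_all add: \<Gamma>p mem_perm_graph)
      have fin: "finite (V - {j})" using V by simp
      have "leaves (V - {j}) (contract \<Gamma> j i) = {}" using leaves_contract[OF \<Gamma> c] l by simp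
      then obtain q where q: "q permutes (V - {j})" "contract \<Gamma> j i = perm_graph (V - {j}) q"
        using leafless_imp_perm_graph[OF fin graph_on_contract[OF \<Gamma> ji]] by blast
      have qv: "q v = (if p v = j then i else p v)" if "v \<in> V - {j}" for v
      proof -
        have "(v, p v) \<in> \<Gamma>" using that by (simp add: \<Gamma>p mem_perm_graph)
        then have "(v, if p v = j then i else p v) \<in> contract \<Gamma> j i"
          using that by (auto simp: contract_def)
        then show ?thesis unfolding q(2) mem_perm_graph by simp
      qed
      let ?cs = "support p i"
      define m where "m = least_power p i"
      have cyc: "is_cycle p ?cs" by (rule is_cycle_support[OF perm])
      have odd: "odd m" using False pj by (simp add: m_def)
      have "m \<noteq> 1"
      proof
        assume "m = 1"
        then have "p i = i" using least_power_of_permutation(1)[OF perm, of i] by (simp add: m_def)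
        then show False using pj(1) ji(2) permutes_inj[OF p] by (metis injD)
      qed
      then obtain l where m: "m = Suc l" "even l" "l > 0" using odd
        by (metis One_nat_def even_Suc not0_implies_Suc not_gr_zero odd_pos less_not_refl)
      have "(p ^^ Suc l) i = i"
        using least_power_of_permutation(1)[OF perm, of i] m(1) by (simp only: m_def)
      then have "p ((p ^^ l) i) = p j" using pj(1) by simp
      then have last: "(p ^^ l) i = j" using permutes_inj[OF p] by (metis injD)
      have inj: "(p ^^ a) i = (p ^^ b) i \<longleftrightarrow> a = b" if "a < m" "b < m" for a b
      proof -
        have "inj_on (\<lambda>k. (p ^^ k) i) {0..<m}"
          using cyc by (simp add: is_cycle_def distinct_map m_def)
        then show ?thesis using inj_on_eq_iff[of "\<lambda>k. (p ^^ k) i" "{0..<m}" a b] that by simp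
      qed
      \<comment> \<open>The cycle of \<open>p\<close> through \<open>i\<close>, started at
        \<open>i\<close>, ends with \<open>j\<close>. Dropping \<open>j\<close> leaves
        \<open>l = m - 1\<close> vertices, an even positive number, and the contraction closes them
        up to a cycle of \<open>q\<close>.\<close>
      let ?ds = "map (\<lambda>k. (p ^^ k) i) [0..<l]"
      have mem: "(p ^^ k) i \<in> V - {j}" if "k < l" for k
        using that inj[of k l] m last permutes_in_image[OF permutes_funpow[OF p]] pj(3) by auto
      have "is_cycle q ?ds"
        unfolding is_cycle_def
      proof (intro conjI allI impI)
        show "?ds \<noteq> []" using m by simp
        show "distinct ?ds" using inj m by (auto simp: distinct_map inj_on_def)
        fix k assume "k < length ?ds"
        then have k: "k < l" by simp
        have "q ((p ^^ k) i) = (if (p ^^ Suc k) i = j then i else (p ^^ Suc k) i)"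
          using qv[OF mem[OF k]] by simp
        also have "\<dots> = (p ^^ (Suc k mod l)) i"
          using k inj[of "Suc k" l] m last by (cases "Suc k = l") auto
        finally show "q (?ds ! k) = ?ds ! (Suc k mod length ?ds)" using k m by simp
      qed
      then show ?thesis
        unfolding q(2) using mem m V pj \<delta> q(1) fin
        by (intro coeff_on_even_cycle_eq_0[of _ _ _ ?ds]) auto
    qed
    then show ?thesis by (simp add: coboundary_coeff_def case_prod_unfold)
  qed
qed

section \<open>Wheels and cycle lists\<close>

definition cycle_arrows :: "nat list \<Rightarrow> vgraph" where
  "cycle_arrows cs = (\<lambda>k. (cs ! k, cs ! (Suc k mod length cs))) ` {..<length cs}"

lemma wheel_from_eq:
  assumes "m > 0"
  shows "wheel_from s m = (\<lambda>k. (s + 1 + k, s + 1 + (Suc k mod m))) ` {..<m}"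
proof (intro equalityI subsetI)
  fix e assume "e \<in> wheel_from s m"
  then consider a where "e = (s + a, s + a + 1)" "1 \<le> a" "a < m" | "e = (s + m, s + 1)"
    by (auto simp: wheel_from_def)
  then show "e \<in> (\<lambda>k. (s + 1 + k, s + 1 + (Suc k mod m))) ` {..<m}"
  proof cases
    case (1 a)
    then show ?thesis by (intro image_eqI[of _ _ "a - 1"]) auto
  next
    case 2
    then show ?thesis using assms by (intro image_eqI[of _ _ "m - 1"]) auto
  qed
next
  fix e assume "e \<in> (\<lambda>k. (s + 1 + k, s + 1 + (Suc k mod m))) ` {..<m}"
  then obtain k where k: "k < m" "e = (s + 1 + k, s + 1 + (Suc k mod m))" by auto
  show "e \<in> wheel_from s m"
  proof (cases "Suc k = m")
    case True
    then show ?thesis using k by (auto simp: wheel_from_def)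
  next
    case False
    then have "Suc k < m" using k(1) by simp
    then have "e = (s + Suc k, s + Suc k + 1) \<and> 1 \<le> Suc k" using k(2) by simp
    then show ?thesis using \<open>Suc k < m\<close> unfolding wheel_from_def by blast
  qed
qed

lemma relabel_wheel_from:
  assumes "cs \<noteq> []" "\<And>k. k < length cs \<Longrightarrow> \<sigma> (s + 1 + k) = cs ! k"
  shows "relabel \<sigma> (wheel_from s (length cs)) = cycle_arrows cs"
proof -
  have len: "length cs > 0" using assms(1) by simp
  show ?thesis
    unfolding relabel_def wheel_from_eq[OF len] cycle_arrows_def image_image
    by (rule image_cong) (use assms(2) len in auto)
qed

text \<open>Wheels are labelled consecutively, just as positions in a concatenated list. With the
  identity this recognises the standard wheels as a permutation graph, and with a renumbering it
  conjugates them to any permutation graph with cycles of these lengths.\<close>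

lemma relabel_wheels_from:
  assumes "[] \<notin> set css" "\<And>k. k < length (concat css) \<Longrightarrow> \<sigma> (s + 1 + k) = concat css ! k"
  shows "relabel \<sigma> (wheels_from s (map length css)) = (\<Union>cs\<in>set css. cycle_arrows cs)"
  using assms
proof (induction css arbitrary: s)
  case Nil
  then show ?case by (simp add: relabel_def)
next
  case (Cons cs css)
  have 1: "relabel \<sigma> (wheel_from s (length cs)) = cycle_arrows cs"
    by (rule relabel_wheel_from) (use Cons.prems(1) Cons.prems(2) in \<open>auto simp: nth_append\<close>)
  have 2: "relabel \<sigma> (wheels_from (s + length cs) (map length css)) = (\<Union>cs\<in>set css. cycle_arrows cs)"
  proof (rule Cons.IH)
    show "[] \<notin> set css" using Cons.prems(1) by simp
    fix k assume "k < length (concat css)"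
    then show "\<sigma> (s + length cs + 1 + k) = concat css ! k"
      using Cons.prems(2)[of "length cs + k"] by (simp add: nth_append add.assoc add.left_commute)
  qed
  show ?case using 1 2 by (simp add: relabel_def image_Un)
qed

definition cycle_lists :: "nat set \<Rightarrow> (nat \<Rightarrow> nat) \<Rightarrow> nat list list \<Rightarrow> bool" where
  "cycle_lists V p css \<longleftrightarrow> distinct (concat css) \<and> set (concat css) = V \<and> (\<forall>cs\<in>set css. is_cycle p cs)"

lemma cycle_lists_Nil: "cycle_lists V p css \<Longrightarrow> [] \<notin> set css"
  by (auto simp: cycle_lists_def is_cycle_def)

lemma cycle_lists_cases:
  assumes "cycle_lists V p css" "v \<in> V"
  obtains cs where "cs \<in> set css" "v \<in> set cs"
  using assms by (auto simp: cycle_lists_def)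

lemma cycle_lists_disjoint:
  assumes "cycle_lists V p css" "cs \<in> set css" "ds \<in> set css" "v \<in> set cs" "v \<in> set ds"
  shows "cs = ds"
  using assms unfolding cycle_lists_def distinct_concat_iff by blast

lemma perm_graph_cycle_lists:
  assumes "cycle_lists V p css"
  shows "perm_graph V p = (\<Union>cs\<in>set css. cycle_arrows cs)"
proof -
  have "cycle_arrows cs = (\<lambda>v. (v, p v)) ` set cs" if "cs \<in> set css" for cs
  proof -
    have "is_cycle p cs" using assms that by (simp add: cycle_lists_def)
    then have "cycle_arrows cs = (\<lambda>k. (cs ! k, p (cs ! k))) ` {..<length cs}"
      unfolding cycle_arrows_def by (intro image_cong) (auto simp: is_cycle_def)
    also have "\<dots> = (\<lambda>v. (v, p v)) ` (\<lambda>k. cs ! k) ` {..<length cs}" by (simp add: image_image)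
    also have "(\<lambda>k. cs ! k) ` {..<length cs} = set cs" by (auto simp: set_conv_nth)
    finally show ?thesis .
  qed
  moreover have "V = (\<Union>cs\<in>set css. set cs)" using assms by (auto simp: cycle_lists_def)
  ultimately show ?thesis by (auto simp: perm_graph_def)
qed

lemma is_cycle_cycle_of_list:
  assumes "distinct cs" "cs \<noteq> []"
  shows "is_cycle (cycle_of_list cs) cs"
proof -
  have "map (cycle_of_list cs) cs = rotate1 cs" using cyclic_rotation[OF assms(1), of 1] by simp
  then have "cycle_of_list cs (cs ! k) = cs ! (Suc k mod length cs)" if "k < length cs" for k
    using that by (metis nth_map nth_rotate1)
  then show ?thesis using assms by (simp add: is_cycle_def)
qed

lemma is_cycle_cong:
  assumes "is_cycle p cs" "\<And>v. v \<in> set cs \<Longrightarrow> q v = p v"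
  shows "is_cycle q cs"
  using assms by (simp add: is_cycle_def)

lemma cycle_lists_exists_permutation:
  assumes "distinct (concat css)" "[] \<notin> set css"
  shows "\<exists>p. p permutes set (concat css) \<and> cycle_lists (set (concat css)) p css"
  using assms
proof (induction css)
  case Nil
  show ?case by (intro exI[of _ id]) (simp add: cycle_lists_def fun_eq_iff)
next
  case (Cons cs css)
  then obtain p where p: "p permutes set (concat css)" "\<forall>cs\<in>set css. is_cycle p cs"
    by (auto simp: cycle_lists_def)
  have disj: "set cs \<inter> set (concat css) = {}" and cs: "distinct cs" "cs \<noteq> []" using Cons.prems by auto
  define q where "q = cycle_of_list cs \<circ> p"
  have "q permutes set (concat (cs # css))"
    unfolding q_def by (rule permutes_compose) (auto intro: permutes_subset[OF p(1)] permutes_subset[OF cycle_permutes])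
  moreover have "is_cycle q cs"
  proof (rule is_cycle_cong[OF is_cycle_cycle_of_list[OF cs]])
    fix v assume "v \<in> set cs"
    then have "v \<notin> set (concat css)" using disj by blast
    then show "q v = cycle_of_list cs v" using permutes_not_in[OF p(1)] by (simp add: q_def)
  qed
  moreover have "is_cycle q ds" if "ds \<in> set css" for ds
  proof (rule is_cycle_cong)
    show "is_cycle p ds" using p(2) that by blast
    fix v assume "v \<in> set ds"
    then have "p v \<in> set ds" using is_cycle_image[OF \<open>is_cycle p ds\<close>] by blast
    then have "p v \<notin> set cs" using that disj by auto
    then show "q v = p v" using id_outside_supp by (simp add: q_def)
  qed
  ultimately show ?case using Cons.prems(1) by (intro exI[of _ q]) (simp add: cycle_lists_def)
qed

lemma cycle_lists_exist:
  assumes p: "permutation p" and W: "finite W" "\<And>v. p v \<in> W \<longleftrightarrow> v \<in> W"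
  shows "\<exists>css. cycle_lists W p css"
  using W
proof (induction W rule: finite_psubset_induct)
  case (psubset W)
  show ?case
  proof (cases "W = {}")
    case True
    then show ?thesis by (intro exI[of _ "[]"]) (simp add: cycle_lists_def)
  next
    case False
    then obtain x where x: "x \<in> W" by blast
    let ?cs = "support p x"
    have cyc: "is_cycle p ?cs" by (rule is_cycle_support[OF p])
    have inj: "inj p" using p by (simp add: permutation bij_is_inj)
    have "(p ^^ k) x \<in> W" for k by (induction k) (simp_all add: x psubset.prems)
    then have sub: "set ?cs \<subseteq> W" by auto
    have "x \<in> set ?cs" using least_power_of_permutation(2)[OF p, of x] by force
    then have "W - set ?cs \<subset> W" using x by blast
    moreover have "p v \<in> W - set ?cs \<longleftrightarrow> v \<in> W - set ?cs" for v
      using psubset.prems is_cycle_mem_iff[OF cyc inj] by blast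
    ultimately obtain css where "cycle_lists (W - set ?cs) p css" using psubset.IH by blast
    then have "cycle_lists W p (?cs # css)"
      using cyc sub unfolding cycle_lists_def by (auto simp: is_cycle_def simp del: set_map)
    then show ?thesis by blast
  qed
qed

lemma least_power_image_cycle_lists:
  assumes "cycle_lists V p css"
  shows "least_power p ` V = length ` set css"
proof (intro equalityI subsetI)
  fix m assume "m \<in> least_power p ` V"
  then obtain v where "v \<in> V" "m = least_power p v" by blast
  moreover obtain cs where "cs \<in> set css" "v \<in> set cs" using cycle_lists_cases[OF assms \<open>v \<in> V\<close>] .
  ultimately show "m \<in> length ` set css"
    using least_power_is_cycle[of p cs v] assms by (auto simp: cycle_lists_def)
next
  fix m assume "m \<in> length ` set css"
  then obtain cs where cs: "cs \<in> set css" "m = length cs" by blast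
  then have cyc: "is_cycle p cs" using assms by (simp add: cycle_lists_def)
  then have hd: "hd cs \<in> set cs" by (simp add: is_cycle_def)
  then have "hd cs \<in> V" using assms cs(1) by (auto simp: cycle_lists_def)
  then show "m \<in> least_power p ` V" using least_power_is_cycle[OF cyc hd] cs(2) by force
qed

lemma distinct_odd_cyclesI:
  assumes css: "cycle_lists V p css" and "\<forall>cs\<in>set css. odd (length cs)" and inj: "inj_on length (set css)"
  shows "distinct_odd_cycles V p"
  unfolding distinct_odd_cycles_def
proof (intro conjI ballI impI)
  fix v assume "v \<in> V"
  then have "least_power p v \<in> length ` set css" using least_power_image_cycle_lists[OF css] by blast
  then show "odd (least_power p v)" using assms(2) by auto
next
  fix u v assume uv: "u \<in> V" "v \<in> V" "least_power p u = least_power p v"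
  obtain cs where cs: "cs \<in> set css" "u \<in> set cs" using cycle_lists_cases[OF css uv(1)] .
  obtain ds where ds: "ds \<in> set css" "v \<in> set ds" using cycle_lists_cases[OF css uv(2)] .
  have cyc: "is_cycle p cs" "is_cycle p ds" using css cs(1) ds(1) by (auto simp: cycle_lists_def)
  have "length cs = length ds"
    using least_power_is_cycle[OF cyc(1) cs(2)] least_power_is_cycle[OF cyc(2) ds(2)] uv(3) by simp
  then have "cs = ds" using inj cs(1) ds(1) by (auto dest: inj_onD)
  then obtain a b where ab: "a < length cs" "u = cs ! a" "b < length cs" "v = cs ! b"
    using cs(2) ds(2) by (metis in_set_conv_nth)
  \<comment> \<open>The extra turn \<open>length cs\<close> keeps the subtraction exact when
    \<open>b < a\<close>.\<close>
  have "(p ^^ (b + length cs - a)) u = v"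
    using is_cycle_funpow[OF cyc(1) ab(1), of "b + length cs - a"] ab by simp
  then show "\<exists>t. v = (p ^^ t) u" by blast
qed

lemma distinct_odd_cyclesD:
  assumes css: "cycle_lists V p css" and d: "distinct_odd_cycles V p"
  shows "\<forall>cs\<in>set css. odd (length cs)" "inj_on length (set css)"
proof -
  show "\<forall>cs\<in>set css. odd (length cs)"
    using d least_power_image_cycle_lists[OF css] unfolding distinct_odd_cycles_def by (metis image_iff)
  show "inj_on length (set css)"
  proof (rule inj_onI)
    fix cs ds assume cd: "cs \<in> set css" "ds \<in> set css" "length cs = length ds"
    then have cyc: "is_cycle p cs" "is_cycle p ds" using css by (auto simp: cycle_lists_def)
    then have mem: "cs ! 0 \<in> set cs" "ds ! 0 \<in> set ds" and len: "0 < length cs" by (auto simp: is_cycle_def)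
    then have "cs ! 0 \<in> V" "ds ! 0 \<in> V" using css cd by (auto simp: cycle_lists_def)
    moreover have "least_power p (cs ! 0) = least_power p (ds ! 0)"
      using least_power_is_cycle[OF cyc(1) mem(1)] least_power_is_cycle[OF cyc(2) mem(2)] cd(3) by simp
    ultimately obtain t where "ds ! 0 = (p ^^ t) (cs ! 0)"
      using d unfolding distinct_odd_cycles_def by blast
    then have "ds ! 0 = cs ! (t mod length cs)" using is_cycle_funpow[OF cyc(1) len] by simp
    then have "ds ! 0 \<in> set cs" using len by simp
    then show "cs = ds" using cycle_lists_disjoint[OF css cd(1,2)] mem(2) by blast
  qed
qed

section \<open>Standard wheels as representatives of conjugacy classes\<close>

fun wheel_cycles :: "nat \<Rightarrow> nat list \<Rightarrow> nat list list" where
  "wheel_cycles s [] = []"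
| "wheel_cycles s (m # ms) = [s + 1..<s + m + 1] # wheel_cycles (s + m) ms"

lemma map_length_wheel_cycles: "map length (wheel_cycles s ms) = ms"
  by (induction s ms rule: wheel_cycles.induct) (simp_all del: upt_Suc)

lemma concat_wheel_cycles: "concat (wheel_cycles s ms) = [s + 1..<s + sum_list ms + 1]"
proof (induction s ms rule: wheel_cycles.induct)
  case (2 s m ms)
  have "[s + 1..<s + (m + sum_list ms) + 1] = [s + 1..<s + m + 1] @ [s + m + 1..<s + m + sum_list ms + 1]"
    using upt_add_eq_append[of "s + 1" "s + m + 1" "sum_list ms"] by (simp add: add_ac del: upt_Suc)
  then show ?case using 2 by (simp del: upt_Suc)
qed simp

abbreviation odd_wheels :: "nat list \<Rightarrow> vgraph" where
  "odd_wheels ks \<equiv> wheels_from 0 (map (\<lambda>k. 2 * k + 1) ks)"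

lemma odd_wheels_perm_graph:
  assumes "ks \<in> odd_wheel_indices n"
  obtains p where "p permutes {1..n}" "odd_wheels ks = perm_graph {1..n} p" "distinct_odd_cycles {1..n} p"
    "least_power p ` {1..n} = (\<lambda>k. 2 * k + 1) ` set ks"
proof -
  let ?ms = "map (\<lambda>k. 2 * k + 1) ks"
  define css where "css = wheel_cycles 0 ?ms"
  have n: "sum_list ?ms = n" using assms by (simp add: odd_wheel_indices_def)
  have concat: "concat css = [1..<Suc n]" unfolding css_def concat_wheel_cycles n by simp
  have len: "map length css = ?ms" by (simp only: css_def map_length_wheel_cycles)
  have nil: "[] \<notin> set css"
  proof
    assume "[] \<in> set css"
    then have "0 \<in> set (map length css)" by force
    then show False unfolding len by auto
  qed
  have V: "set (concat css) = {1..n}" unfolding concat by auto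
  obtain p where p: "p permutes {1..n}" "cycle_lists {1..n} p css"
    using cycle_lists_exists_permutation[OF _ nil] distinct_upt[of 1 "Suc n"] unfolding concat[symmetric] V by blast
  have "relabel id (wheels_from 0 (map length css)) = (\<Union>cs\<in>set css. cycle_arrows cs)"
    by (rule relabel_wheels_from[OF nil]) (simp add: concat del: upt_Suc)
  then have 1: "odd_wheels ks = perm_graph {1..n} p"
    unfolding perm_graph_cycle_lists[OF p(2)] relabel_id len .
  have lset: "length ` set css = (\<lambda>k. 2 * k + 1) ` set ks"
    using arg_cong[OF len, of set] by simp
  then have "\<forall>cs\<in>set css. odd (length cs)" by (metis (no_types, lifting) even_plus_one_iff dvd_triv_left image_iff)
  moreover have "inj_on length (set css)"
  proof -
    have "distinct ks" using assms by (auto simp: odd_wheel_indices_def strict_sorted_iff)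
    then have "distinct (map length css)" unfolding len by (simp add: distinct_map inj_on_def)
    then show ?thesis by (simp add: distinct_map)
  qed
  ultimately have "distinct_odd_cycles {1..n} p" by (rule distinct_odd_cyclesI[OF p(2)])
  then show thesis
    using that[OF p(1) 1] least_power_image_cycle_lists[OF p(2)] lset by simp
qed

lemma distinct_odd_perm_graph_conjugate:
  assumes n: "n \<ge> 1" and p: "p permutes {1..n}" and d: "distinct_odd_cycles {1..n} p"
  obtains ks \<sigma> where "ks \<in> odd_wheel_indices n" "\<sigma> permutes {1..n}"
    "relabel \<sigma> (odd_wheels ks) = perm_graph {1..n} p"
proof -
  obtain css0 where css0: "cycle_lists {1..n} p css0"
    using cycle_lists_exist[OF permutes_imp_permutation[OF p], of "{1..n}"] permutes_in_image[OF p] by blast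
  \<comment> \<open>Sorting by length makes the lengths weakly increasing; as they are distinct, the
    resulting index list is strictly increasing.\<close>
  define css where "css = sort_key length css0"
  have set: "set css = set css0" by (simp add: css_def)
  \<comment> \<open>A distinct concatenation allows the empty list to be repeated, and only that
    one; cycles are nonempty.\<close>
  have "removeAll [] css0 = css0" using cycle_lists_Nil[OF css0] by (rule removeAll_id)
  then have dist: "distinct css"
    using css0 unfolding css_def distinct_sort cycle_lists_def distinct_concat_iff by simp
  have css: "cycle_lists {1..n} p css"
    unfolding cycle_lists_def
  proof (intro conjI)
    show "distinct (concat css)"
    proof (rule distinct_concat[OF dist])
      show "distinct cs" if "cs \<in> set css" for cs
        using css0 that by (simp add: cycle_lists_def set is_cycle_def)
      show "set cs \<inter> set ds = {}" if "cs \<in> set css" "ds \<in> set css" "cs \<noteq> ds" for cs ds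
        using cycle_lists_disjoint[OF css0] that set by blast
    qed
  qed (use css0 in \<open>simp_all add: cycle_lists_def set\<close>)
  note odd = distinct_odd_cyclesD(1)[OF css d] and inj = distinct_odd_cyclesD(2)[OF css d]
  define ks where "ks = map (\<lambda>cs. length cs div 2) css"
  have len: "map (\<lambda>k. 2 * k + 1) ks = map length css"
    unfolding ks_def map_map by (rule map_cong) (use odd in \<open>auto simp: odd_two_times_div_two_succ\<close>)
  have length: "length (concat css) = n"
    using css distinct_card[of "concat css"] by (simp add: cycle_lists_def)
  have "ks \<in> odd_wheel_indices n"
    unfolding odd_wheel_indices_def
  proof (intro CollectI conjI)
    show sum: "(\<Sum>k\<leftarrow>ks. 2 * k + 1) = n" using length len by (simp only: length_concat)
    then show "ks \<noteq> []" using n by auto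
    have "distinct (map length css)" using dist inj by (simp add: distinct_map)
    moreover have "sorted (map length css)" by (simp add: css_def)
    ultimately have "sorted_wrt (<) (map (\<lambda>k. 2 * k + 1) ks)" unfolding len strict_sorted_iff by simp
    then show "sorted_wrt (<) ks" by (simp add: sorted_wrt_map)
  qed
  moreover
  \<comment> \<open>Labels start at 1 and list positions at 0, hence \<open>i - 1\<close>.\<close>
  define \<sigma> where "\<sigma> i = (if i \<in> {1..n} then concat css ! (i - 1) else i)" for i
  have "\<sigma> ` {1..n} = {1..n}"
  proof -
    have "\<sigma> ` {1..n} = (\<lambda>k. concat css ! k) ` {..<n}"
    proof -
      have "{1..n} = Suc ` {..<n}" by (simp only: image_Suc_lessThan)
      then have "\<sigma> ` {1..n} = (\<lambda>k. \<sigma> (Suc k)) ` {..<n}" by (simp add: image_image)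
      also have "\<dots> = (\<lambda>k. concat css ! k) ` {..<n}" by (rule image_cong) (auto simp: \<sigma>_def)
      finally show ?thesis .
    qed
    also have "\<dots> = set (concat css)" using length by (auto simp: set_conv_nth)
    finally show ?thesis using css by (simp add: cycle_lists_def)
  qed
  then have "\<sigma> permutes {1..n}"
    by (intro bij_imp_permutes) (auto simp: bij_betw_def \<sigma>_def intro: eq_card_imp_inj_on)
  moreover have "relabel \<sigma> (odd_wheels ks) = perm_graph {1..n} p"
    unfolding len perm_graph_cycle_lists[OF css]
    by (rule relabel_wheels_from[OF cycle_lists_Nil[OF css]]) (simp add: \<sigma>_def length)
  ultimately show thesis by (rule that)
qed

text \<open>The set of cycle lengths is invariant under conjugation, and a strictly increasing list
  is determined by its set.\<close>

lemma odd_wheels_conjugate_imp_eq: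
  assumes ks: "ks \<in> odd_wheel_indices n" and ls: "ls \<in> odd_wheel_indices n" and \<sigma>: "\<sigma> permutes {1..n}"
    and eq: "relabel \<sigma> (odd_wheels ks) = odd_wheels ls"
  shows "ks = ls"
proof -
  obtain p where p: "p permutes {1..n}" "odd_wheels ks = perm_graph {1..n} p"
    "least_power p ` {1..n} = (\<lambda>k. 2 * k + 1) ` set ks"
    using odd_wheels_perm_graph[OF ks] .
  obtain q where q: "q permutes {1..n}" "odd_wheels ls = perm_graph {1..n} q"
    "least_power q ` {1..n} = (\<lambda>k. 2 * k + 1) ` set ls"
    using odd_wheels_perm_graph[OF ls] .
  have conj: "\<sigma> (p v) = q (\<sigma> v)" for v
  proof (cases "v \<in> {1..n}")
    case True
    then have "(v, p v) \<in> odd_wheels ks" unfolding p(2) mem_perm_graph by blast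
    then have "(\<sigma> v, \<sigma> (p v)) \<in> perm_graph {1..n} q"
      unfolding q(2)[symmetric] eq[symmetric] by (force simp: relabel_def)
    then show ?thesis by (simp add: mem_perm_graph)
  next
    case False
    then show ?thesis by (simp add: permutes_not_in[OF p(1)] permutes_not_in[OF q(1)] permutes_not_in[OF \<sigma>])
  qed
  have "least_power q ` {1..n} = least_power q ` \<sigma> ` {1..n}" by (simp only: permutes_image[OF \<sigma>])
  also have "\<dots> = least_power p ` {1..n}"
    unfolding image_image least_power_conjugate[of \<sigma> p q, OF conj permutes_inj[OF \<sigma>]] ..
  finally have "(\<lambda>k. 2 * k + 1) ` set ls = (\<lambda>k. 2 * k + (1::nat)) ` set ks" by (simp only: p(3) q(3))
  moreover have "inj (\<lambda>k. 2 * k + (1::nat))" by (simp add: inj_on_def)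
  ultimately have "set ls = set ks" by (simp only: inj_image_eq_iff)
  then show ?thesis
    using ks ls by (intro strict_sorted_equal) (simp_all add: odd_wheel_indices_def)
qed

section \<open>Wedges of odd wheels\<close>

lemma lookup_symmetrization:
  "Poly_Mapping.lookup (symmetrization n \<Delta>) G =
     (\<Sum>\<sigma> | \<sigma> permutes {1..n}. if relabel \<sigma> \<Delta> = G then eps_deb \<Delta> \<sigma> else 0)"
  by (simp add: symmetrization_def lookup_sum lookup_single when_def)

lemma lookup_symmetrization_nonzero:
  assumes "Poly_Mapping.lookup (symmetrization n \<Delta>) G \<noteq> 0"
  obtains \<sigma> where "\<sigma> permutes {1..n}" "relabel \<sigma> \<Delta> = G"
  using assms unfolding lookup_symmetrization
  by (auto elim!: sum.not_neutral_contains_not_neutral split: if_splits)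

text \<open>Replacing the summation variable \<sigma> by \<open>\<tau> \<circ> \<sigma>\<close>
  pulls out the sign of \<tau>: on the nonzero terms \<open>relabel \<sigma> \<Delta>\<close> equals
  \<open>G\<close>, so the factor is always \<open>eps_deb G \<tau>\<close>.\<close>

lemma symmetrization_symmetric:
  assumes \<Delta>: "graph_on {1..n} \<Delta>"
  shows "symmetrization n \<Delta> \<in> symmetric_combs n"
  unfolding symmetric_combs_def
proof (intro CollectI conjI ballI allI impI subsetI)
  fix G assume "G \<in> Poly_Mapping.keys (symmetrization n \<Delta>)"
  then obtain \<sigma> where "\<sigma> permutes {1..n}" "relabel \<sigma> \<Delta> = G"
    unfolding in_keys_iff by (rule lookup_symmetrization_nonzero)
  then show "G \<in> vectorial_graphs n" using relabel_permutes[OF _ \<Delta>] mem_vectorial_graphs by blast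
next
  fix G \<tau> assume "G \<in> vectorial_graphs n" and \<tau>: "\<tau> permutes {1..n}"
  then have G: "graph_on {1..n} G" by (simp add: mem_vectorial_graphs)
  have inj\<tau>: "inj_on \<tau> {1..n}" by (rule permutes_inj_on[OF \<tau>])
  have "Poly_Mapping.lookup (symmetrization n \<Delta>) (relabel \<tau> G) =
    (\<Sum>\<sigma> | \<sigma> permutes {1..n}. if relabel (\<tau> \<circ> \<sigma>) \<Delta> = relabel \<tau> G then eps_deb \<Delta> (\<tau> \<circ> \<sigma>) else 0)"
    unfolding lookup_symmetrization by (rule setum_permutations_compose_left[OF \<tau>])
  also have "\<dots> = (\<Sum>\<sigma> | \<sigma> permutes {1..n}. eps_deb G \<tau> * (if relabel \<sigma> \<Delta> = G then eps_deb \<Delta> \<sigma> else 0))"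
  proof (rule sum.cong, rule refl)
    fix \<sigma> assume "\<sigma> \<in> {\<sigma>. \<sigma> permutes {1..n}}"
    then have \<sigma>: "\<sigma> permutes {1..n}" by simp
    have "relabel (\<tau> \<circ> \<sigma>) \<Delta> = relabel \<tau> G \<longleftrightarrow> relabel \<sigma> \<Delta> = G"
      unfolding relabel_comp using relabel_inj[OF relabel_permutes[OF \<sigma> \<Delta>] G inj\<tau>] by blast
    moreover have "eps_deb \<Delta> (\<tau> \<circ> \<sigma>) = eps_deb (relabel \<sigma> \<Delta>) \<tau> * eps_deb \<Delta> \<sigma>"
      by (rule eps_deb_compose[OF \<Delta> _ permutes_inj_on[OF \<sigma>] permutes_inj_on[OF \<tau>]]) simp
    ultimately show "(if relabel (\<tau> \<circ> \<sigma>) \<Delta> = relabel \<tau> G then eps_deb \<Delta> (\<tau> \<circ> \<sigma>) else 0) =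
       eps_deb G \<tau> * (if relabel \<sigma> \<Delta> = G then eps_deb \<Delta> \<sigma> else 0)"
      by (simp only: mult_zero_right if_True if_False split: if_split) blast
  qed
  finally show "Poly_Mapping.lookup (symmetrization n \<Delta>) (relabel \<tau> G) = 
      eps_deb G \<tau> * Poly_Mapping.lookup (symmetrization n \<Delta>) G"
    by (simp only: lookup_symmetrization sum_distrib_left)
qed

lemma odd_wheel_wedge_eq:
  assumes "ks \<in> odd_wheel_indices n"
  shows "odd_wheel_wedge ks = symmetrization n (odd_wheels ks)"
  using assms by (simp add: odd_wheel_wedge_def wheel_wedge_def odd_wheel_indices_def)

lemma graph_on_odd_wheels:
  assumes "ks \<in> odd_wheel_indices n"
  shows "graph_on {1..n} (odd_wheels ks)"
  using odd_wheels_perm_graph[OF assms] graph_on_perm_graph by metis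

lemma leaves_odd_wheels:
  assumes "ks \<in> odd_wheel_indices n"
  shows "leaves {1..n} (odd_wheels ks) = {}"
  using odd_wheels_perm_graph[OF assms] leaves_perm_graph by metis

lemma odd_wheel_wedge_symmetric:
  assumes "ks \<in> odd_wheel_indices n"
  shows "odd_wheel_wedge ks \<in> symmetric_combs n"
  unfolding odd_wheel_wedge_eq[OF assms] by (rule symmetrization_symmetric[OF graph_on_odd_wheels[OF assms]])

text \<open>The contributing permutations form the stabilizer of the graph, and all of them have
  sign 1. So nothing cancels, and the coefficient is the order of the stabilizer.\<close>

lemma lookup_odd_wheel_wedge_self:
  assumes ks: "ks \<in> odd_wheel_indices n"
  shows "Poly_Mapping.lookup (odd_wheel_wedge ks) (odd_wheels ks) \<noteq> 0"
proof -
  obtain p where p: "p permutes {1..n}" "odd_wheels ks = perm_graph {1..n} p" "distinct_odd_cycles {1..n} p"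
    using odd_wheels_perm_graph[OF ks] .
  let ?S = "{\<sigma>. \<sigma> permutes {1..n}}" and ?W = "odd_wheels ks"
  have "eps_deb ?W \<sigma> = 1" if \<sigma>: "\<sigma> permutes {1..n}" and fix_W: "relabel \<sigma> ?W = ?W" for \<sigma>
  proof -
    have "\<sigma> (p v) = p (\<sigma> v)" for v
    proof (cases "v \<in> {1..n}")
      case True
      then have "(v, p v) \<in> ?W" unfolding p(2) mem_perm_graph by blast
      then have "(\<sigma> v, \<sigma> (p v)) \<in> relabel \<sigma> ?W" by (force simp: relabel_def)
      then show ?thesis unfolding fix_W unfolding p(2) mem_perm_graph by simp
    next
      case False
      then show ?thesis by (simp add: permutes_not_in[OF p(1)] permutes_not_in[OF \<sigma>])
    qed
    then have "sign \<sigma> = 1" using sign_centralizer[OF _ p(1) \<sigma> _ p(3)] by simp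
    then show ?thesis unfolding p(2) using eps_deb_perm_graph[OF _ p(1) \<sigma>] by simp
  qed
  then have "Poly_Mapping.lookup (odd_wheel_wedge ks) ?W = (\<Sum>\<sigma>\<in>?S. if relabel \<sigma> ?W = ?W then 1 else 0)"
    unfolding odd_wheel_wedge_eq[OF ks] lookup_symmetrization by (intro sum.cong) auto
  also have "\<dots> = card {\<sigma> \<in> ?S. relabel \<sigma> ?W = ?W}"
    using finite_permutations[of "{1..n}"] by (simp add: sum.inter_filter[symmetric])
  also have "\<dots> \<noteq> 0"
  proof -
    have "id \<in> {\<sigma> \<in> ?S. relabel \<sigma> ?W = ?W}" by (simp only: mem_Collect_eq relabel_id permutes_id simp_thms)
    moreover have "finite {\<sigma> \<in> ?S. relabel \<sigma> ?W = ?W}"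
      using finite_permutations[of "{1..n}"] by simp
    ultimately show ?thesis unfolding of_nat_eq_0_iff by (metis (no_types, lifting) card_0_eq empty_iff)
  qed
  finally show ?thesis .
qed

lemma lookup_odd_wheel_wedge_other:
  assumes "ks \<in> odd_wheel_indices n" "ls \<in> odd_wheel_indices n" "ks \<noteq> ls"
  shows "Poly_Mapping.lookup (odd_wheel_wedge ks) (odd_wheels ls) = 0"
proof (rule ccontr)
  assume "Poly_Mapping.lookup (odd_wheel_wedge ks) (odd_wheels ls) \<noteq> 0"
  then obtain \<sigma> where "\<sigma> permutes {1..n}" "relabel \<sigma> (odd_wheels ks) = odd_wheels ls"
    unfolding odd_wheel_wedge_eq[OF assms(1)] by (rule lookup_symmetrization_nonzero)
  then show False using odd_wheels_conjugate_imp_eq assms by blast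
qed

lemma lookup_odd_wheel_wedge_leaves:
  assumes ks: "ks \<in> odd_wheel_indices n" and "leaves {1..n} G \<noteq> {}"
  shows "Poly_Mapping.lookup (odd_wheel_wedge ks) G = 0"
proof (rule ccontr)
  assume "Poly_Mapping.lookup (odd_wheel_wedge ks) G \<noteq> 0"
  then obtain \<sigma> where \<sigma>: "\<sigma> permutes {1..n}" "relabel \<sigma> (odd_wheels ks) = G"
    unfolding odd_wheel_wedge_eq[OF ks] by (rule lookup_symmetrization_nonzero)
  have "leaves {1..n} G = {}"
    using leaves_relabel[OF graph_on_odd_wheels[OF ks] permutes_inj_on[OF \<sigma>(1)]]
    unfolding permutes_image[OF \<sigma>(1)] \<sigma>(2) leaves_odd_wheels[OF ks] by simp
  then show False using assms(2) by simp
qed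

text \<open>At leafless graphs every coboundary vanishes. At a graph with a leaf, all contractions
  have a leaf as well, whereas the wedge is supported on leafless graphs.\<close>

lemma odd_wheel_wedge_cocycle:
  assumes ks: "ks \<in> odd_wheel_indices n"
  shows "odd_wheel_wedge ks \<in> cocycles n"
proof -
  let ?R = "odd_wheel_wedge ks"
  note R = odd_wheel_wedge_symmetric[OF ks]
  have "Poly_Mapping.lookup (coboundary n ?R) G = 0" for G
  proof (cases "graph_on {1..Suc n} G")
    case G: True
    have "coboundary_coeff ?R {1..Suc n} G = 0"
    proof (cases "leaves {1..Suc n} G = {}")
      case True
      then show ?thesis by (intro coboundary_coeff_leafless_eq_0[OF R _ _ G]) simp_all
    next
      case False
      have "coeff_on ?R ({1..Suc n} - {j}) (contract G j i) = 0" if c: "contractible G j i" for j i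
      proof -
        let ?V = "{1..Suc n} - {j}" and ?C = "contract G j i"
        have ji: "(j, i) \<in> G" "j \<noteq> i" using c by (auto simp: contractible_def)
        have V: "finite ?V" "rank ?V ` ?V = {1..n}"
          using graph_onD(1)[OF G ji(1)] rank_image[of ?V] by simp_all
        have "card (leaves {1..n} (relabel (rank ?V) ?C)) = card (leaves ?V ?C)"
          using card_leaves_relabel[OF graph_on_contract[OF G ji] inj_on_rank[OF V(1)]] unfolding V(2) .
        also have "\<dots> = card (leaves {1..Suc n} G)" by (rule card_leaves_contract[OF _ G c]) simp
        also have "\<dots> \<noteq> 0" using False finite_leaves[of "{1..Suc n}" G] by simp
        finally have "leaves {1..n} (relabel (rank ?V) ?C) \<noteq> {}" by auto
        then show ?thesis unfolding coeff_on_def by (rule lookup_odd_wheel_wedge_leaves[OF ks])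
      qed
      then show ?thesis by (simp add: coboundary_coeff_def case_prod_unfold)
    qed
    then show ?thesis by (simp only: lookup_coboundary[OF R G])
  next
    case False
    then show ?thesis by (rule lookup_coboundary_eq_0[OF R])
  qed
  then have "coboundary n ?R = 0" by (intro poly_mapping_eqI) simp
  then show ?thesis using R by (simp add: cocycles_def)
qed

text \<open>Hence the coefficient at a standard wheel graph is well defined on cohomology classes;
  these functionals serve as coordinates.\<close>

lemma lookup_coboundary_odd_wheels:
  assumes "\<beta> \<in> symmetric_combs m" "ks \<in> odd_wheel_indices (Suc m)"
  shows "Poly_Mapping.lookup (coboundary m \<beta>) (odd_wheels ks) = 0"
  unfolding lookup_coboundary[OF assms(1) graph_on_odd_wheels[OF assms(2)]]
  by (rule coboundary_coeff_leafless_eq_0[OF assms(1) _ _ graph_on_odd_wheels[OF assms(2)] leaves_odd_wheels[OF assms(2)]])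
     simp_all

lemma finite_odd_wheel_indices: "finite (odd_wheel_indices n)"
proof (rule finite_subset)
  have "k \<le> n" if "(\<Sum>k\<leftarrow>ks. 2 * k + 1) = n" "k \<in> set ks" for ks k
    using that member_le_sum_list[of "2 * k + 1" "map (\<lambda>k. 2 * k + 1) ks"] by simp
  moreover have "length ks \<le> (\<Sum>k\<leftarrow>ks. 2 * k + 1)" for ks :: "nat list"
    by (induction ks) auto
  ultimately show "odd_wheel_indices n \<subseteq> {ks. set ks \<subseteq> {..n} \<and> length ks \<le> n}"
    unfolding odd_wheel_indices_def by fastforce
  show "finite {ks. set ks \<subseteq> {..n} \<and> length ks \<le> n}"
    by (rule finite_lists_length_le) simp
qed

text \<open>A leafless graph is either conjugate to a standard wheel graph, so that symmetry
  determines its coefficient, or has an odd automorphism and coefficient 0. For \<open>n = 0\<close>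
  the empty graph would escape, since no index list has sum 0.\<close>

lemma symmetric_combs_eq_0I:
  assumes n: "n \<ge> 1" and w: "w \<in> symmetric_combs n"
    and leafy: "\<And>G. graph_on {1..n} G \<Longrightarrow> leaves {1..n} G \<noteq> {} \<Longrightarrow> Poly_Mapping.lookup w G = 0"
    and wheels: "\<And>ks. ks \<in> odd_wheel_indices n \<Longrightarrow> Poly_Mapping.lookup w (odd_wheels ks) = 0"
  shows "w = 0"
proof (rule poly_mapping_eqI)
  fix G
  show "Poly_Mapping.lookup w G = Poly_Mapping.lookup 0 G"
  proof (cases "graph_on {1..n} G \<and> leaves {1..n} G = {}")
    case True
    then have G: "graph_on {1..n} G" by blast
    obtain p where p: "p permutes {1..n}" "G = perm_graph {1..n} p"
      using leafless_imp_perm_graph[of "{1..n}" G] True by auto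
    show ?thesis
    proof (cases "distinct_odd_cycles {1..n} p")
      case True
      then obtain ks \<sigma> where "ks \<in> odd_wheel_indices n" "\<sigma> permutes {1..n}" "relabel \<sigma> (odd_wheels ks) = G"
        using distinct_odd_perm_graph_conjugate[OF n p(1)] p(2) by metis
      then show ?thesis
        using symmetric_combs_lookup[OF w graph_on_odd_wheels] wheels by fastforce
    next
      case False
      then have "coeff_on w {1..n} G = 0"
        unfolding p(2) using w by (intro coeff_on_not_distinct_odd_eq_0 p(1)) simp_all
      then show ?thesis by (simp only: coeff_on_atLeast1[OF G] lookup_zero)
    qed
  next
    case False
    then show ?thesis using leafy symmetric_combs_lookup_eq_0[OF w] by auto
  qed
qed

lemma homotopy_0: "homotopy n 0 = 0"
  by (simp add: homotopy_def leaf_sum_def coeff_on_def)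

lemma cocycle_decomposition:
  assumes n: "n \<ge> 1" and z: "z \<in> cocycles n"
  obtains c b where "b \<in> coboundaries n" "z = (\<Sum>ks\<in>odd_wheel_indices n. c ks *\<^sub>R odd_wheel_wedge ks) + b"
proof -
  obtain m where m: "n = Suc m" using n by (cases n) auto
  let ?I = "odd_wheel_indices n" and ?R = odd_wheel_wedge
  have zs: "z \<in> symmetric_combs n" "coboundary n z = 0" using z by (auto simp: cocycles_def)
  define h where "h = homotopy m z"
  have h: "h \<in> symmetric_combs m" using homotopy_symmetric zs(1) by (simp add: h_def m)
  define b where "b = coboundary m h"
  have b: "b \<in> coboundaries n" "b \<in> symmetric_combs n"
    using coboundaries_eq[OF n] coboundary_symmetric[OF h] h by (auto simp: b_def m)
  \<comment> \<open>Dividing by the wedge's own coefficient makes \<open>s\<close> and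
    \<open>z\<close> agree at the standard wheel graphs, where the other wedges vanish.\<close>
  define c where "c ks = Poly_Mapping.lookup z (odd_wheels ks) / Poly_Mapping.lookup (?R ks) (odd_wheels ks)" for ks
  define s where "s = (\<Sum>ks\<in>?I. c ks *\<^sub>R ?R ks)"
  have s: "s \<in> symmetric_combs n"
    unfolding s_def by (intro subspace_sum subspace_symmetric_combs symmetric_combs_scaleR odd_wheel_wedge_symmetric)
  have ls: "Poly_Mapping.lookup s G = (\<Sum>ks\<in>?I. c ks * Poly_Mapping.lookup (?R ks) G)" for G
    by (simp add: s_def lookup_sum lookup_scaleR_poly_mapping)
  have "z - b - s = 0"
  proof (rule symmetric_combs_eq_0I[OF n])
    show "z - b - s \<in> symmetric_combs n"
      using subspace_symmetric_combs zs(1) b(2) s by (intro subspace_diff)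
    fix G assume G: "graph_on {1..n} G" "leaves {1..n} G \<noteq> {}"
    \<comment> \<open>As \<open>z\<close> is a cocycle, the term h\<partial> of the homotopy
      identity drops out and \<partial>h returns \<open>z\<close> on graphs with leaves.\<close>
    have "Poly_Mapping.lookup b G = Poly_Mapping.lookup z G"
      using coboundary_homotopy[of z m G] zs G by (simp add: b_def h_def m homotopy_0)
    moreover have "Poly_Mapping.lookup s G = 0"
      unfolding ls using lookup_odd_wheel_wedge_leaves[OF _ G(2)] by (intro sum.neutral) simp
    ultimately show "Poly_Mapping.lookup (z - b - s) G = 0" by (simp add: lookup_minus)
  next
    fix ks assume ks: "ks \<in> ?I"
    have "Poly_Mapping.lookup s (odd_wheels ks) = c ks * Poly_Mapping.lookup (?R ks) (odd_wheels ks)"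
      unfolding ls using lookup_odd_wheel_wedge_other[OF _ ks]
      by (subst sum.remove[OF finite_odd_wheel_indices ks]) (simp add: sum.neutral)
    also have "\<dots> = Poly_Mapping.lookup z (odd_wheels ks)"
      using lookup_odd_wheel_wedge_self[OF ks] by (simp add: c_def)
    moreover have "Poly_Mapping.lookup b (odd_wheels ks) = 0"
      unfolding b_def using lookup_coboundary_odd_wheels[OF h] ks by (simp add: m)
    ultimately show "Poly_Mapping.lookup (z - b - s) (odd_wheels ks) = 0" by (simp add: lookup_minus)
  qed
  then have "z = s + b" by (simp add: algebra_simps)
  then show thesis using that b(1) by (simp add: s_def)
qed

text \<open>The coefficient at \<open>odd_wheels ks\<close> annihilates coboundaries and the wedges
  of all other index lists, but not the wedge of \<open>ks\<close>.\<close>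

lemma odd_wheel_wedge_independent:
  assumes n: "n \<ge> 1" and J: "finite J" "J \<subseteq> odd_wheel_indices n" and ks: "ks \<in> J"
    and sum: "(\<Sum>ks\<in>J. c ks *\<^sub>R odd_wheel_wedge ks) \<in> coboundaries n"
  shows "c ks = 0"
proof -
  obtain m where m: "n = Suc m" using n by (cases n) auto
  then obtain \<beta> where \<beta>: "\<beta> \<in> symmetric_combs m" "(\<Sum>ks\<in>J. c ks *\<^sub>R odd_wheel_wedge ks) = coboundary m \<beta>"
    using sum coboundaries_eq[OF n] by auto
  have ksI: "ks \<in> odd_wheel_indices n" using J(2) ks by blast
  have "0 = Poly_Mapping.lookup (\<Sum>ks\<in>J. c ks *\<^sub>R odd_wheel_wedge ks) (odd_wheels ks)"
    using lookup_coboundary_odd_wheels[OF \<beta>(1)] ksI by (simp add: \<beta>(2) m)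
  also have "\<dots> = (\<Sum>ls\<in>J. c ls * Poly_Mapping.lookup (odd_wheel_wedge ls) (odd_wheels ks))"
    by (simp add: lookup_sum lookup_scaleR_poly_mapping)
  also have "\<dots> = c ks * Poly_Mapping.lookup (odd_wheel_wedge ks) (odd_wheels ks)"
  proof -
    have "(\<Sum>ls\<in>J - {ks}. c ls * Poly_Mapping.lookup (odd_wheel_wedge ls) (odd_wheels ks)) = 0"
    proof (rule sum.neutral, rule ballI)
      fix ls assume "ls \<in> J - {ks}"
      then show "c ls * Poly_Mapping.lookup (odd_wheel_wedge ls) (odd_wheels ks) = 0"
        using lookup_odd_wheel_wedge_other[OF _ ksI, of ls] J(2) by auto
    qed
    then show ?thesis using sum.remove[OF J(1) ks] by (metis (no_types, lifting) add_0_right)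
  qed
  finally show ?thesis using lookup_odd_wheel_wedge_self[OF ksI] by simp
qed

section \<open>Quotient spaces\<close>

lemma mem_coset_class: "x \<in> coset_class B z \<longleftrightarrow> x - z \<in> B"
  unfolding coset_class_def by (auto intro!: exI[of _ "x - z"])

lemma coset_class_eq_iff:
  assumes "subspace B"
  shows "coset_class B x = coset_class B y \<longleftrightarrow> x - y \<in> B"
proof
  assume "coset_class B x = coset_class B y"
  moreover have "x \<in> coset_class B x" using subspace_0[OF assms] by (simp add: mem_coset_class)
  ultimately show "x - y \<in> B" by (simp add: mem_coset_class)
next
  assume xy: "x - y \<in> B"
  have "u - x \<in> B \<longleftrightarrow> u - y \<in> B" for u
    using subspace_add[OF assms, of "u - x" "x - y"] subspace_diff[OF assms, of "u - y" "x - y"] xy by auto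
  then show "coset_class B x = coset_class B y" by (auto simp: mem_coset_class)
qed

lemma quotient_space_add:
  assumes "subspace B"
  shows "coset_class B x \<oplus>\<^bsub>quotient_space Z B\<^esub> coset_class B y = coset_class B (x + y)"
proof -
  have "\<exists>u v. w = u + v \<and> u - x \<in> B \<and> v - y \<in> B" if "w - (x + y) \<in> B" for w
    by (rule exI[of _ x], rule exI[of _ "w - x"]) (use that subspace_0[OF assms] in \<open>simp add: algebra_simps\<close>)
  moreover have "u + v - (x + y) \<in> B" if "u - x \<in> B" "v - y \<in> B" for u v
    using subspace_add[OF assms that] by (simp add: algebra_simps)
  ultimately have "{u + v | u v. u - x \<in> B \<and> v - y \<in> B} = {w. w - (x + y) \<in> B}" by blast
  then show ?thesis by (auto simp: quotient_space_def mem_coset_class)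
qed

lemma quotient_space_smult:
  assumes "subspace B"
  shows "c \<odot>\<^bsub>quotient_space Z B\<^esub> coset_class B x = coset_class B (c *\<^sub>R x)"
proof -
  have "\<exists>u v. w = c *\<^sub>R u + v \<and> u - x \<in> B \<and> v \<in> B" if "w - c *\<^sub>R x \<in> B" for w
    by (rule exI[of _ x], rule exI[of _ "w - c *\<^sub>R x"]) (use that subspace_0[OF assms] in simp)
  moreover have "c *\<^sub>R u + v - c *\<^sub>R x \<in> B" if "u - x \<in> B" "v \<in> B" for u v
    using subspace_add[OF assms subspace_scale[OF assms that(1)] that(2), of c] by (simp add: algebra_simps)
  ultimately have "{c *\<^sub>R u + v | u v. u - x \<in> B \<and> v \<in> B} = {w. w - c *\<^sub>R x \<in> B}" by blast
  then show ?thesis by (auto simp: quotient_space_def mem_coset_class)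
qed

lemma abelian_monoid_quotient_space:
  assumes "subspace Z" "subspace B"
  shows "abelian_monoid (quotient_space Z B)"
proof -
  have carrier: "carrier (quotient_space Z B) = coset_class B ` Z"
    and zero: "\<zero>\<^bsub>quotient_space Z B\<^esub> = coset_class B 0"
    by (simp_all add: quotient_space_def)
  show ?thesis
    by (rule abelian_monoidI)
       (auto simp: carrier zero quotient_space_add[OF assms(2)] add_ac 
          intro!: imageI subspace_add[OF assms(1)] subspace_0[OF assms(1)])
qed

lemma finsum_quotient_space:
  assumes Z: "subspace Z" and B: "subspace B" and "finite J" "\<And>i. i \<in> J \<Longrightarrow> v i \<in> Z"
  shows "(\<Oplus>\<^bsub>quotient_space Z B\<^esub>i\<in>J. c i \<odot>\<^bsub>quotient_space Z B\<^esub> coset_class B (v i)) =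
    coset_class B (\<Sum>i\<in>J. c i *\<^sub>R v i)"
proof -
  interpret abelian_monoid "quotient_space Z B" by (rule abelian_monoid_quotient_space[OF Z B])
  show ?thesis
    using assms(3,4)
  proof (induction J rule: finite_induct)
    case empty
    have "\<zero>\<^bsub>quotient_space Z B\<^esub> = coset_class B 0" by (simp add: quotient_space_def)
    then show ?case by simp
  next
    case (insert i J)
    have "c j \<odot>\<^bsub>quotient_space Z B\<^esub> coset_class B (v j) \<in> carrier (quotient_space Z B)" if "j \<in> insert i J" for j
      using subspace_scale[OF Z insert.prems[OF that], of "c j"]
      by (simp add: quotient_space_smult[OF B]) (simp add: quotient_space_def)
    then show ?case
      using insert by (simp add: Pi_def quotient_space_smult[OF B] quotient_space_add[OF B])
  qed
qed

section \<open>The basis of the cohomology\<close>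

theorem mainTheorem1:
  fixes n :: nat
  assumes "n \<ge> 1"
  shows "(\<forall>ks\<in>odd_wheel_indices n. odd_wheel_wedge ks \<in> cocycles n) \<and>
    is_basis_family (cohomology n) (odd_wheel_indices n)
      (\<lambda>ks. coset_class (coboundaries n) (odd_wheel_wedge ks))"
proof
  let ?I = "odd_wheel_indices n" and ?B = "coboundaries n"
  let ?Q = "quotient_space (cocycles n) ?B"
  note Z = subspace_cocycles[of n] and B = subspace_coboundaries[of n]
  show cocycle: "\<forall>ks\<in>?I. odd_wheel_wedge ks \<in> cocycles n" using odd_wheel_wedge_cocycle by blast
  \<comment> \<open>Combinations of classes are classes of combinations, so both conditions on a
    basis become statements about representatives modulo coboundaries.\<close>
  have finsum: "(\<Oplus>\<^bsub>?Q\<^esub>ks\<in>J. c ks \<odot>\<^bsub>?Q\<^esub> coset_class ?B (odd_wheel_wedge ks)) =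
      coset_class ?B (\<Sum>ks\<in>J. c ks *\<^sub>R odd_wheel_wedge ks)" if "finite J" "J \<subseteq> ?I" for J c
    using finsum_quotient_space[OF Z B that(1)] cocycle that(2) by blast
  have carrier: "carrier ?Q = coset_class ?B ` cocycles n" and zero: "\<zero>\<^bsub>?Q\<^esub> = coset_class ?B 0"
    by (simp_all add: quotient_space_def)
  show "is_basis_family (cohomology n) ?I (\<lambda>ks. coset_class ?B (odd_wheel_wedge ks))"
    unfolding is_basis_family_def cohomology_def
  proof (intro conjI allI impI ballI)
    show "(\<lambda>ks. coset_class ?B (odd_wheel_wedge ks)) \<in> ?I \<rightarrow> carrier ?Q"
      using cocycle by (auto simp: carrier)
    fix J c ks
    assume "finite J \<and> J \<subseteq> ?I \<and>
      (\<Oplus>\<^bsub>?Q\<^esub>ks\<in>J. c ks \<odot>\<^bsub>?Q\<^esub> coset_class ?B (odd_wheel_wedge ks)) = \<zero>\<^bsub>?Q\<^esub>" and ks: "ks \<in> J"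
    then have J: "finite J" "J \<subseteq> ?I"
      and "(\<Oplus>\<^bsub>?Q\<^esub>ks\<in>J. c ks \<odot>\<^bsub>?Q\<^esub> coset_class ?B (odd_wheel_wedge ks)) = \<zero>\<^bsub>?Q\<^esub>"
      by blast+
    then have "coset_class ?B (\<Sum>ks\<in>J. c ks *\<^sub>R odd_wheel_wedge ks) = coset_class ?B 0"
      unfolding finsum[OF J] zero by blast
    then have "(\<Sum>ks\<in>J. c ks *\<^sub>R odd_wheel_wedge ks) \<in> ?B" by (simp add: coset_class_eq_iff[OF B])
    then show "c ks = 0" by (rule odd_wheel_wedge_independent[OF assms J ks])
  next
    fix x assume "x \<in> carrier ?Q"
    then obtain z where z: "z \<in> cocycles n" "x = coset_class ?B z" by (auto simp: carrier)
    obtain c b where "b \<in> ?B" "z = (\<Sum>ks\<in>?I. c ks *\<^sub>R odd_wheel_wedge ks) + b"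
      using cocycle_decomposition[OF assms z(1)] .
    then have "x = coset_class ?B (\<Sum>ks\<in>?I. c ks *\<^sub>R odd_wheel_wedge ks)"
      by (simp add: z(2) coset_class_eq_iff[OF B])
    then show "\<exists>J c. finite J \<and> J \<subseteq> ?I \<and> x =
        (\<Oplus>\<^bsub>?Q\<^esub>ks\<in>J. c ks \<odot>\<^bsub>?Q\<^esub> coset_class ?B (odd_wheel_wedge ks))"
      using finsum[OF finite_odd_wheel_indices subset_refl] finite_odd_wheel_indices by blast
  qed
qed

end
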